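(* Let $a \in [0,\infty)$, $b \in \mathbb{R}$, $\sigma \in (0,\infty)$, and let $m$ be a L\'evy measure on $(0,\infty)$ with $\int_0^\infty z\, m(\mathrm{d}z) < \infty$. Let $(Y_t)_{t\geq 0}$ be the unique strong solution of the SDE $$\mathrm{d}Y_t = (a - bY_t)\,\mathrm{d}t + \sigma\sqrt{Y_t}\,\mathrm{d}W_t + \mathrm{d}J_t,\qquad t\in[0,\infty),$$ satisfying $\mathbb{P}(Y_0 = y_0) = 1$ with some $y_0\in[0,\infty)$. Then for all $u, v \in (-\infty,0]$ and all $t\in[0,\infty)$, $$\mathbb{E}\left[\exp\left\{uY_t + v\int_0^t Y_s\,\mathrm{d}s\right\}\right] = \exp\left\{\psi_{u,v}(t)\,y_0 + \int_0^t\left(a\,\psi_{u,v}(s) + \int_0^\infty\left(\mathrm{e}^{z\psi_{u,v}(s)} - 1\right) m(\mathrm{d}z)\right)\mathrm{d}s\right\},$$ where, with $\gamma_v := \sqrt{b^2 - 2\sigma^2 v}$, the function $\psi_{u,v}:[0,\infty)\to(-\infty,0]$ takes the form $$\psi_{u,v}(t) = \begin{cases} \dfrac{u\gamma_v\cosh\left(\frac{\gamma_v t}{2}\right) + (-ub+2v)\sinh\left(\frac{\gamma_v t}{2}\right)}{\gamma_v\cosh\left(\frac{\gamma_v t}{2}\right) + (-\sigma^2 u + b)\sinh\left(\frac{\gamma_v t}{2}\right)} & \text{if } v<0 \text{ or } b\neq 0,\\[3mm] \dfrac{u}{1-\frac{\sigma^2 u}{2}t} & \text{if } v=0 \text{ and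 } b=0,\end{cases}\qquad t\in[0,\infty).$$
   Context: $(W_t)_{t\geq0}$ is a one-dimensional standard Wiener process, and $(J_t)_{t\geq0}$ is a subordinator (increasing L\'evy process) with zero drift and L\'evy measure $m$ concentrated on $(0,\infty)$, i.e. $\mathbb{E}(\mathrm{e}^{uJ_t}) = \exp\{t\int_0^\infty(\mathrm{e}^{uz}-1)\,m(\mathrm{d}z)\}$ for all $t\geq0$ and all complex $u$ with $\mathrm{Re}(u)\leq0$. $Y_0$, $(W_t)_{t\geq0}$ and $(J_t)_{t\geq0}$ are independent. Under these assumptions, for any almost surely non-negative initial value $Y_0$ with $\mathbb{E}(Y_0)<\infty$, the SDE has a pathwise unique strong solution with $\mathbb{P}(Y_t\geq0 \text{ for all } t\geq0)=1$. *)

theory Defs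
  imports "HOL-Probability.Probability"
begin

text \<open>Processes are functions \<open>X :: real \<Rightarrow> 'a \<Rightarrow> real\<close> of time and outcome; only times
  \<open>t \<ge> 0\<close> are ever constrained.\<close>

definition cadlag :: "(real \<Rightarrow> real) \<Rightarrow> bool" where
  "cadlag x \<longleftrightarrow> (\<forall>t\<ge>0. (x \<longlongrightarrow> x t) (at_right t)) \<and> (\<forall>t>0. \<exists>l. (x \<longlongrightarrow> l) (at_left t))"

definition levy_measure_pos :: "real measure \<Rightarrow> bool" where
  "levy_measure_pos m \<longleftrightarrow> sets m = sets borel \<and> emeasure m {..0} = 0 \<and>
     (\<integral>\<^sup>+z. ennreal (min 1 (z\<^sup>2)) \<partial>m) < \<infinity>"

subsection \<open>Driving processes\<close>

context prob_space
begin

definition independent_increments :: "(real \<Rightarrow> 'a \<Rightarrow> real) \<Rightarrow> bool" where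
  "independent_increments X \<longleftrightarrow>
     (\<forall>(n::nat) (\<tau>::nat \<Rightarrow> real). 0 \<le> \<tau> 0 \<longrightarrow> (\<forall>i<n. \<tau> i \<le> \<tau> (Suc i)) \<longrightarrow>
        indep_vars (\<lambda>_. borel) (\<lambda>i \<omega>. X (\<tau> (Suc i)) \<omega> - X (\<tau> i) \<omega>) {..<n})"

definition wiener_process :: "(real \<Rightarrow> 'a \<Rightarrow> real) \<Rightarrow> bool" where
  "wiener_process W \<longleftrightarrow>
     (\<forall>t\<ge>0. random_variable borel (W t)) \<and>
     (AE \<omega> in M. W 0 \<omega> = 0) \<and>
     independent_increments W \<and>
     (\<forall>s t. 0 \<le> s \<longrightarrow> s < t \<longrightarrow>
        distributed M lborel (\<lambda>\<omega>. W t \<omega> - W s \<omega>) (normal_density 0 (sqrt (t - s)))) \<and>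
     (AE \<omega> in M. continuous_on {0..} (\<lambda>t. W t \<omega>))"

text \<open>Subordinator with zero drift and Levy measure \<open>m\<close>; both are encoded by the Laplace transform
  on the closed left half-plane.\<close>

definition subordinator :: "real measure \<Rightarrow> (real \<Rightarrow> 'a \<Rightarrow> real) \<Rightarrow> bool" where
  "subordinator m J \<longleftrightarrow>
     (\<forall>t\<ge>0. random_variable borel (J t)) \<and>
     (AE \<omega> in M. J 0 \<omega> = 0) \<and>
     independent_increments J \<and>
     (\<forall>s t. 0 \<le> s \<longrightarrow> s \<le> t \<longrightarrow>
        distr M borel (\<lambda>\<omega>. J t \<omega> - J s \<omega>) = distr M borel (J (t - s))) \<and>
     (AE \<omega> in M. cadlag (\<lambda>t. J t \<omega>)) \<and>
     (AE \<omega> in M. mono_on {0..} (\<lambda>t. J t \<omega>)) \<and>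
     (\<forall>t\<ge>0. \<forall>u::complex. Re u \<le> 0 \<longrightarrow>
        expectation (\<lambda>\<omega>. exp (u * complex_of_real (J t \<omega>))) =
        exp (complex_of_real t * (LINT z:{0<..}|m. exp (u * complex_of_real z) - 1)))"

subsection \<open>Generated sigma-algebras\<close>

definition process_sigma :: "real set \<Rightarrow> (real \<Rightarrow> 'a \<Rightarrow> real) \<Rightarrow> 'a measure" where
  "process_sigma T X = sigma (space M) (\<Union>t\<in>T. sets (vimage_algebra (space M) (X t) borel))"

definition independent_inputs ::
  "('a \<Rightarrow> real) \<Rightarrow> (real \<Rightarrow> 'a \<Rightarrow> real) \<Rightarrow> (real \<Rightarrow> 'a \<Rightarrow> real) \<Rightarrow> bool" where
  "independent_inputs \<xi> W J \<longleftrightarrow>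
     indep_sets (\<lambda>i::nat. [sets (vimage_algebra (space M) \<xi> borel),
                           sets (process_sigma {0..} W),
                           sets (process_sigma {0..} J)] ! i) {0, 1, 2}"

text \<open>The augmented filtration of \<open>(\<xi>, W, J)\<close>. The measure space need not be complete; all its
  measurable null sets are added.\<close>

definition augmented_filtration ::
  "('a \<Rightarrow> real) \<Rightarrow> (real \<Rightarrow> 'a \<Rightarrow> real) \<Rightarrow> (real \<Rightarrow> 'a \<Rightarrow> real) \<Rightarrow> real \<Rightarrow> 'a measure" where
  "augmented_filtration \<xi> W J t = sigma (space M)
     (sets (vimage_algebra (space M) \<xi> borel) \<union>
      sets (process_sigma {0..t} W) \<union> sets (process_sigma {0..t} J) \<union> null_sets M)"

lemma sets_process_sigma_mono: "S \<subseteq> T \<Longrightarrow> sets (process_sigma S X) \<subseteq> sets (process_sigma T X)"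
  unfolding process_sigma_def using sets.sets_into_space
  by (subst (1 2) sets_measure_of) (fastforce intro!: sigma_sets_mono' UN_mono)+

lemma filtration_augmented_filtration: "filtration (space M) (augmented_filtration \<xi> W J)"
proof
  have sub: "sets (vimage_algebra (space M) \<xi> borel) \<union>
      sets (process_sigma {0..t} W) \<union> sets (process_sigma {0..t} J) \<union> null_sets M
      \<subseteq> Pow (space M)" for t
    using sets.space_closed[of "process_sigma {0..t} W"] sets.space_closed[of "process_sigma {0..t} J"]
      sets.space_closed[of "vimage_algebra (space M) \<xi> borel"] sets.space_closed[of M]
    by (simp add: process_sigma_def space_measure_of_conv null_sets_def) blast
  show "space (augmented_filtration \<xi> W J t) = space M" for t
    by (simp add: augmented_filtration_def space_measure_of_conv)
  show "sets (augmented_filtration \<xi> W J s) \<subseteq> sets (augmented_filtration \<xi> W J t)"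
    if "s \<le> t" for s t
    unfolding augmented_filtration_def using that
    by (subst (1 2) sets_measure_of[OF sub])
      (intro sigma_sets_mono' Un_mono sets_process_sigma_mono order_refl, auto)
qed

subsection \<open>The Ito integral\<close>

definition tendsto_prob :: "(nat \<Rightarrow> 'a \<Rightarrow> real) \<Rightarrow> ('a \<Rightarrow> real) \<Rightarrow> bool" where
  "tendsto_prob X Z \<longleftrightarrow>
     (\<forall>\<epsilon>>0. (\<lambda>n. prob {\<omega> \<in> space M. \<bar>X n \<omega> - Z \<omega>\<bar> > \<epsilon>}) \<longlonglongrightarrow> 0)"

definition progressive :: "(real \<Rightarrow> 'a measure) \<Rightarrow> (real \<Rightarrow> 'a \<Rightarrow> real) \<Rightarrow> bool" where
  "progressive F H \<longleftrightarrow>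
     (\<forall>t\<ge>0. (\<lambda>(s, \<omega>). H s \<omega>) \<in> borel_measurable (restrict_space borel {0..t} \<Otimes>\<^sub>M F t))"

text \<open>A triple \<open>(k, \<tau>, \<xi>)\<close> stands for the simple process
  \<open>\<Sum>i<k. \<xi> i * 1(\<tau> i, \<tau> (i + 1)]\<close>.\<close>

definition simple_integrand ::
  "(real \<Rightarrow> 'a measure) \<Rightarrow> nat \<Rightarrow> (nat \<Rightarrow> real) \<Rightarrow> (nat \<Rightarrow> 'a \<Rightarrow> real) \<Rightarrow> bool" where
  "simple_integrand F k \<tau> \<xi> \<longleftrightarrow> 0 \<le> \<tau> 0 \<and> (\<forall>i<k. \<tau> i \<le> \<tau> (Suc i)) \<and>
     (\<forall>i<k. \<xi> i \<in> borel_measurable (F (\<tau> i)) \<and> (\<exists>C. \<forall>\<omega>\<in>space M. \<bar>\<xi> i \<omega>\<bar> \<le> C))"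

definition simple_process ::
  "nat \<Rightarrow> (nat \<Rightarrow> real) \<Rightarrow> (nat \<Rightarrow> 'a \<Rightarrow> real) \<Rightarrow> real \<Rightarrow> 'a \<Rightarrow> real" where
  "simple_process k \<tau> \<xi> s \<omega> = (\<Sum>i<k. \<xi> i \<omega> * indicator {\<tau> i<..\<tau> (Suc i)} s)"

definition simple_integral ::
  "nat \<Rightarrow> (nat \<Rightarrow> real) \<Rightarrow> (nat \<Rightarrow> 'a \<Rightarrow> real) \<Rightarrow> (real \<Rightarrow> 'a \<Rightarrow> real) \<Rightarrow> real \<Rightarrow> 'a \<Rightarrow> real" where
  "simple_integral k \<tau> \<xi> W t \<omega> =
     (\<Sum>i<k. \<xi> i \<omega> * (W (min (\<tau> (Suc i)) t) \<omega> - W (min (\<tau> i) t) \<omega>))"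

text \<open>\<open>has_ito_integral F W H I\<close>: the process \<open>I\<close> is the Ito integral of the progressively measurable,
  almost surely locally square-integrable \<open>H\<close> against \<open>W\<close>, i.e. the continuous adapted process
  obtained as the limit in probability of the elementary integrals of simple processes that
  approximate \<open>H\<close> in \<open>L\<^sup>2([0,t])\<close>, in probability, for every \<open>t\<close>.\<close>

definition has_ito_integral ::
  "(real \<Rightarrow> 'a measure) \<Rightarrow> (real \<Rightarrow> 'a \<Rightarrow> real) \<Rightarrow> (real \<Rightarrow> 'a \<Rightarrow> real) \<Rightarrow> (real \<Rightarrow> 'a \<Rightarrow> real) \<Rightarrow> bool"
where
  "has_ito_integral F W H I \<longleftrightarrow>
     progressive F H \<and>
     (AE \<omega> in M. \<forall>t\<ge>0. (\<integral>\<^sup>+s\<in>{0..t}. ennreal ((H s \<omega>)\<^sup>2) \<partial>lborel) < \<infinity>) \<and>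
     (\<forall>t\<ge>0. I t \<in> borel_measurable (F t)) \<and>
     (AE \<omega> in M. continuous_on {0..} (\<lambda>t. I t \<omega>)) \<and>
     (\<exists>k \<tau> \<xi>. (\<forall>n::nat. simple_integrand F (k n) (\<tau> n) (\<xi> n)) \<and>
        (\<forall>t\<ge>0.
           (\<forall>\<epsilon>>0. (\<lambda>n. prob {\<omega> \<in> space M.
               (\<integral>\<^sup>+s\<in>{0..t}. ennreal ((simple_process (k n) (\<tau> n) (\<xi> n) s \<omega> - H s \<omega>)\<^sup>2) \<partial>lborel)
                 > ennreal \<epsilon>}) \<longlonglongrightarrow> 0) \<and>
           tendsto_prob (\<lambda>n. simple_integral (k n) (\<tau> n) (\<xi> n) W t) (I t)))"

subsection \<open>The jump-type CIR equation\<close>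

text \<open>Strong solution of \<open>dY = (a - b Y) dt + \<sigma> sqrt Y dW + dJ\<close> with state space \<open>[0, \<infinity>)\<close>: non-negativity
  is required because \<open>sqrt\<close> is the odd extension of the square root on negative reals.\<close>

definition strong_solution ::
  "real \<Rightarrow> real \<Rightarrow> real \<Rightarrow> (real \<Rightarrow> 'a \<Rightarrow> real) \<Rightarrow> (real \<Rightarrow> 'a \<Rightarrow> real) \<Rightarrow> (real \<Rightarrow> 'a \<Rightarrow> real) \<Rightarrow> bool"
where
  "strong_solution a b \<sigma> W J Y \<longleftrightarrow>
     (\<forall>t\<ge>0. Y t \<in> borel_measurable (augmented_filtration (Y 0) W J t)) \<and>
     (\<forall>\<omega>\<in>space M. cadlag (\<lambda>t. Y t \<omega>)) \<and>
     (AE \<omega> in M. \<forall>t\<ge>0. 0 \<le> Y t \<omega>) \<and>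
     (\<exists>I. has_ito_integral (augmented_filtration (Y 0) W J) W (\<lambda>s \<omega>. sqrt (Y s \<omega>)) I \<and>
        (AE \<omega> in M. \<forall>t\<ge>0.
           Y t \<omega> = Y 0 \<omega> + (LBINT s:{0..t}. a - b * Y s \<omega>) + \<sigma> * I t \<omega> + J t \<omega>))"

end

definition cir_gamma :: "real \<Rightarrow> real \<Rightarrow> real \<Rightarrow> real" where
  "cir_gamma b \<sigma> v = sqrt (b\<^sup>2 - 2 * \<sigma>\<^sup>2 * v)"

definition cir_psi :: "real \<Rightarrow> real \<Rightarrow> real \<Rightarrow> real \<Rightarrow> real \<Rightarrow> real" where
  "cir_psi b \<sigma> u v t =
     (if v < 0 \<or> b \<noteq> 0 then
        (let g = cir_gamma b \<sigma> v in
          (u * g * cosh (g * t / 2) + (- u * b + 2 * v) * sinh (g * t / 2)) /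
          (g * cosh (g * t / 2) + (- \<sigma>\<^sup>2 * u + b) * sinh (g * t / 2)))
      else u / (1 - \<sigma>\<^sup>2 * u / 2 * t))"

end

theory Submission
  imports Defs
begin

text \<open>
  Fix \<open>t > 0\<close>, write \<open>\<psi>\<close> for \<open>cir_psi b \<sigma> u v\<close> and run it backwards: \<open>p s = \<psi> (t - s)\<close>. Since \<open>\<psi>\<close> solves
  the Riccati equation \<open>\<psi>' = \<sigma>\<^sup>2 / 2 * \<psi>\<^sup>2 - b * \<psi> + v\<close> with \<open>\<psi> 0 = u\<close>, integrating the deterministic \<open>p\<close> by
  parts against \<open>Y\<close> gives

  \<open>p s * Y s - p 0 * Y 0 + v * (\<integral>\<^sub>0\<^sup>s Y) - a * (\<integral>\<^sub>0\<^sup>s p) =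
    (\<integral>\<^sub>0\<^sup>s \<sigma> * p * sqrt Y dW) - 1/2 * (\<integral>\<^sub>0\<^sup>s \<sigma>\<^sup>2 * p\<^sup>2 * Y) + (\<integral>\<^sub>0\<^sup>s p dJ)\<close>.

  At \<open>s = t\<close> the left-hand side is \<open>u * Y t + v * (\<integral>\<^sub>0\<^sup>t Y)\<close> up to a constant. The Gaussian part of the
  right-hand side has the shape of the logarithm of an exponential martingale, and \<open>J\<close> is independent of
  \<open>W\<close>, so the exponential of the right-hand side should have expectation \<open>exp (\<integral>\<^sub>0\<^sup>t \<kappa> (p s) ds)\<close> with
  \<open>\<kappa> q = (\<integral> exp (z * q) - 1 dm)\<close>. This is the claimed formula.

  For an elementary integrand in place of \<open>sqrt Y\<close> and a piecewise constant \<open>p\<close> the expectation is computed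
  exactly, one grid cell at a time (\<open>exponential_martingale\<close>). The rest is a passage to the limit. The
  inequality of Lenglart turns convergence in probability of the elementary integrals at each fixed time into
  uniform convergence over the points of ever finer grids (\<open>ito_integral_uniform_approximation\<close>), and
  summation by parts along a path then makes the discrete exponents converge to the left-hand side, uniformly
  over the grid points (\<open>exponent_uniform_limit\<close>).

  Uniform integrability is the crux, because the elementary integrands obey no bound that is uniform in the
  approximation. They are switched off as soon as the next cell would push their quadratic variation above a
  level \<open>K\<close>. This decision is made at the left end of the cell, so the exact expectation survives, and it
  bounds the second moments by a constant that depends on \<open>K\<close>. On the other hand \<open>p \<le> 0\<close>, \<open>v \<le> 0\<close> and \<open>Y \<ge> 0\<close>
  bound the left-hand side from above at every time, hence, by uniform convergence, also the stopped discrete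
  exponents eventually, now by a constant independent of \<open>K\<close>. Letting first the mesh tend to \<open>0\<close> and then \<open>K\<close> to
  infinity yields the identity (\<open>expectation_eq_of_stopped_approximation\<close>, \<open>exponential_functional\<close>).
\<close>

section \<open>Independence of increments from the past\<close>

lemma finite_set_grid:
  fixes R :: "real set"
  assumes R: "finite R" "R \<subseteq> {0..T}" "0 \<in> R" "T \<in> R"
  obtains g :: "nat \<Rightarrow> real" and k where "g 0 = 0" "g k = T"
    "\<And>i. i < k \<Longrightarrow> g i < g (Suc i)" "g ` {..k} = R"
proof -
  define l where "l = sorted_list_of_set R"
  have l: "set l = R" "sorted l" "distinct l" "l \<noteq> []"
    using R by (auto simp: l_def)
  define k where "k = length l - 1"
  have len: "length l = Suc k"
    using l(4) by (simp add: k_def)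
  have img: "(!) l ` {..k} = R"
    using l(1) len by (auto simp: set_conv_nth image_def less_Suc_eq_le)
  have mono: "l ! i \<le> l ! j" if "i \<le> j" "j \<le> k" for i j
    using l(2) that len by (auto simp: sorted_iff_nth_mono)
  obtain i0 iT where i: "i0 \<le> k" "l ! i0 = 0" "iT \<le> k" "l ! iT = T"
    using img R(3,4) by (metis atMost_iff imageE)
  have "l ! 0 \<in> R" "l ! k \<in> R"
    using img by auto
  then have "l ! 0 = 0" "l ! k = T"
    using mono[of 0 i0] mono[of iT k] i R(2) by (auto intro!: antisym)
  moreover have "l ! i < l ! Suc i" if "i < k" for i
    using mono[of i "Suc i"] l(3) len that
    by (auto simp: order_less_le nth_eq_iff_index_eq)
  ultimately show ?thesis
    using that[of "(!) l" k] img by blast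
qed

context prob_space
begin

lemma sets_process_sigma:
  "sets (process_sigma A X) = sigma_sets (space M) (\<Union>t\<in>A. sets (vimage_algebra (space M) (X t) borel))"
  unfolding process_sigma_def
  by (rule sets_measure_of) (use sets.sets_into_space in fastforce)

lemma space_process_sigma [simp]: "space (process_sigma A X) = space M"
  by (simp add: process_sigma_def space_measure_of_conv)

lemma process_sigma_measurable:
  assumes "t \<in> A"
  shows "X t \<in> borel_measurable (process_sigma A X)"
proof (rule measurableI)
  fix B :: "real set" assume "B \<in> sets borel"
  then have "X t -` B \<inter> space M \<in> sets (vimage_algebra (space M) (X t) borel)"
    by (auto simp: sets_vimage_algebra2)
  then show "X t -` B \<inter> space (process_sigma A X) \<in> sets (process_sigma A X)"
    using assms by (auto simp: sets_process_sigma)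
qed auto

text \<open>Independence of increments speaks about finitely many increments only. The events of the past that depend on
  finitely many times are stable under intersection and generate the past. Adding the times \<open>0\<close> and \<open>s\<close> to such
  a finite set of times and telescoping from \<open>X 0 = 0\<close>, such an event is a function of increments over
  disjoint intervals before \<open>s\<close>, up to a null set.\<close>

lemma increment_indep_past:
  assumes X: "\<And>t. 0 \<le> t \<Longrightarrow> random_variable borel (X t)"
    and X0: "AE \<omega> in M. X 0 \<omega> = 0" and inc: "independent_increments X"
    and st: "0 \<le> s" "s \<le> t"
  shows "indep_set (sets (process_sigma {0..s} X))
    (sets (vimage_algebra (space M) (\<lambda>\<omega>. X t \<omega> - X s \<omega>) borel))"
proof -
  note [measurable] = X
  let ?cyl = "\<lambda>R B. {\<omega>\<in>space M. \<forall>r\<in>R. X r \<omega> \<in> B r}"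
  define C where "C = (\<lambda>(R, B). ?cyl R B) `
    {(R, B). finite R \<and> R \<subseteq> {0..s} \<and> (\<forall>r. B r \<in> sets (borel :: real measure))}"
  have C_I: "?cyl R B \<in> C" if "finite R" "R \<subseteq> {0..s}" "\<And>r. B r \<in> sets (borel :: real measure)" for R B
    unfolding C_def by (rule image_eqI[of _ _ "(R, B)"]) (simp_all add: that)
  have C_E: thesis if "A \<in> C" "\<And>R B. A = ?cyl R B \<Longrightarrow> finite R \<Longrightarrow> R \<subseteq> {0..s} \<Longrightarrow>
    (\<And>r. B r \<in> sets (borel :: real measure)) \<Longrightarrow> thesis" for A thesis
    using that(1) unfolding C_def by (elim imageE) (auto intro: that(2))
  have meas_s[measurable]: "random_variable borel (X s)" "random_variable borel (X t)"
    using st by auto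
  have cyl_ev: "?cyl R B \<in> events"
    if "finite R" "R \<subseteq> {0..s}" "\<And>r. B r \<in> sets borel" for R B
  proof -
    have "Measurable.pred M (\<lambda>\<omega>. \<forall>r\<in>R. X r \<omega> \<in> B r)"
      using that X by (intro pred_intros_finite(3)[OF that(1)]) (auto intro!: pred_sets2[OF that(3)])
    then show ?thesis
      by simp
  qed
  have indep: "prob (?cyl R B \<inter> ((\<lambda>\<omega>. X t \<omega> - X s \<omega>) -` C \<inter> space M)) =
      prob (?cyl R B) * prob ((\<lambda>\<omega>. X t \<omega> - X s \<omega>) -` C \<inter> space M)"
    if R: "finite R" "R \<subseteq> {0..s}" and B[measurable]: "\<And>r. B r \<in> sets borel" and C[measurable]: "C \<in> sets borel"
    for R B C
  proof -
    obtain g k where g: "g 0 = 0" "g k = s" "\<And>i. i < k \<Longrightarrow> g i < g (Suc i)" "g ` {..k} = insert 0 (insert s R)"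
      using finite_set_grid[of "insert 0 (insert s R)" s] R st by auto
    \<comment> \<open>The points of the past come first and \<open>t\<close> last; the final interval may be degenerate if \<open>t = s\<close>.\<close>
    define \<tau> where "\<tau> i = (if i \<le> k then g i else t)" for i
    define D where "D i \<omega> = X (\<tau> (Suc i)) \<omega> - X (\<tau> i) \<omega>" for i \<omega>
    have "indep_vars (\<lambda>_. borel) D {..<Suc k}"
      unfolding D_def
      using inc[unfolded independent_increments_def, rule_format, of \<tau> "Suc k"] g st
      by (force simp: \<tau>_def less_Suc_eq)
    note ind = this
    have D[measurable]: "random_variable borel (D i)" if "i \<le> k" for i
      using ind that by (auto simp: indep_vars_def2)
    have iv: "indep_var (PiM {..<k} (\<lambda>_. borel)) (\<lambda>\<omega>. \<lambda>i\<in>{..<k}. D i \<omega>)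
        (PiM {k} (\<lambda>_. borel)) (\<lambda>\<omega>. \<lambda>i\<in>{k}. D i \<omega>)"
      by (rule indep_var_restrict[OF ind]) auto
    define E where "E = {f \<in> space (PiM {..<k} (\<lambda>_. borel :: real measure)).
      \<forall>j\<in>{j\<in>{..k}. g j \<in> R}. (\<Sum>i<j. f i) \<in> B (g j)}"
    have [measurable]: "E \<in> sets (PiM {..<k} (\<lambda>_. borel))"
    proof -
      have "Measurable.pred (PiM {..<k} (\<lambda>_. borel)) (\<lambda>f. \<forall>j\<in>{j\<in>{..k}. g j \<in> R}. (\<Sum>i<j. f i) \<in> B (g j))"
        by (intro pred_intros_finite(3) pred_sets2[OF B]) auto
      then show ?thesis unfolding E_def by simp
    qed
    define E2 where "E2 = {f \<in> space (PiM {k} (\<lambda>_. borel :: real measure)). f k \<in> C}"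
    have [measurable]: "E2 \<in> sets (PiM {k} (\<lambda>_. borel))"
      unfolding E2_def by measurable
    have Dk: "D k \<omega> = X t \<omega> - X s \<omega>" for \<omega>
      using g by (simp add: D_def \<tau>_def)
    have "AE \<omega> in M. \<forall>j\<le>k. X (g j) \<omega> = (\<Sum>i<j. D i \<omega>)"
      using X0
    proof eventually_elim
      case (elim \<omega>)
      have "j \<le> k \<Longrightarrow> X (g j) \<omega> = (\<Sum>i<j. D i \<omega>)" for j
        by (induction j) (auto simp: D_def \<tau>_def g elim)
      then show ?case by blast
    qed
    then have AE_cyl: "AE \<omega> in M. (\<omega> \<in> ?cyl R B) = (\<omega> \<in> (\<lambda>\<omega>. \<lambda>i\<in>{..<k}. D i \<omega>) -` E \<inter> space M)"
    proof eventually_elim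
      case (elim \<omega>)
      have "(\<Sum>i<j. (\<lambda>i\<in>{..<k}. D i \<omega>) i) = X (g j) \<omega>" if "j \<le> k" for j
        using elim that by (auto intro!: sum.cong)
      moreover have "R = g ` {j\<in>{..k}. g j \<in> R}"
        using g(4) by auto
      then have "(\<forall>r\<in>R. X r \<omega> \<in> B r) = (\<forall>r\<in>g ` {j\<in>{..k}. g j \<in> R}. X r \<omega> \<in> B r)"
        by simp
      then have "(\<forall>r\<in>R. X r \<omega> \<in> B r) = (\<forall>j\<in>{j\<in>{..k}. g j \<in> R}. X (g j) \<omega> \<in> B (g j))"
        by blast
      ultimately have "(\<forall>j\<in>{j\<in>{..k}. g j \<in> R}. (\<Sum>i<j. (\<lambda>i\<in>{..<k}. D i \<omega>) i) \<in> B (g j)) = (\<forall>r\<in>R. X r \<omega> \<in> B r)"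
        by simp
      then show ?case
        unfolding E_def by (auto simp: space_PiM PiE_def extensional_def)
    qed
    have m1: "(\<lambda>\<omega>. \<lambda>i\<in>{..<k}. D i \<omega>) -` E \<inter> space M \<in> events"
      using iv by (auto intro!: measurable_sets[of _ M "PiM {..<k} (\<lambda>_. borel)"] simp: indep_var_eq)
    have V_eq: "(\<lambda>\<omega>. X t \<omega> - X s \<omega>) -` C \<inter> space M = (\<lambda>\<omega>. \<lambda>i\<in>{k}. D i \<omega>) -` E2 \<inter> space M"
      using Dk by (auto simp: E2_def space_PiM PiE_def extensional_def)
    have m2: "(\<lambda>\<omega>. X t \<omega> - X s \<omega>) -` C \<inter> space M \<in> events"
      by (intro measurable_sets[OF _ C]) simp
    have "prob (?cyl R B \<inter> ((\<lambda>\<omega>. X t \<omega> - X s \<omega>) -` C \<inter> space M)) =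
      prob (((\<lambda>\<omega>. \<lambda>i\<in>{..<k}. D i \<omega>) -` E \<inter> space M) \<inter> ((\<lambda>\<omega>. X t \<omega> - X s \<omega>) -` C \<inter> space M))"
      using AE_cyl m1 m2 cyl_ev[OF R B]
      by (intro finite_measure_eq_AE) (auto elim: AE_mp)
    also have "\<dots> = prob ((\<lambda>\<omega>. \<lambda>i\<in>{..<k}. D i \<omega>) -` E \<inter> space M) * prob ((\<lambda>\<omega>. X t \<omega> - X s \<omega>) -` C \<inter> space M)"
      unfolding V_eq
      by (rule indep_setD[where A="sigma_sets (space M) {(\<lambda>\<omega>. \<lambda>i\<in>{..<k}. D i \<omega>) -` A \<inter> space M |A. A \<in> sets (PiM {..<k} (\<lambda>_. borel))}"
            and B="sigma_sets (space M) {(\<lambda>\<omega>. \<lambda>i\<in>{k}. D i \<omega>) -` A \<inter> space M |A. A \<in> sets (PiM {k} (\<lambda>_. borel))}"])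
        (use iv in \<open>auto simp: indep_var_eq intro!: sigma_sets.Basic\<close>)
    also have "prob ((\<lambda>\<omega>. \<lambda>i\<in>{..<k}. D i \<omega>) -` E \<inter> space M) = prob (?cyl R B)"
      using AE_cyl m1 cyl_ev[OF R B]
      by (intro finite_measure_eq_AE) (auto elim: AE_mp)
    finally show ?thesis .
  qed
  let ?V = "sets (vimage_algebra (space M) (\<lambda>\<omega>. X t \<omega> - X s \<omega>) borel)"
  have "indep_set C ?V"
  proof (rule indep_setI)
    show "C \<subseteq> events"
    proof
      fix a assume "a \<in> C"
      then show "a \<in> events" using cyl_ev by (elim C_E) simp
    qed
    have "(\<lambda>\<omega>. X t \<omega> - X s \<omega>) -` A \<inter> space M \<in> events" if "A \<in> sets borel" for A
      by (rule measurable_sets[OF _ that]) simp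
    then show "?V \<subseteq> events"
      by (auto simp: sets_vimage_algebra2)
    fix a b assume a: "a \<in> C" and "b \<in> ?V"
    then obtain A where b: "b = (\<lambda>\<omega>. X t \<omega> - X s \<omega>) -` A \<inter> space M" "A \<in> sets borel"
      by (auto simp: sets_vimage_algebra2)
    from a show "prob (a \<inter> b) = prob a * prob b"
      using indep b by (elim C_E) simp
  qed
  moreover have "Int_stable C"
  proof (rule Int_stableI)
    fix a1 a2 assume "a1 \<in> C" "a2 \<in> C"
    obtain R1 B1 where 1: "a1 = ?cyl R1 B1" "finite R1" "R1 \<subseteq> {0..s}" "\<And>r. B1 r \<in> sets borel"
      by (rule C_E[OF \<open>a1 \<in> C\<close>]) (rule that; assumption)
    obtain R2 B2 where 2: "a2 = ?cyl R2 B2" "finite R2" "R2 \<subseteq> {0..s}" "\<And>r. B2 r \<in> sets borel"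
      by (rule C_E[OF \<open>a2 \<in> C\<close>]) (rule that; assumption)
    let ?B = "\<lambda>r. (if r \<in> R1 then B1 r else UNIV) \<inter> (if r \<in> R2 then B2 r else UNIV)"
    have "?cyl (R1 \<union> R2) ?B \<in> C"
      by (rule C_I) (use 1 2 in auto)
    moreover have "?cyl (R1 \<union> R2) ?B = a1 \<inter> a2"
      unfolding 1 2 by auto
    ultimately show "a1 \<inter> a2 \<in> C"
      by (simp only:)
  qed
  ultimately have "indep_set (sigma_sets (space M) C) (sigma_sets (space M) ?V)"
    by (rule indep_set_sigma_sets) (rule sets.Int_stable)
  moreover have "sigma_sets (space M) ?V = ?V"
    using sets.sigma_sets_eq[of "vimage_algebra (space M) (\<lambda>\<omega>. X t \<omega> - X s \<omega>) borel"]
    unfolding space_vimage_algebra .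
  moreover have "sets (process_sigma {0..s} X) \<subseteq> sigma_sets (space M) C"
    unfolding sets_process_sigma
  proof (rule sigma_sets_mono, rule subsetI)
    fix A assume "A \<in> (\<Union>t\<in>{0..s}. sets (vimage_algebra (space M) (X t) borel))"
    then obtain r where r: "r \<in> {0..s}" and "A \<in> sets (vimage_algebra (space M) (X r) borel)"
      by (rule UN_E)
    then obtain B where B: "B \<in> sets borel" "A = X r -` B \<inter> space M"
      by (auto simp: sets_vimage_algebra2)
    have "?cyl {r} (\<lambda>_. B) \<in> C"
      by (rule C_I) (use r B(1) in simp_all)
    moreover have "?cyl {r} (\<lambda>_. B) = A"
      unfolding B(2) by auto
    ultimately have "A \<in> C"
      by (simp only:)
    then show "A \<in> sigma_sets (space M) C"
      by (rule sigma_sets.Basic)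
  qed
  ultimately show ?thesis
    by (auto simp: indep_sets2_eq)
qed

lemma indep_set_mono: "indep_set A B \<Longrightarrow> A' \<subseteq> A \<Longrightarrow> indep_set A' B"
  unfolding indep_sets2_eq by (simp add: subset_iff)

text \<open>The past of one driving process is enlarged by everything that is independent of that process (the initial
  value and the other driving process) and by the null sets. Products of one event of each kind form a
  generator that is stable under intersection; listing the whole space next to the null sets makes it contain
  the three families.\<close>

lemma increment_indep_join:
  assumes X: "\<And>t. 0 \<le> t \<Longrightarrow> random_variable borel (X t)"
    and X0: "AE \<omega> in M. X 0 \<omega> = 0" and inc: "independent_increments X"
    and st: "0 \<le> s" "s \<le> t"
    and H: "Int_stable H" "space M \<in> H" and ind: "indep_set H (sets (process_sigma {0..} X))"
  shows "indep_set (sigma_sets (space M) (H \<union> sets (process_sigma {0..s} X) \<union> null_sets M))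
    (sets (vimage_algebra (space M) (\<lambda>\<omega>. X t \<omega> - X s \<omega>) borel))"
proof -
  let ?P = "sets (process_sigma {0..s} X)" and ?N = "insert (space M) (null_sets M)"
  let ?V = "sets (vimage_algebra (space M) (\<lambda>\<omega>. X t \<omega> - X s \<omega>) borel)"
  define G where "G = (\<lambda>(A, B, D). A \<inter> B \<inter> D) ` (H \<times> ?P \<times> ?N)"
  note past = increment_indep_past[OF X X0 inc st]
  have Hev: "H \<subseteq> events" and Pev: "?P \<subseteq> events" and Vev: "?V \<subseteq> events"
    using indep_setD_ev1[OF ind] indep_setD_ev1[OF past] indep_setD_ev2[OF past] by auto
  have V_sub: "?V \<subseteq> sets (process_sigma {0..} X)"
  proof -
    have "X t \<in> borel_measurable (process_sigma {0..} X)" "X s \<in> borel_measurable (process_sigma {0..} X)"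
      using st by (auto intro: process_sigma_measurable)
    then have "(\<lambda>\<omega>. X t \<omega> - X s \<omega>) \<in> borel_measurable (process_sigma {0..} X)"
      by (rule borel_measurable_diff)
    then have "(\<lambda>\<omega>. X t \<omega> - X s \<omega>) -` A \<inter> space M \<in> sets (process_sigma {0..} X)" if "A \<in> sets borel" for A
      using measurable_sets[OF _ that, of "\<lambda>\<omega>. X t \<omega> - X s \<omega>" "process_sigma {0..} X"] by simp
    then show ?thesis
      by (auto simp: sets_vimage_algebra2)
  qed
  have P_sub: "?P \<subseteq> sets (process_sigma {0..} X)"
    by (rule sets_process_sigma_mono) auto
  have "indep_set G ?V"
  proof (rule indep_setI[OF _ Vev])
    show "G \<subseteq> events"
    proof
      fix a assume "a \<in> G"
      then obtain A B D where "a = A \<inter> B \<inter> D" "A \<in> H" "B \<in> ?P" "D \<in> ?N"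
        by (auto simp: G_def)
      then show "a \<in> events"
        using Hev Pev by (auto intro!: sets.Int)
    qed
    fix a C assume "a \<in> G" and C: "C \<in> ?V"
    then obtain A B D where a: "a = A \<inter> B \<inter> D" "A \<in> H" "B \<in> ?P" and D: "D \<in> ?N"
      by (auto simp: G_def)
    have ev: "A \<in> events" "B \<in> events" "C \<in> events"
      using a C Hev Pev Vev by auto
    show "prob (a \<inter> C) = prob a * prob C"
    proof (cases "D = space M")
      case True
      have "a \<inter> C = A \<inter> (B \<inter> C)" "a = A \<inter> B"
        using a True sets.sets_into_space[OF ev(2)] by auto
      moreover have "prob (A \<inter> (B \<inter> C)) = prob A * prob (B \<inter> C)"
        using a C V_sub P_sub by (intro indep_setD[OF ind]) (auto intro: sets.Int)
      moreover have "prob (A \<inter> B) = prob A * prob B"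
        using a C V_sub P_sub by (intro indep_setD[OF ind]) auto
      moreover have "prob (B \<inter> C) = prob B * prob C"
        using a C by (intro indep_setD[OF past])
      ultimately show ?thesis by simp
    next
      case False
      then have D: "D \<in> null_sets M" using D by simp
      then have "A \<inter> B \<inter> D \<in> null_sets M"
        using ev by (intro null_set_Int1 sets.Int)
      moreover then have "A \<inter> B \<inter> D \<inter> C \<in> null_sets M"
        using ev by (intro null_set_Int2[of _ M C])
      ultimately show ?thesis
        unfolding a by (simp add: measure_eq_0_null_sets)
    qed
  qed
  moreover have "Int_stable G"
  proof (rule Int_stableI)
    fix a b assume "a \<in> G" "b \<in> G"
    then obtain A B D A' B' D' where *: "a = A \<inter> B \<inter> D" "A \<in> H" "B \<in> ?P" "D \<in> ?N"
      "b = A' \<inter> B' \<inter> D'" "A' \<in> H" "B' \<in> ?P" "D' \<in> ?N"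
      by (auto simp: G_def)
    have "D \<inter> D' \<in> ?N"
      using *(4,8) by (auto intro: null_set_Int1 null_set_Int2)
    moreover have "a \<inter> b = (A \<inter> A') \<inter> (B \<inter> B') \<inter> (D \<inter> D')"
      using * by auto
    moreover have "A \<inter> A' \<in> H" "B \<inter> B' \<in> ?P"
      using * H by (auto simp: Int_stable_def)
    ultimately show "a \<inter> b \<in> G"
      unfolding G_def by (intro image_eqI[of _ _ "(A \<inter> A', B \<inter> B', D \<inter> D')"]) auto
  qed
  ultimately have "indep_set (sigma_sets (space M) G) (sigma_sets (space M) ?V)"
    by (rule indep_set_sigma_sets) (rule sets.Int_stable)
  then have "indep_set (sigma_sets (space M) G) ?V"
    using sets.sigma_sets_eq[of "vimage_algebra (space M) (\<lambda>\<omega>. X t \<omega> - X s \<omega>) borel"]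
    unfolding space_vimage_algebra by (simp only:)
  moreover have "sigma_sets (space M) (H \<union> ?P \<union> null_sets M) \<subseteq> sigma_sets (space M) G"
  proof (rule sigma_sets_mono, rule subsetI)
    have sp: "space M \<in> ?P"
      using sets.top[of "process_sigma {0..s} X"] by simp
    fix A assume A: "A \<in> H \<union> ?P \<union> null_sets M"
    then consider "A \<in> H" | "A \<in> ?P" | "A \<in> null_sets M"
      by (elim UnE)
    then have "A \<in> G"
    proof cases
      case 1
      then have "A \<subseteq> space M"
        by (rule sets.sets_into_space[OF subsetD[OF Hev]])
      then have "A \<inter> space M \<inter> space M = A" by auto
      then show ?thesis
        using 1 sp unfolding G_def by (intro image_eqI[of _ _ "(A, space M, space M)"]) simp_all
    next
      case 2
      then have "A \<subseteq> space M"
        by (rule sets.sets_into_space[OF subsetD[OF Pev]])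
      then have "space M \<inter> A \<inter> space M = A" by auto
      then show ?thesis
        using 2 H unfolding G_def by (intro image_eqI[of _ _ "(space M, A, space M)"]) simp_all
    next
      case 3
      then have "A \<subseteq> space M"
        by (rule sets.sets_into_space[OF null_setsD2])
      then have "space M \<inter> space M \<inter> A = A" by auto
      then show ?thesis
        using 3 sp H unfolding G_def by (intro image_eqI[of _ _ "(space M, space M, A)"]) simp_all
    qed
    then show "A \<in> sigma_sets (space M) G"
      by (rule sigma_sets.Basic)
  qed
  ultimately show ?thesis
    by (rule indep_set_mono)
qed

text \<open>Fubini for an increment and a quantity known before it: the increment may be integrated out with the past
  held fixed. This replaces conditional expectations throughout.\<close>

lemma nn_integral_indep:
  assumes G: "space G = space M" "indep_set (sets G) (sets (vimage_algebra (space M) V borel))"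
    and X: "X \<in> measurable G N" and V: "random_variable borel (V :: 'a \<Rightarrow> real)"
    and \<Phi>: "\<Phi> \<in> borel_measurable (N \<Otimes>\<^sub>M borel)"
  shows "(\<integral>\<^sup>+\<omega>. \<Phi> (X \<omega>, V \<omega>) \<partial>M) = (\<integral>\<^sup>+\<omega>. (\<integral>\<^sup>+v. \<Phi> (X \<omega>, v) \<partial>distr M borel V) \<partial>M)"
proof -
  have Gev: "sets G \<subseteq> events"
    using indep_setD_ev1[OF G(2)] .
  have XM[measurable]: "X \<in> measurable M N"
    using X Gev G(1) unfolding measurable_def by (simp add: subset_iff)
  note [measurable] = V \<Phi>
  interpret V: prob_space "distr M borel V" by (rule prob_space_distr) simp
  interpret X: prob_space "distr M N X" by (rule prob_space_distr) simp
  have d: "distr M N X \<Otimes>\<^sub>M distr M borel V = distr M (N \<Otimes>\<^sub>M borel) (\<lambda>x. (X x, V x))"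
  proof (rule pair_measure_eqI)
    show "sigma_finite_measure (distr M N X)" "sigma_finite_measure (distr M borel V)"
      by (rule X.sigma_finite_measure_axioms V.sigma_finite_measure_axioms)+
    show "sets (distr M N X \<Otimes>\<^sub>M distr M borel V) = sets (distr M (N \<Otimes>\<^sub>M borel) (\<lambda>x. (X x, V x)))"
      by (simp cong: sets_pair_measure_cong)
    fix A B assume "A \<in> sets (distr M N X)" "B \<in> sets (distr M borel V)"
    then have [measurable]: "A \<in> sets N" "B \<in> sets borel" by simp_all
    have "prob ((X -` A \<inter> space M) \<inter> (V -` B \<inter> space M)) = prob (X -` A \<inter> space M) * prob (V -` B \<inter> space M)"
    proof (rule indep_setD[OF G(2)])
      show "X -` A \<inter> space M \<in> sets G"
        using measurable_sets[OF X, of A] by (simp add: G(1))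
      show "V -` B \<inter> space M \<in> sets (vimage_algebra (space M) V borel)"
        by (auto simp: sets_vimage_algebra2)
    qed
    moreover have "(\<lambda>x. (X x, V x)) -` (A \<times> B) \<inter> space M = (X -` A \<inter> space M) \<inter> (V -` B \<inter> space M)"
      by auto
    ultimately show "emeasure (distr M N X) A * emeasure (distr M borel V) B =
      emeasure (distr M (N \<Otimes>\<^sub>M borel) (\<lambda>x. (X x, V x))) (A \<times> B)"
      by (simp add: emeasure_distr emeasure_eq_measure ennreal_mult)
  qed
  have \<Phi>': "\<Phi> \<in> borel_measurable (distr M N X \<Otimes>\<^sub>M distr M borel V)"
    unfolding d by simp
  have "(\<integral>\<^sup>+\<omega>. \<Phi> (X \<omega>, V \<omega>) \<partial>M) = integral\<^sup>N (distr M N X \<Otimes>\<^sub>M distr M borel V) \<Phi>"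
    unfolding d by (subst nn_integral_distr) auto
  also have "\<dots> = (\<integral>\<^sup>+x. (\<integral>\<^sup>+v. \<Phi> (x, v) \<partial>distr M borel V) \<partial>distr M N X)"
    by (rule V.nn_integral_fst[OF \<Phi>', symmetric])
  also have "\<dots> = (\<integral>\<^sup>+\<omega>. (\<integral>\<^sup>+v. \<Phi> (X \<omega>, v) \<partial>distr M borel V) \<partial>M)"
    by (rule nn_integral_distr) (auto intro!: V.borel_measurable_nn_integral)
  finally show ?thesis .
qed

end

section \<open>Expectations over a single time step\<close>

text \<open>Completing the square turns the integrand into another normal density.\<close>

lemma nn_integral_normal_exp:
  assumes "0 < \<delta>"
  shows "(\<integral>\<^sup>+w. ennreal (exp (c * w - c\<^sup>2 * \<delta> / 2)) \<partial>density lborel (\<lambda>x. ennreal (normal_density 0 (sqrt \<delta>) x))) = 1"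
proof -
  have "normal_density 0 (sqrt \<delta>) w * exp (c * w - c\<^sup>2 * \<delta> / 2) = normal_density (c * \<delta>) (sqrt \<delta>) w" for w
  proof -
    have "- w\<^sup>2 / (2 * \<delta>) + (c * w - c\<^sup>2 * \<delta> / 2) = - (w - c * \<delta>)\<^sup>2 / (2 * \<delta>)"
      using assms by (simp add: field_simps power2_eq_square)
    then show ?thesis
      using assms by (simp add: normal_density_def exp_add[symmetric])
  qed
  then have "(\<integral>\<^sup>+w. ennreal (exp (c * w - c\<^sup>2 * \<delta> / 2)) \<partial>density lborel (\<lambda>x. ennreal (normal_density 0 (sqrt \<delta>) x)))
    = (\<integral>\<^sup>+w. ennreal (normal_density (c * \<delta>) (sqrt \<delta>) w) \<partial>lborel)"
    by (subst nn_integral_density) (auto simp: ennreal_mult[symmetric] intro!: nn_integral_cong)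
  also have "\<dots> = ennreal (\<integral>w. normal_density (c * \<delta>) (sqrt \<delta>) w \<partial>lborel)"
    using assms by (intro nn_integral_eq_integral integrable_normal_density) auto
  finally show ?thesis
    using assms by simp
qed

lemma nn_integral_normal_square:
  assumes "0 < \<delta>"
  shows "(\<integral>\<^sup>+w. ennreal ((x + c * w)\<^sup>2) \<partial>density lborel (\<lambda>x. ennreal (normal_density 0 (sqrt \<delta>) x))) =
    ennreal (x\<^sup>2 + c\<^sup>2 * \<delta>)"
proof -
  let ?n = "normal_density 0 (sqrt \<delta>)"
  have s: "0 < sqrt \<delta>" using assms by simp
  have 0: "has_bochner_integral lborel ?n 1"
    using s by (simp add: has_bochner_integral_iff)
  have 1: "has_bochner_integral lborel (\<lambda>w. ?n w * w) 0"
    using normal_moment_nz_1[OF s, of 0] .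
  have 2: "has_bochner_integral lborel (\<lambda>w. ?n w * w\<^sup>2) \<delta>"
    using normal_moment_even[OF s, of 0 1] assms by simp
  have "has_bochner_integral lborel (\<lambda>w. x\<^sup>2 * ?n w + 2 * x * c * (?n w * w) + c\<^sup>2 * (?n w * w\<^sup>2))
     (x\<^sup>2 * 1 + 2 * x * c * 0 + c\<^sup>2 * \<delta>)"
    by (intro has_bochner_integral_add has_bochner_integral_mult_right 0 1 2)
  also have "(\<lambda>w. x\<^sup>2 * ?n w + 2 * x * c * (?n w * w) + c\<^sup>2 * (?n w * w\<^sup>2)) = (\<lambda>w. ?n w * (x + c * w)\<^sup>2)"
    by (auto simp: power2_eq_square algebra_simps)
  finally have h: "has_bochner_integral lborel (\<lambda>w. ?n w * (x + c * w)\<^sup>2) (x\<^sup>2 + c\<^sup>2 * \<delta>)"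
    by simp
  have "(\<integral>\<^sup>+w. ennreal ((x + c * w)\<^sup>2) \<partial>density lborel (\<lambda>x. ennreal (?n x))) =
    (\<integral>\<^sup>+w. ennreal (?n w * (x + c * w)\<^sup>2) \<partial>lborel)"
    by (subst nn_integral_density) (auto simp: ennreal_mult[symmetric])
  also have "\<dots> = ennreal (\<integral>w. ?n w * (x + c * w)\<^sup>2 \<partial>lborel)"
    using h by (intro nn_integral_eq_integral) (auto simp: has_bochner_integral_iff)
  finally show ?thesis
    using h by (simp add: has_bochner_integral_iff)
qed

lemma measurable_sets_mono:
  "space A = space B \<Longrightarrow> sets A \<subseteq> sets B \<Longrightarrow> f \<in> measurable A N \<Longrightarrow> f \<in> measurable B N"
  unfolding measurable_def by (simp add: subset_iff)

text \<open>The logarithm of the Laplace transform of the subordinator at time \<open>1\<close>, for \<open>p \<le> 0\<close>.\<close>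

definition levy_exponent :: "real measure \<Rightarrow> real \<Rightarrow> real" where
  "levy_exponent m p = (LINT z:{0<..}|m. exp (z * p) - 1)"

locale driving_noise = prob_space M for M :: "'a measure" +
  fixes m :: "real measure" and \<xi> :: "'a \<Rightarrow> real" and W J :: "real \<Rightarrow> 'a \<Rightarrow> real"
  assumes wiener: "wiener_process W" and sub: "subordinator m J"
    and inputs: "independent_inputs \<xi> W J"
begin

abbreviation F :: "real \<Rightarrow> 'a measure" where "F \<equiv> augmented_filtration \<xi> W J"

lemma W_measurable [measurable]: "0 \<le> t \<Longrightarrow> random_variable borel (W t)"
  and J_measurable [measurable]: "0 \<le> t \<Longrightarrow> random_variable borel (J t)"
  using wiener sub by (auto simp: wiener_process_def subordinator_def)

lemma input_events:
  "sets (vimage_algebra (space M) \<xi> borel) \<subseteq> events"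
  "sets (process_sigma {0..} W) \<subseteq> events" "sets (process_sigma {0..} J) \<subseteq> events"
proof -
  have "i \<in> {0, 1, 2} \<Longrightarrow> [sets (vimage_algebra (space M) \<xi> borel), sets (process_sigma {0..} W),
                           sets (process_sigma {0..} J)] ! i \<subseteq> events" for i :: nat
    using inputs unfolding independent_inputs_def indep_sets_def by blast
  from this[of 0] this[of 1] this[of 2] show
    "sets (vimage_algebra (space M) \<xi> borel) \<subseteq> events"
    "sets (process_sigma {0..} W) \<subseteq> events" "sets (process_sigma {0..} J) \<subseteq> events"
    by simp_all
qed

lemma space_F [simp]: "space (F s) = space M"
  by (simp add: augmented_filtration_def space_measure_of_conv)

lemma process_events: "A \<subseteq> {0..} \<Longrightarrow> sets (process_sigma A W) \<subseteq> events"
   "A \<subseteq> {0..} \<Longrightarrow> sets (process_sigma A J) \<subseteq> events"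
  using input_events sets_process_sigma_mono[of A "{0..}"] by blast+

lemma F_generator_subset:
  "A \<subseteq> {0..} \<Longrightarrow> B \<subseteq> {0..} \<Longrightarrow> sets (vimage_algebra (space M) \<xi> borel) \<union>
      sets (process_sigma A W) \<union> sets (process_sigma B J) \<union> null_sets M \<subseteq> events"
  by (intro Un_least input_events process_events subsetI[OF null_setsD2])

lemma sets_F:
  "sets (F s) = sigma_sets (space M) (sets (vimage_algebra (space M) \<xi> borel) \<union>
      sets (process_sigma {0..s} W) \<union> sets (process_sigma {0..s} J) \<union> null_sets M)"
  unfolding augmented_filtration_def
  by (intro sets_measure_of order_trans[OF F_generator_subset sets.space_closed]) auto

lemma sets_F_events: "sets (F s) \<subseteq> events"
  unfolding sets_F
  by (intro sets.sigma_sets_subset F_generator_subset) auto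

lemma sets_F_mono: "s \<le> t \<Longrightarrow> sets (F s) \<subseteq> sets (F t)"
  using filtration.sets_F_mono[OF filtration_augmented_filtration[of \<xi> W J]] .

lemma measurable_F_mono: "s \<le> t \<Longrightarrow> f \<in> measurable (F s) N \<Longrightarrow> f \<in> measurable (F t) N"
  by (rule measurable_sets_mono[OF _ sets_F_mono]) simp_all

lemma measurable_F_M: "f \<in> measurable (F s) N \<Longrightarrow> f \<in> measurable M N"
  by (rule measurable_sets_mono[OF _ sets_F_events]) simp_all

lemma W_F: "0 \<le> t \<Longrightarrow> t \<le> s \<Longrightarrow> W t \<in> borel_measurable (F s)"
  and J_F: "0 \<le> t \<Longrightarrow> t \<le> s \<Longrightarrow> J t \<in> borel_measurable (F s)"
proof -
  assume t: "0 \<le> t" "t \<le> s"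
  have "sets (process_sigma {0..s} W) \<subseteq> sets (F s)" "sets (process_sigma {0..s} J) \<subseteq> sets (F s)"
    unfolding sets_F by (intro subsetI sigma_sets.Basic; simp)+
  moreover have "W t \<in> borel_measurable (process_sigma {0..s} W)" "J t \<in> borel_measurable (process_sigma {0..s} J)"
    using t by (auto intro: process_sigma_measurable)
  ultimately show "W t \<in> borel_measurable (F s)" "J t \<in> borel_measurable (F s)"
    by (auto elim!: measurable_sets_mono[rotated 2])
qed

text \<open>The independence of three families is regrouped as the independence of one of them from the join of the
  other two.\<close>

lemma inputs_indep:
  shows "indep_set (sigma_sets (space M) (sets (vimage_algebra (space M) \<xi> borel) \<union> sets (process_sigma {0..} J)))
     (sets (process_sigma {0..} W))" (is ?W)
    and "indep_set (sigma_sets (space M) (sets (vimage_algebra (space M) \<xi> borel) \<union> sets (process_sigma {0..} W)))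
     (sets (process_sigma {0..} J))" (is ?J)
proof -
  let ?E = "\<lambda>i::nat. [sets (vimage_algebra (space M) \<xi> borel), sets (process_sigma {0..} W),
                           sets (process_sigma {0..} J)] ! i"
  have ind: "indep_sets ?E {0, 1, 2}"
    using inputs unfolding independent_inputs_def .
  have stable: "Int_stable (?E i)" if "i \<in> {0, 1, 2}" for i
    using that by (auto simp: sets.Int_stable)
  have split: "indep_sets (\<lambda>b. sigma_sets (space M) (\<Union>i\<in>case_bool {0, j} {k} b. ?E i)) UNIV"
    if jk: "j = 1 \<and> k = 2 \<or> j = 2 \<and> k = 1" for j k :: nat
  proof (rule indep_sets_collect_sigma)
    have "(\<Union>b. case_bool {0, j} {k} b) = {0, 1, 2}"
      using jk by (elim disjE) (auto simp: UNIV_bool)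
    then show "indep_sets ?E (\<Union>b. case_bool {0, j} {k} b)"
      using ind by simp
    show "Int_stable (?E i)" if "i \<in> case_bool {0, j} {k} b" for i b
    proof (rule stable)
      show "i \<in> {0, 1, 2}"
        using jk that by (elim disjE conjE; cases b) auto
    qed
    show "disjoint_family (case_bool {0, j} {k})"
      using jk by (elim disjE) (auto simp: disjoint_family_on_def split: bool.splits)
  qed
  have eq: "sigma_sets (space M) (sets (process_sigma {0..} X)) = sets (process_sigma {0..} X)" for X
    using sets.sigma_sets_eq[of "process_sigma {0..} X"] by simp
  show ?W
    unfolding indep_set_def
    by (rule indep_sets_mono_sets[OF split[of 2 1]]) (auto split: bool.split simp: eq)
  show ?J
    unfolding indep_set_def
    by (rule indep_sets_mono_sets[OF split[of 1 2]]) (auto split: bool.split simp: eq)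
qed

lemma W_increment_indep:
  assumes "0 \<le> s" "s \<le> t"
  shows "indep_set (sets (F s)) (sets (vimage_algebra (space M) (\<lambda>\<omega>. W t \<omega> - W s \<omega>) borel))"
proof -
  let ?H = "sigma_sets (space M) (sets (vimage_algebra (space M) \<xi> borel) \<union> sets (process_sigma {0..} J))"
  interpret H: sigma_algebra "space M" ?H
    by (rule sigma_algebra_sigma_sets) (intro Un_least order_trans[OF input_events(1) sets.space_closed]
      order_trans[OF input_events(2) sets.space_closed] order_trans[OF input_events(3) sets.space_closed])
  have "indep_set (sigma_sets (space M) (?H \<union> sets (process_sigma {0..s} W) \<union> null_sets M))
    (sets (vimage_algebra (space M) (\<lambda>\<omega>. W t \<omega> - W s \<omega>) borel))"
    by (rule increment_indep_join[OF _ _ _ assms H.Int_stable H.top inputs_indep(1)])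
      (use wiener in \<open>auto simp: wiener_process_def\<close>)
  moreover have "sets (F s) \<subseteq> sigma_sets (space M) (?H \<union> sets (process_sigma {0..s} W) \<union> null_sets M)"
    unfolding sets_F using sets_process_sigma_mono[of "{0..s}" "{0..}" J]
    by (intro sigma_sets_mono' subsetI) (auto intro!: sigma_sets.Basic)
  ultimately show ?thesis
    by (rule indep_set_mono)
qed

text \<open>The noise up to time \<open>s\<close> together with the whole path of \<open>W\<close>. An increment of \<open>J\<close> after \<open>s\<close> is independent even of
  this larger past, so within a grid cell the increment of \<open>J\<close> can be integrated out first, with that of \<open>W\<close>
  held fixed.\<close>

definition enlarged_F :: "real \<Rightarrow> 'a measure" where
  "enlarged_F s = sigma (space M) (sets (vimage_algebra (space M) \<xi> borel) \<union>
      sets (process_sigma {0..} W) \<union> sets (process_sigma {0..s} J) \<union> null_sets M)"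

lemma sets_enlarged:
  "sets (enlarged_F s) = sigma_sets (space M) (sets (vimage_algebra (space M) \<xi> borel) \<union>
      sets (process_sigma {0..} W) \<union> sets (process_sigma {0..s} J) \<union> null_sets M)"
  unfolding enlarged_F_def
  by (intro sets_measure_of order_trans[OF F_generator_subset sets.space_closed]) auto

lemma space_enlarged [simp]: "space (enlarged_F s) = space M"
  by (simp add: enlarged_F_def space_measure_of_conv)

lemma measurable_F_enlarged: "f \<in> measurable (F s) N \<Longrightarrow> f \<in> measurable (enlarged_F s) N"
proof -
  have "sets (F s) \<subseteq> sets (enlarged_F s)"
    unfolding sets_F sets_enlarged using sets_process_sigma_mono[of "{0..s}" "{0..}" W]
    by (intro sigma_sets_mono' subsetI) auto
  then show "f \<in> measurable (F s) N \<Longrightarrow> f \<in> measurable (enlarged_F s) N"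
    by (intro measurable_sets_mono[of "F s" "enlarged_F s"]) simp_all
qed

lemma W_enlarged: "0 \<le> t \<Longrightarrow> W t \<in> borel_measurable (enlarged_F s)"
proof -
  assume t: "0 \<le> t"
  have "sets (process_sigma {0..} W) \<subseteq> sets (enlarged_F s)"
    unfolding sets_enlarged by (intro subsetI sigma_sets.Basic) simp
  then show "W t \<in> borel_measurable (enlarged_F s)"
    using t by (auto intro!: process_sigma_measurable measurable_sets_mono[of "process_sigma {0..} _" "enlarged_F s"])
qed

lemma J_increment_indep:
  assumes "0 \<le> s" "s \<le> t"
  shows "indep_set (sets (enlarged_F s)) (sets (vimage_algebra (space M) (\<lambda>\<omega>. J t \<omega> - J s \<omega>) borel))"
proof -
  let ?H = "sigma_sets (space M) (sets (vimage_algebra (space M) \<xi> borel) \<union> sets (process_sigma {0..} W))"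
  interpret H: sigma_algebra "space M" ?H
    by (rule sigma_algebra_sigma_sets) (intro Un_least order_trans[OF input_events(1) sets.space_closed]
      order_trans[OF input_events(2) sets.space_closed] order_trans[OF input_events(3) sets.space_closed])
  have "indep_set (sigma_sets (space M) (?H \<union> sets (process_sigma {0..s} J) \<union> null_sets M))
    (sets (vimage_algebra (space M) (\<lambda>\<omega>. J t \<omega> - J s \<omega>) borel))"
    by (rule increment_indep_join[OF _ _ _ assms H.Int_stable H.top inputs_indep(2)])
      (use sub in \<open>auto simp: subordinator_def\<close>)
  moreover have "sets (enlarged_F s) \<subseteq> sigma_sets (space M) (?H \<union> sets (process_sigma {0..s} J) \<union> null_sets M)"
    unfolding sets_enlarged
    by (intro sigma_sets_mono' subsetI) (auto intro!: sigma_sets.Basic)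
  ultimately show ?thesis
    by (rule indep_set_mono)
qed

lemma distr_W_increment:
  "0 \<le> s \<Longrightarrow> s < t \<Longrightarrow> distr M borel (\<lambda>\<omega>. W t \<omega> - W s \<omega>) =
     density lborel (\<lambda>x. ennreal (normal_density 0 (sqrt (t - s)) x))"
  using wiener unfolding wiener_process_def distributed_def by (simp cong: distr_cong)

lemma wiener_exp_step:
  assumes "0 \<le> s" "s < t" and [measurable]: "U \<in> borel_measurable (F s)" "c \<in> borel_measurable (F s)"
  shows "(\<integral>\<^sup>+\<omega>. U \<omega> * ennreal (exp (c \<omega> * (W t \<omega> - W s \<omega>) - (c \<omega>)\<^sup>2 * (t - s) / 2)) \<partial>M) = (\<integral>\<^sup>+\<omega>. U \<omega> \<partial>M)"
proof -
  have [measurable]: "random_variable borel (\<lambda>\<omega>. W t \<omega> - W s \<omega>)"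
    using assms by (intro borel_measurable_diff W_measurable) simp_all
  have "(\<lambda>x. fst (fst x) * ennreal (exp (snd (fst x) * snd x - (snd (fst x))\<^sup>2 * (t - s) / 2))) \<in> borel_measurable ((borel \<Otimes>\<^sub>M borel) \<Otimes>\<^sub>M (borel :: real measure))"
    by measurable
  note nn_integral_indep[OF space_F W_increment_indep _ _ this, of s t "\<lambda>\<omega>. (U \<omega>, c \<omega>)"]
  then have "(\<integral>\<^sup>+\<omega>. U \<omega> * ennreal (exp (c \<omega> * (W t \<omega> - W s \<omega>) - (c \<omega>)\<^sup>2 * (t - s) / 2)) \<partial>M) =
    (\<integral>\<^sup>+\<omega>. (\<integral>\<^sup>+w. U \<omega> * ennreal (exp (c \<omega> * w - (c \<omega>)\<^sup>2 * (t - s) / 2))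
      \<partial>distr M borel (\<lambda>\<omega>. W t \<omega> - W s \<omega>)) \<partial>M)"
    using assms(1,2) by simp
  also have "\<dots> = (\<integral>\<^sup>+\<omega>. U \<omega> \<partial>M)"
    using assms(1,2) by (simp add: distr_W_increment nn_integral_cmult nn_integral_normal_exp)
  finally show ?thesis .
qed

lemma wiener_square_step:
  assumes "0 \<le> s" "s < t" and [measurable]: "S \<in> borel_measurable (F s)" "c \<in> borel_measurable (F s)"
  shows "(\<integral>\<^sup>+\<omega>. ennreal ((S \<omega> + c \<omega> * (W t \<omega> - W s \<omega>))\<^sup>2) \<partial>M) =
    (\<integral>\<^sup>+\<omega>. ennreal ((S \<omega>)\<^sup>2 + (c \<omega>)\<^sup>2 * (t - s)) \<partial>M)"
proof -
  have [measurable]: "random_variable borel (\<lambda>\<omega>. W t \<omega> - W s \<omega>)"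
    using assms by (intro borel_measurable_diff W_measurable) simp_all
  have "(\<lambda>x. ennreal ((fst (fst x) + snd (fst x) * snd x)\<^sup>2)) \<in> borel_measurable ((borel \<Otimes>\<^sub>M borel) \<Otimes>\<^sub>M (borel :: real measure))"
    by measurable
  note nn_integral_indep[OF space_F W_increment_indep _ _ this, of s t "\<lambda>\<omega>. (S \<omega>, c \<omega>)"]
  then have "(\<integral>\<^sup>+\<omega>. ennreal ((S \<omega> + c \<omega> * (W t \<omega> - W s \<omega>))\<^sup>2) \<partial>M) =
    (\<integral>\<^sup>+\<omega>. (\<integral>\<^sup>+w. ennreal ((S \<omega> + c \<omega> * w)\<^sup>2) \<partial>distr M borel (\<lambda>\<omega>. W t \<omega> - W s \<omega>)) \<partial>M)"
    using assms(1,2) by simp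
  also have "\<dots> = (\<integral>\<^sup>+\<omega>. ennreal ((S \<omega>)\<^sup>2 + (c \<omega>)\<^sup>2 * (t - s)) \<partial>M)"
    using assms(1,2) by (simp add: distr_W_increment nn_integral_normal_square)
  finally show ?thesis .
qed

text \<open>The transform of a subordinator is prescribed for complex arguments; for a real argument both sides are real.\<close>

lemma laplace_J:
  assumes "0 \<le> t" "p \<le> 0"
  shows "expectation (\<lambda>\<omega>. exp (p * J t \<omega>)) = exp (t * levy_exponent m p)"
proof -
  have "expectation (\<lambda>\<omega>. exp (complex_of_real p * complex_of_real (J t \<omega>))) =
        exp (complex_of_real t * (LINT z:{0<..}|m. exp (complex_of_real p * complex_of_real z) - 1))"
    using assms
    by (intro sub[unfolded subordinator_def, THEN conjunct2, THEN conjunct2, THEN conjunct2, THEN conjunct2,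
          THEN conjunct2, THEN conjunct2, rule_format]) simp_all
  also have "(LINT z:{0<..}|m. exp (complex_of_real p * complex_of_real z) - 1) = complex_of_real (levy_exponent m p)"
    unfolding levy_exponent_def set_lebesgue_integral_def integral_complex_of_real[symmetric]
    by (intro Bochner_Integration.integral_cong)
      (auto simp: scaleR_conv_of_real exp_of_real[symmetric] mult.commute)
  also have "expectation (\<lambda>\<omega>. exp (complex_of_real p * complex_of_real (J t \<omega>))) =
     complex_of_real (expectation (\<lambda>\<omega>. exp (p * J t \<omega>)))"
    unfolding integral_complex_of_real[symmetric]
    by (intro Bochner_Integration.integral_cong) (auto simp: exp_of_real[symmetric])
  finally show ?thesis
    by (metis exp_of_real of_real_eq_iff of_real_mult)
qed

lemma AE_J_mono: "AE \<omega> in M. \<forall>s t. 0 \<le> s \<longrightarrow> s \<le> t \<longrightarrow> J s \<omega> \<le> J t \<omega>"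
proof -
  have "AE \<omega> in M. mono_on {0..} (\<lambda>t. J t \<omega>)"
    using sub by (simp add: subordinator_def)
  then show ?thesis
    by eventually_elim (auto simp: mono_on_def)
qed

lemma AE_J_nonneg: "0 \<le> t \<Longrightarrow> AE \<omega> in M. 0 \<le> J t \<omega>"
proof -
  assume t: "0 \<le> t"
  have "AE \<omega> in M. J 0 \<omega> = 0"
    using sub by (simp add: subordinator_def)
  with AE_J_mono show "AE \<omega> in M. 0 \<le> J t \<omega>"
    by eventually_elim (use t in \<open>metis order_refl\<close>)
qed

lemma subordinator_exp_step:
  assumes "0 \<le> s" "s \<le> t" "p \<le> 0" and [measurable]: "U \<in> borel_measurable (enlarged_F s)"
  shows "(\<integral>\<^sup>+\<omega>. U \<omega> * ennreal (exp (p * (J t \<omega> - J s \<omega>))) \<partial>M) =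
    (\<integral>\<^sup>+\<omega>. U \<omega> \<partial>M) * ennreal (exp ((t - s) * levy_exponent m p))"
proof -
  have [measurable]: "random_variable borel (\<lambda>\<omega>. J t \<omega> - J s \<omega>)"
    using assms by (intro borel_measurable_diff J_measurable) simp_all
  have UM: "U \<in> borel_measurable M"
    using assms(4) indep_setD_ev1[OF J_increment_indep[OF assms(1,2)]]
    by (intro measurable_sets_mono[of "enlarged_F s" M]) simp_all
  have d: "distr M borel (\<lambda>\<omega>. J t \<omega> - J s \<omega>) = distr M borel (J (t - s))"
    using assms
    by (intro sub[unfolded subordinator_def, THEN conjunct2, THEN conjunct2, THEN conjunct2, THEN conjunct1,
          rule_format])
  have ts: "0 \<le> t - s"
    using assms by simp
  note [measurable] = J_measurable[OF ts]
  have int: "integrable M (\<lambda>\<omega>. exp (p * J (t - s) \<omega>))"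
  proof (rule integrable_const_bound[of _ 1])
    show "AE \<omega> in M. norm (exp (p * J (t - s) \<omega>)) \<le> 1"
      using AE_J_nonneg[of "t - s"] assms by (auto simp: mult_nonpos_nonneg)
  qed measurable
  have "(\<integral>\<^sup>+v. ennreal (exp (p * v)) \<partial>distr M borel (J (t - s))) = (\<integral>\<^sup>+\<omega>. ennreal (exp (p * J (t - s) \<omega>)) \<partial>M)"
    using J_measurable[OF ts] by (intro nn_integral_distr) auto
  also have "\<dots> = ennreal (exp ((t - s) * levy_exponent m p))"
    using int by (subst nn_integral_eq_integral) (auto simp: laplace_J[OF ts assms(3)])
  finally have L: "(\<integral>\<^sup>+v. ennreal (exp (p * v)) \<partial>distr M borel (J (t - s))) = ennreal (exp ((t - s) * levy_exponent m p))" .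
  note nn_integral_indep[OF space_enlarged J_increment_indep, of s t U "borel"
    "\<lambda>(u, v). u * ennreal (exp (p * v))"]
  then have "(\<integral>\<^sup>+\<omega>. U \<omega> * ennreal (exp (p * (J t \<omega> - J s \<omega>))) \<partial>M) =
    (\<integral>\<^sup>+\<omega>. (\<integral>\<^sup>+v. U \<omega> * ennreal (exp (p * v)) \<partial>distr M borel (J (t - s))) \<partial>M)"
    using assms(1,2) by (simp add: d)
  also have "\<dots> = (\<integral>\<^sup>+\<omega>. U \<omega> * ennreal (exp ((t - s) * levy_exponent m p)) \<partial>M)"
    using assms(1,2) by (simp add: nn_integral_cmult L)
  finally show ?thesis
    using UM by (simp add: nn_integral_multc)
qed

end

section \<open>Sums of increments over a grid\<close>

lemma grid_mono:
  fixes g :: "nat \<Rightarrow> real"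
  assumes "\<And>i. i < k \<Longrightarrow> g i < g (Suc i)" "i \<le> j" "j \<le> k"
  shows "g i \<le> g j"
  using assms(2,3)
proof (induction j)
  case (Suc j)
  then show ?case
    using assms(1)[of j] by (cases "i = Suc j") auto
qed simp

text \<open>The indicator looks one step ahead: a summand is kept only if the sum including it stays below \<open>\<delta>\<close>. Hence there
  is no overshoot. This is possible because the summands will be squared integrands times cell lengths, which
  are known at the left end of a cell.\<close>

lemma sum_stopped_le:
  fixes q :: "nat \<Rightarrow> real"
  assumes "\<And>i. i < k \<Longrightarrow> 0 \<le> q i" "0 \<le> \<delta>"
  shows "(\<Sum>i<k. q i * of_bool ((\<Sum>l\<le>i. q l) \<le> \<delta>)) \<le> \<delta>"
  using assms(1)
proof (induction k)
  case (Suc k)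
  show ?case
  proof (cases "(\<Sum>l\<le>k. q l) \<le> \<delta>")
    case True
    have "(\<Sum>i<Suc k. q i * of_bool ((\<Sum>l\<le>i. q l) \<le> \<delta>)) \<le> (\<Sum>i<Suc k. q i)"
      using Suc.prems by (intro sum_mono) (simp add: mult_left_le)
    then show ?thesis
      using True by (simp add: lessThan_Suc_atMost)
  next
    case False
    then show ?thesis
      using Suc by simp
  qed
qed (use assms in simp)

context driving_noise
begin

lemma increment_sum_measurable:
  assumes g: "0 \<le> g 0" "\<And>i. i < k \<Longrightarrow> g i < g (Suc i)"
    and d: "\<And>i. i < k \<Longrightarrow> d i \<in> borel_measurable (F (g i))" and j: "j \<le> k" "g j \<le> s"
  shows "(\<lambda>\<omega>. \<Sum>i<j. d i \<omega> * (W (g (Suc i)) \<omega> - W (g i) \<omega>)) \<in> borel_measurable (F s)"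
proof (intro borel_measurable_sum borel_measurable_times borel_measurable_diff)
  fix i assume "i \<in> {..<j}"
  then have "i < j" by simp
  then have "0 \<le> g i" "g i \<le> g (Suc i)" "g (Suc i) \<le> s"
    using grid_mono[of k g 0 i] grid_mono[of k g "Suc i" j] g(1) less_imp_le[OF g(2), of i] j by (auto simp: g(2))
  then show "d i \<in> borel_measurable (F s)" "W (g (Suc i)) \<in> borel_measurable (F s)" "W (g i) \<in> borel_measurable (F s)"
    using \<open>i < j\<close> j by (auto intro!: W_F measurable_F_mono[OF _ d])
qed

text \<open>Integrate out the increments of the last cell, first the one of \<open>J\<close>, which contributes a factor, then the one
  of \<open>W\<close>, which contributes \<open>1\<close>. All integrands are
  nonnegative, so each step is an identity between integrals in \<open>[0, \<infinity>]\<close>.\<close>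

lemma exponential_martingale:
  assumes g: "0 \<le> g 0" "\<And>i. i < k \<Longrightarrow> g i < g (Suc i)"
    and d: "\<And>i. i < k \<Longrightarrow> d i \<in> borel_measurable (F (g i))" and p: "\<And>i. i < k \<Longrightarrow> p i \<le> 0"
  shows "(\<integral>\<^sup>+\<omega>. ennreal (exp (\<Sum>i<k. d i \<omega> * (W (g (Suc i)) \<omega> - W (g i) \<omega>)
      - (d i \<omega>)\<^sup>2 * (g (Suc i) - g i) / 2 + p i * (J (g (Suc i)) \<omega> - J (g i) \<omega>))) \<partial>M) =
    ennreal (exp (\<Sum>i<k. (g (Suc i) - g i) * levy_exponent m (p i)))"
proof -
  define s where "s i \<omega> = d i \<omega> * (W (g (Suc i)) \<omega> - W (g i) \<omega>) - (d i \<omega>)\<^sup>2 * (g (Suc i) - g i) / 2 +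
    p i * (J (g (Suc i)) \<omega> - J (g i) \<omega>)" for i \<omega>
  have "j \<le> k \<Longrightarrow> (\<integral>\<^sup>+\<omega>. ennreal (exp (\<Sum>i<j. s i \<omega>)) \<partial>M) =
    ennreal (exp (\<Sum>i<j. (g (Suc i) - g i) * levy_exponent m (p i)))" for j
  proof (induction j)
    case 0
    then show ?case by (simp add: emeasure_space_1)
  next
    case (Suc j)
    then have j: "j < k" "j \<le> k" by auto
    have g0: "0 \<le> g j" "g j < g (Suc j)" "g j \<le> g (Suc j)"
      using grid_mono[of k g 0 j] g j by (auto intro: less_imp_le)
    define U where "U \<omega> = ennreal (exp (\<Sum>i<j. s i \<omega>))" for \<omega>
    define V where "V \<omega> = ennreal (exp (d j \<omega> * (W (g (Suc j)) \<omega> - W (g j) \<omega>) - (d j \<omega>)\<^sup>2 * (g (Suc j) - g j) / 2))" for \<omega>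
    have "s i \<in> borel_measurable (F (g j))" if "i < j" for i
    proof -
      have "0 \<le> g i" "g i \<le> g (Suc i)" "g (Suc i) \<le> g j"
        using grid_mono[of k g 0 i] grid_mono[of k g "Suc i" j] g(1) less_imp_le[OF g(2), of i] j that by (auto simp: g(2))
      then have [measurable]: "d i \<in> borel_measurable (F (g j))" "W (g (Suc i)) \<in> borel_measurable (F (g j))" "W (g i) \<in> borel_measurable (F (g j))"
        "J (g (Suc i)) \<in> borel_measurable (F (g j))" "J (g i) \<in> borel_measurable (F (g j))"
        using that j by (auto intro!: W_F J_F measurable_F_mono[OF _ d])
      show ?thesis unfolding s_def by measurable
    qed
    then have U[measurable]: "U \<in> borel_measurable (F (g j))"
      unfolding U_def by (intro measurable_compose[OF _ measurable_ennreal] borel_measurable_exp borel_measurable_sum) auto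
    have dj[measurable]: "d j \<in> borel_measurable (F (g j))"
      using d j by simp
    have [measurable]: "U \<in> borel_measurable (enlarged_F (g j))" "d j \<in> borel_measurable (enlarged_F (g j))"
       "W (g (Suc j)) \<in> borel_measurable (enlarged_F (g j))" "W (g j) \<in> borel_measurable (enlarged_F (g j))"
      using g0 by (auto intro!: measurable_F_enlarged W_enlarged U dj)
    have "(\<lambda>\<omega>. U \<omega> * V \<omega>) \<in> borel_measurable (enlarged_F (g j))"
      unfolding V_def by measurable
    note step = subordinator_exp_step[OF g0(1,3) p[OF j(1)] this]
    have "(\<integral>\<^sup>+\<omega>. ennreal (exp (\<Sum>i<Suc j. s i \<omega>)) \<partial>M) =
      (\<integral>\<^sup>+\<omega>. (U \<omega> * V \<omega>) * ennreal (exp (p j * (J (g (Suc j)) \<omega> - J (g j) \<omega>))) \<partial>M)"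
      unfolding U_def V_def
      by (intro nn_integral_cong) (simp add: ennreal_mult[symmetric] exp_add[symmetric] s_def algebra_simps)
    also have "\<dots> = (\<integral>\<^sup>+\<omega>. U \<omega> * V \<omega> \<partial>M) * ennreal (exp ((g (Suc j) - g j) * levy_exponent m (p j)))"
      by (rule step)
    also have "(\<integral>\<^sup>+\<omega>. U \<omega> * V \<omega> \<partial>M) = (\<integral>\<^sup>+\<omega>. U \<omega> \<partial>M)"
      unfolding V_def by (rule wiener_exp_step[OF g0(1,2) U dj])
    also have "\<dots> = ennreal (exp (\<Sum>i<j. (g (Suc i) - g i) * levy_exponent m (p i)))"
      unfolding U_def using Suc.IH j by simp
    finally show ?case
      by (simp add: ennreal_mult[symmetric] exp_add[symmetric])
  qed
  from this[of k] show ?thesis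
    by (simp add: s_def)
qed

text \<open>The cross terms vanish because an increment of \<open>W\<close> is centred given the past. Each step
  integrates a complete square, so the identity holds in \<open>[0, \<infinity>]\<close>.\<close>

lemma ito_isometry_sum:
  assumes g: "0 \<le> g 0" "\<And>i. i < k \<Longrightarrow> g i < g (Suc i)"
    and d: "\<And>i. i < k \<Longrightarrow> d i \<in> borel_measurable (F (g i))"
  shows "(\<integral>\<^sup>+\<omega>. ennreal ((\<Sum>i<k. d i \<omega> * (W (g (Suc i)) \<omega> - W (g i) \<omega>))\<^sup>2) \<partial>M) =
    (\<integral>\<^sup>+\<omega>. ennreal (\<Sum>i<k. (d i \<omega>)\<^sup>2 * (g (Suc i) - g i)) \<partial>M)"
proof -
  have "j \<le> k \<Longrightarrow> (\<integral>\<^sup>+\<omega>. ennreal ((\<Sum>i<j. d i \<omega> * (W (g (Suc i)) \<omega> - W (g i) \<omega>))\<^sup>2) \<partial>M) =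
    (\<integral>\<^sup>+\<omega>. ennreal (\<Sum>i<j. (d i \<omega>)\<^sup>2 * (g (Suc i) - g i)) \<partial>M)" for j
  proof (induction j)
    case (Suc j)
    then have j: "j < k" "j \<le> k" by auto
    have g0: "0 \<le> g j" "g j < g (Suc j)"
      using grid_mono[of k g 0 j] g j by auto
    have S: "(\<lambda>\<omega>. \<Sum>i<j. d i \<omega> * (W (g (Suc i)) \<omega> - W (g i) \<omega>)) \<in> borel_measurable (F (g j))"
      by (rule increment_sum_measurable[OF g d j(2) order_refl])
    note [measurable] = measurable_F_M[OF S]
    have dM[measurable]: "random_variable borel (d i)" if "i < Suc j" for i
      using d[of i] that j by (intro measurable_F_M) auto
    have nn: "0 \<le> (\<Sum>i<j. (d i \<omega>)\<^sup>2 * (g (Suc i) - g i))" for \<omega>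
      using g(2) j by (intro sum_nonneg mult_nonneg_nonneg) (auto intro: less_imp_le)
    have m2: "random_variable borel (\<lambda>\<omega>. \<Sum>i<j. (d i \<omega>)\<^sup>2 * (g (Suc i) - g i))"
      by (intro borel_measurable_sum borel_measurable_times borel_measurable_power dM) auto
    have "(\<integral>\<^sup>+\<omega>. ennreal ((\<Sum>i<Suc j. d i \<omega> * (W (g (Suc i)) \<omega> - W (g i) \<omega>))\<^sup>2) \<partial>M) =
      (\<integral>\<^sup>+\<omega>. ennreal ((\<Sum>i<j. d i \<omega> * (W (g (Suc i)) \<omega> - W (g i) \<omega>))\<^sup>2 + (d j \<omega>)\<^sup>2 * (g (Suc j) - g j)) \<partial>M)"
      using wiener_square_step[OF g0 S d[OF j(1)]] by simp
    also have "\<dots> = (\<integral>\<^sup>+\<omega>. ennreal ((\<Sum>i<j. d i \<omega> * (W (g (Suc i)) \<omega> - W (g i) \<omega>))\<^sup>2) \<partial>M) +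
       (\<integral>\<^sup>+\<omega>. ennreal ((d j \<omega>)\<^sup>2 * (g (Suc j) - g j)) \<partial>M)"
      using g0 by (simp add: ennreal_plus nn_integral_add)
    also have "\<dots> = (\<integral>\<^sup>+\<omega>. ennreal (\<Sum>i<Suc j. (d i \<omega>)\<^sup>2 * (g (Suc i) - g i)) \<partial>M)"
      using g0 j nn m2 by (simp add: Suc.IH ennreal_plus nn_integral_add)
    finally show ?case .
  qed simp
  from this[of k] show ?thesis by simp
qed

text \<open>Switch the integrand off as soon as the next cell would push the quadratic variation above \<open>\<delta>\<close>, or once the sum
  has exceeded \<open>\<epsilon>\<close>. The second moment of the stopped sum is at most \<open>\<delta>\<close>. If the quadratic variation stays below
  \<open>\<delta>\<close>, a large partial sum is frozen, so the final value of the stopped sum is large as well and the inequality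
  of Chebyshev applies to it.\<close>

lemma lenglart_inequality:
  assumes g: "0 \<le> g 0" "\<And>i. i < k \<Longrightarrow> g i < g (Suc i)"
    and d: "\<And>i. i < k \<Longrightarrow> d i \<in> borel_measurable (F (g i))" and pos: "0 < \<epsilon>" "0 < \<delta>"
  shows "prob {\<omega>\<in>space M. \<exists>j\<le>k. \<epsilon> < \<bar>\<Sum>i<j. d i \<omega> * (W (g (Suc i)) \<omega> - W (g i) \<omega>)\<bar>} \<le>
    prob {\<omega>\<in>space M. \<delta> < (\<Sum>i<k. (d i \<omega>)\<^sup>2 * (g (Suc i) - g i))} + \<delta> / \<epsilon>\<^sup>2"
proof -
  define S where "S j \<omega> = (\<Sum>i<j. d i \<omega> * (W (g (Suc i)) \<omega> - W (g i) \<omega>))" for j \<omega>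
  define q where "q i \<omega> = (d i \<omega>)\<^sup>2 * (g (Suc i) - g i)" for i \<omega>
  \<comment> \<open>The integrand is still active on cell \<open>i\<close>; this is decided at the time \<open>g i\<close>.\<close>
  define b where "b i \<omega> \<longleftrightarrow> (\<Sum>l\<le>i. q l \<omega>) \<le> \<delta> \<and> (\<forall>j\<in>{..i}. \<bar>S j \<omega>\<bar> \<le> \<epsilon>)" for i \<omega>
  define e where "e i \<omega> = d i \<omega> * of_bool (b i \<omega>)" for i \<omega>
  have q0: "0 \<le> q i \<omega>" if "i < k" for i \<omega>
    using g(2)[OF that] by (simp add: q_def)
  have SF: "S j \<in> borel_measurable (F (g i))" if "j \<le> i" "i \<le> k" for i j
    unfolding S_def
  proof (rule increment_sum_measurable)
    show "0 \<le> g 0" "j \<le> k" "g j \<le> g i"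
      using g grid_mono[of k g j i] that by auto
  qed (use g d in auto)
  have dF: "d l \<in> borel_measurable (F (g i))" if "l \<le> i" "i < k" for l i
    using that grid_mono[of k g l i] g(2) by (intro measurable_F_mono[OF _ d]) auto
  have qF: "q l \<in> borel_measurable (F (g i))" if "l \<le> i" "i < k" for l i
    unfolding q_def by (intro borel_measurable_times borel_measurable_power dF[OF that]) auto
  have eF: "e i \<in> borel_measurable (F (g i))" if "i < k" for i
  proof -
    have [measurable]: "(\<lambda>\<omega>. \<Sum>l\<le>i. q l \<omega>) \<in> borel_measurable (F (g i))"
      using that by (intro borel_measurable_sum qF) auto
    have "Measurable.pred (F (g i)) (\<lambda>\<omega>. \<forall>j\<in>{..i}. \<bar>S j \<omega>\<bar> \<le> \<epsilon>)"
    proof (intro pred_intros_finite(3))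
      fix j assume "j \<in> {..i}"
      then have [measurable]: "S j \<in> borel_measurable (F (g i))" using SF that by auto
      show "Measurable.pred (F (g i)) (\<lambda>\<omega>. \<bar>S j \<omega>\<bar> \<le> \<epsilon>)" by measurable
    qed simp
    then have [measurable]: "Measurable.pred (F (g i)) (b i)"
      unfolding b_def by measurable
    show ?thesis
      unfolding e_def using dF[of i i] that by measurable
  qed
  define T where "T \<omega> = (\<Sum>i<k. e i \<omega> * (W (g (Suc i)) \<omega> - W (g i) \<omega>))" for \<omega>
  have [measurable]: "random_variable borel T"
    unfolding T_def by (rule measurable_F_M[OF increment_sum_measurable[OF g eF order_refl order_refl]])
  have SM[measurable]: "random_variable borel (S j)" if "j \<le> k" for j
    using SF[OF order_refl that] by (rule measurable_F_M)
  have qM: "random_variable borel (\<lambda>\<omega>. \<Sum>i<k. q i \<omega>)"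
    by (intro borel_measurable_sum measurable_F_M[OF qF[OF order_refl]]) auto
  have "(\<Sum>i<k. (e i \<omega>)\<^sup>2 * (g (Suc i) - g i)) \<le> \<delta>" for \<omega>
  proof -
    have "(\<Sum>i<k. (e i \<omega>)\<^sup>2 * (g (Suc i) - g i)) \<le> (\<Sum>i<k. q i \<omega> * of_bool ((\<Sum>l\<le>i. q l \<omega>) \<le> \<delta>))"
      using q0 by (intro sum_mono) (auto simp: e_def q_def[symmetric] b_def)
    also have "\<dots> \<le> \<delta>"
      using q0 pos by (intro sum_stopped_le) auto
    finally show ?thesis .
  qed
  then have "(\<integral>\<^sup>+\<omega>. ennreal (\<Sum>i<k. (e i \<omega>)\<^sup>2 * (g (Suc i) - g i)) \<partial>M) \<le> (\<integral>\<^sup>+\<omega>. ennreal \<delta> \<partial>M)"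
    by (intro nn_integral_mono ennreal_leI)
  moreover have "(\<integral>\<^sup>+\<omega>. ennreal ((T \<omega>)\<^sup>2) \<partial>M) = (\<integral>\<^sup>+\<omega>. ennreal (\<Sum>i<k. (e i \<omega>)\<^sup>2 * (g (Suc i) - g i)) \<partial>M)"
    unfolding T_def by (rule ito_isometry_sum[OF g eF])
  ultimately have "(\<integral>\<^sup>+\<omega>. ennreal ((T \<omega>)\<^sup>2) \<partial>M) \<le> (\<integral>\<^sup>+\<omega>. ennreal \<delta> \<partial>M)"
    by simp
  then have T2: "(\<integral>\<^sup>+\<omega>. ennreal ((T \<omega>)\<^sup>2) \<partial>M) \<le> ennreal \<delta>"
    by (simp add: emeasure_space_1)
  have "ennreal (\<epsilon>\<^sup>2) * emeasure M {\<omega>\<in>space M. \<epsilon> < \<bar>T \<omega>\<bar>} = (\<integral>\<^sup>+\<omega>. ennreal (\<epsilon>\<^sup>2) * indicator {\<omega>\<in>space M. \<epsilon> < \<bar>T \<omega>\<bar>} \<omega> \<partial>M)"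
    by (rule nn_integral_cmult_indicator[symmetric]) measurable
  also have "\<dots> \<le> (\<integral>\<^sup>+\<omega>. ennreal ((T \<omega>)\<^sup>2) \<partial>M)"
  proof (rule nn_integral_mono)
    fix \<omega>
    have "\<epsilon>\<^sup>2 \<le> (T \<omega>)\<^sup>2" if "\<epsilon> < \<bar>T \<omega>\<bar>"
      using power_mono[of \<epsilon> "\<bar>T \<omega>\<bar>" 2] that pos by simp
    then show "ennreal (\<epsilon>\<^sup>2) * indicator {\<omega>\<in>space M. \<epsilon> < \<bar>T \<omega>\<bar>} \<omega> \<le> ennreal ((T \<omega>)\<^sup>2)"
      by (auto split: split_indicator intro: ennreal_leI)
  qed
  also note T2
  finally have "\<epsilon>\<^sup>2 * prob {\<omega>\<in>space M. \<epsilon> < \<bar>T \<omega>\<bar>} \<le> \<delta>"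
    using pos by (simp add: emeasure_eq_measure ennreal_mult[symmetric])
  then have PT: "prob {\<omega>\<in>space M. \<epsilon> < \<bar>T \<omega>\<bar>} \<le> \<delta> / \<epsilon>\<^sup>2"
    using pos by (simp add: field_simps)
  have key: "\<epsilon> < \<bar>T \<omega>\<bar>" if j: "j \<le> k" "\<epsilon> < \<bar>S j \<omega>\<bar>" and Q: "(\<Sum>i<k. q i \<omega>) \<le> \<delta>" for j \<omega>
  proof -
    define j0 where "j0 = (LEAST j. \<epsilon> < \<bar>S j \<omega>\<bar>)"
    have j0: "\<epsilon> < \<bar>S j0 \<omega>\<bar>" "j0 \<le> k"
      unfolding j0_def using LeastI[of "\<lambda>j. \<epsilon> < \<bar>S j \<omega>\<bar>" j] Least_le[of "\<lambda>j. \<epsilon> < \<bar>S j \<omega>\<bar>" j] j by auto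
    have before: "\<bar>S i \<omega>\<bar> \<le> \<epsilon>" if "i < j0" for i
      using not_less_Least[of i "\<lambda>j. \<epsilon> < \<bar>S j \<omega>\<bar>"] that by (simp add: j0_def)
    have b: "b i \<omega> \<longleftrightarrow> i < j0" if "i < k" for i
    proof (cases "i < j0")
      case True
      have "(\<Sum>l\<le>i. q l \<omega>) \<le> (\<Sum>i<k. q i \<omega>)"
        using that q0 by (intro sum_mono2) auto
      then show ?thesis
        using True before Q by (auto simp: b_def)
    next
      case False
      then show ?thesis
        using j0 by (auto simp: b_def not_less not_le intro!: bexI[of _ j0])
    qed
    have "T \<omega> = (\<Sum>i<k. (d i \<omega> * (W (g (Suc i)) \<omega> - W (g i) \<omega>)) * of_bool (i < j0))"
      unfolding T_def e_def by (intro sum.cong) (auto simp: b)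
    also have "\<dots> = S j0 \<omega>"
      unfolding S_def using j0(2) by (intro sum.mono_neutral_cong_right) auto
    finally show ?thesis using j0 by simp
  qed
  have "{\<omega>\<in>space M. \<exists>j\<le>k. \<epsilon> < \<bar>S j \<omega>\<bar>} \<subseteq> {\<omega>\<in>space M. \<delta> < (\<Sum>i<k. q i \<omega>)} \<union> {\<omega>\<in>space M. \<epsilon> < \<bar>T \<omega>\<bar>}"
    using key by (auto simp: not_less) (meson not_less)
  moreover have "{\<omega>\<in>space M. \<delta> < (\<Sum>i<k. q i \<omega>)} \<in> events" "{\<omega>\<in>space M. \<epsilon> < \<bar>T \<omega>\<bar>} \<in> events"
    using qM by measurable
  ultimately have "prob {\<omega>\<in>space M. \<exists>j\<le>k. \<epsilon> < \<bar>S j \<omega>\<bar>} \<le>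
     prob {\<omega>\<in>space M. \<delta> < (\<Sum>i<k. q i \<omega>)} + prob {\<omega>\<in>space M. \<epsilon> < \<bar>T \<omega>\<bar>}"
    by (intro order_trans[OF finite_measure_mono measure_Un_le]) auto
  then show ?thesis
    using PT by (simp add: S_def q_def)
qed

end

section \<open>Elementary integrals on a refining grid\<close>

lemma nn_integral_step:
  fixes g :: "nat \<Rightarrow> real" and f :: "real \<Rightarrow> ennreal"
  assumes g: "g 0 = 0" "\<And>i. i < k \<Longrightarrow> g i < g (Suc i)" and [measurable]: "f \<in> borel_measurable borel"
    and f: "\<And>i s. i < k \<Longrightarrow> g i < s \<Longrightarrow> s \<le> g (Suc i) \<Longrightarrow> f s = ennreal (c i)" and c: "\<And>i. i < k \<Longrightarrow> 0 \<le> c i"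
  shows "(\<integral>\<^sup>+s\<in>{0..g k}. f s \<partial>lborel) = ennreal (\<Sum>i<k. c i * (g (Suc i) - g i))"
proof -
  have "j \<le> k \<Longrightarrow> (\<integral>\<^sup>+s\<in>{0..g j}. f s \<partial>lborel) = ennreal (\<Sum>i<j. c i * (g (Suc i) - g i))" for j
  proof (induction j)
    case 0
    have "AE s in lborel. f s * indicator {0..g 0} s = 0"
      using AE_lborel_singleton[of "0::real"] by eventually_elim (auto simp: g split: split_indicator)
    then have "(\<integral>\<^sup>+s\<in>{0..g 0}. f s \<partial>lborel) = (\<integral>\<^sup>+s. 0 \<partial>(lborel :: real measure))"
      by (rule nn_integral_cong_AE)
    then show ?case by simp
  next
    case (Suc j)
    then have j: "j < k" "0 \<le> g j" "g j < g (Suc j)"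
      using grid_mono[of k g 0 j] g by auto
    have "(\<integral>\<^sup>+s\<in>{0..g (Suc j)}. f s \<partial>lborel) =
      (\<integral>\<^sup>+s. f s * indicator {0..g j} s + ennreal (c j) * indicator {g j<..g (Suc j)} s \<partial>lborel)"
      using j f[of j] by (intro nn_integral_cong) (auto split: split_indicator)
    also have "\<dots> = (\<integral>\<^sup>+s\<in>{0..g j}. f s \<partial>lborel) + ennreal (c j) * ennreal (g (Suc j) - g j)"
      using j by (subst nn_integral_add) (auto simp: nn_integral_cmult_indicator)
    also have "(\<integral>\<^sup>+s\<in>{0..g j}. f s \<partial>lborel) = ennreal (\<Sum>i<j. c i * (g (Suc i) - g i))"
      using Suc by simp
    also have "ennreal (\<Sum>i<j. c i * (g (Suc i) - g i)) + ennreal (c j) * ennreal (g (Suc j) - g j) =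
       ennreal ((\<Sum>i<j. c i * (g (Suc i) - g i)) + c j * (g (Suc j) - g j))"
    proof (subst ennreal_mult[symmetric])
      have "0 \<le> (\<Sum>i<j. c i * (g (Suc i) - g i))"
        using c g(2) j by (intro sum_nonneg mult_nonneg_nonneg) (auto intro: less_imp_le)
      then show "ennreal (\<Sum>i<j. c i * (g (Suc i) - g i)) + ennreal (c j * (g (Suc j) - g j)) =
       ennreal ((\<Sum>i<j. c i * (g (Suc i) - g i)) + c j * (g (Suc j) - g j))"
        using c j by (intro ennreal_plus[symmetric]) auto
    qed (use c j in auto)
    finally show ?case by simp
  qed
  then show ?thesis by simp
qed

text \<open>The points of \<open>\<tau>\<close> beyond \<open>T\<close> do not influence \<open>[0, T]\<close>, hence need not belong to the grid \<open>R\<close>.\<close>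

definition grid_refines :: "(nat \<Rightarrow> real) \<Rightarrow> nat \<Rightarrow> real set \<Rightarrow> real \<Rightarrow> bool" where
  "grid_refines \<tau> n R T \<longleftrightarrow> (\<forall>l\<le>n. \<tau> l \<in> R \<or> T < \<tau> l)"

lemma less_on_grid_cell:
  fixes g :: "nat \<Rightarrow> real"
  assumes g: "\<And>i. i < k \<Longrightarrow> g i < g (Suc i)" and x: "x \<in> g ` {..k} \<or> g k < x"
    and s: "i < k" "g i < s" "s \<le> g (Suc i)"
  shows "x < s \<longleftrightarrow> x \<le> g i"
proof
  assume "x < s"
  moreover have "g (Suc i) \<le> g k"
    using grid_mono[of k g "Suc i" k] g s by auto
  ultimately obtain j where j: "j \<le> k" "x = g j"
    using x s by auto
  have "j \<le> i"
  proof (rule ccontr)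
    assume "\<not> j \<le> i"
    then have "g (Suc i) \<le> g j"
      using grid_mono[of k g "Suc i" j] g j by auto
    then show False using \<open>x < s\<close> j s by simp
  qed
  then show "x \<le> g i"
    using grid_mono[of k g j i] g j s by auto
qed (use s in simp)

context prob_space
begin

text \<open>On a cell of a refining grid a simple process is constant, and its value there only involves the
  coefficients that are known at the left end of the cell.\<close>

lemma simple_process_on_grid:
  assumes g: "\<And>i. i < k \<Longrightarrow> g i < g (Suc i)" and R: "grid_refines \<tau> n (g ` {..k}) (g k)"
    and s: "i < k" "g i < s" "s \<le> g (Suc i)"
  shows "simple_process n \<tau> \<xi> s \<omega> = (\<Sum>l<n. \<xi> l \<omega> * of_bool (\<tau> l \<le> g i \<and> g i < \<tau> (Suc l)))"
  unfolding simple_process_def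
proof (intro sum.cong arg_cong2[where f="(*)"] refl)
  fix l assume "l \<in> {..<n}"
  have "\<tau> x < s \<longleftrightarrow> \<tau> x \<le> g i" if "x \<le> n" for x
    by (rule less_on_grid_cell[where g=g and k=k]) (use g R s that in \<open>auto simp: grid_refines_def\<close>)
  then have "\<tau> l < s \<longleftrightarrow> \<tau> l \<le> g i" "\<tau> (Suc l) < s \<longleftrightarrow> \<tau> (Suc l) \<le> g i"
    using \<open>l \<in> {..<n}\<close> by auto
  then show "indicator {\<tau> l<..\<tau> (Suc l)} s = of_bool (\<tau> l \<le> g i \<and> g i < \<tau> (Suc l))"
    by (auto simp: indicator_def)
qed

text \<open>Passing from one grid point to the next changes the elementary integral only through the interval of \<open>\<tau>\<close> that
  contains the cell.\<close>

lemma simple_integral_on_grid: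
  assumes g: "g 0 = 0" "\<And>i. i < k \<Longrightarrow> g i < g (Suc i)" and R: "grid_refines \<tau> n (g ` {..k}) (g k)"
    and \<tau>: "0 \<le> \<tau> 0" "\<And>l. l < n \<Longrightarrow> \<tau> l \<le> \<tau> (Suc l)" and j: "j \<le> k"
  shows "simple_integral n \<tau> \<xi> W (g j) \<omega> =
    (\<Sum>i<j. simple_process n \<tau> \<xi> (g (Suc i)) \<omega> * (W (g (Suc i)) \<omega> - W (g i) \<omega>))"
  using j
proof (induction j)
  case 0
  have "l \<le> n \<Longrightarrow> 0 \<le> \<tau> l" for l
    by (induction l) (use \<tau> in \<open>auto intro: order_trans\<close>)
  then show ?case
    by (auto simp: simple_integral_def g intro!: sum.neutral)
next
  case (Suc j)
  then have j: "j < k" "g j < g (Suc j)" using g by auto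
  let ?c = "\<lambda>x. W (min x (g (Suc j))) \<omega> - W (min x (g j)) \<omega>"
  have c: "?c (\<tau> l) = (W (g (Suc j)) \<omega> - W (g j) \<omega>) * of_bool (g j < \<tau> l)" if "l \<le> n" for l
  proof (cases "\<tau> l \<le> g j")
    case False
    moreover have "\<tau> l < g (Suc j) \<longleftrightarrow> \<tau> l \<le> g j"
      using R j that by (intro less_on_grid_cell[where g=g and k=k, OF g(2)]) (auto simp: grid_refines_def)
    ultimately have "min (\<tau> l) (g (Suc j)) = g (Suc j)" "min (\<tau> l) (g j) = g j"
      by auto
    then show ?thesis
      using False by simp
  qed (use j in auto)
  have "simple_integral n \<tau> \<xi> W (g (Suc j)) \<omega> - simple_integral n \<tau> \<xi> W (g j) \<omega> =
    (\<Sum>l<n. \<xi> l \<omega> * (?c (\<tau> (Suc l)) - ?c (\<tau> l)))"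
    unfolding simple_integral_def sum_subtractf[symmetric] by (intro sum.cong) (auto simp: algebra_simps)
  also have "\<dots> = (\<Sum>l<n. \<xi> l \<omega> * of_bool (\<tau> l \<le> g j \<and> g j < \<tau> (Suc l)) * (W (g (Suc j)) \<omega> - W (g j) \<omega>))"
  proof (intro sum.cong refl)
    fix l assume l: "l \<in> {..<n}"
    then have "l \<le> n" "Suc l \<le> n" "\<tau> l \<le> \<tau> (Suc l)" using \<tau> by auto
    then show "\<xi> l \<omega> * (?c (\<tau> (Suc l)) - ?c (\<tau> l)) =
        \<xi> l \<omega> * of_bool (\<tau> l \<le> g j \<and> g j < \<tau> (Suc l)) * (W (g (Suc j)) \<omega> - W (g j) \<omega>)"
      unfolding c[OF \<open>l \<le> n\<close>] c[OF \<open>Suc l \<le> n\<close>] by (auto simp: of_bool_def)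
  qed
  also have "\<dots> = simple_process n \<tau> \<xi> (g (Suc j)) \<omega> * (W (g (Suc j)) \<omega> - W (g j) \<omega>)"
    by (simp only: simple_process_on_grid[OF g(2) R j(1) j(2) order_refl] sum_distrib_right)
  finally show ?case
    using Suc by simp
qed

lemma simple_process_measurable:
  assumes "\<And>l. l < n \<Longrightarrow> random_variable borel (\<xi> l)"
  shows "(\<lambda>x. simple_process n \<tau> \<xi> (snd x) (fst x)) \<in> borel_measurable (M \<Otimes>\<^sub>M borel)"
  unfolding simple_process_def
proof (intro borel_measurable_sum)
  fix l assume "l \<in> {..<n}"
  then have [measurable]: "random_variable borel (\<xi> l)" using assms by simp
  show "(\<lambda>x. \<xi> l (fst x) * indicat_real {\<tau> l<..\<tau> (Suc l)} (snd x)) \<in> borel_measurable (M \<Otimes>\<^sub>M borel)"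
    by measurable
qed

end

context driving_noise
begin

lemma simple_integrandD:
  assumes "simple_integrand F n \<tau> \<xi>'"
  shows "0 \<le> \<tau> 0" "\<And>l. l < n \<Longrightarrow> \<tau> l \<le> \<tau> (Suc l)" "\<And>l. l < n \<Longrightarrow> \<xi>' l \<in> borel_measurable (F (\<tau> l))"
    "\<And>l. l < n \<Longrightarrow> random_variable borel (\<xi>' l)" "\<And>l. l \<le> n \<Longrightarrow> 0 \<le> \<tau> l"
proof -
  show 1: "0 \<le> \<tau> 0" and 2: "\<And>l. l < n \<Longrightarrow> \<tau> l \<le> \<tau> (Suc l)" and 3: "\<And>l. l < n \<Longrightarrow> \<xi>' l \<in> borel_measurable (F (\<tau> l))"
    using assms by (auto simp: simple_integrand_def)
  then show "\<And>l. l < n \<Longrightarrow> random_variable borel (\<xi>' l)"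
    by (auto intro: measurable_F_M)
  show "l \<le> n \<Longrightarrow> 0 \<le> \<tau> l" for l
    by (induction l) (use 1 2 in \<open>auto intro: order_trans\<close>)
qed

lemma simple_process_adapted_on_grid:
  assumes simple: "simple_integrand F n \<tau> \<xi>'"
    and g: "\<And>i. i < k \<Longrightarrow> g i < g (Suc i)" and R: "grid_refines \<tau> n (g ` {..k}) (g k)" and i: "i < k"
  shows "simple_process n \<tau> \<xi>' (g (Suc i)) \<in> borel_measurable (F (g i))"
proof -
  have "simple_process n \<tau> \<xi>' (g (Suc i)) = (\<lambda>\<omega>. \<Sum>l<n. \<xi>' l \<omega> * of_bool (\<tau> l \<le> g i \<and> g i < \<tau> (Suc l)))"
    using simple_process_on_grid[OF g R i] g[OF i] by auto
  also have "\<dots> \<in> borel_measurable (F (g i))"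
  proof (intro borel_measurable_sum)
    fix l assume "l \<in> {..<n}"
    then have "\<xi>' l \<in> borel_measurable (F (g i))" if "\<tau> l \<le> g i"
      using simple_integrandD(3)[OF simple] that by (intro measurable_F_mono[OF that]) auto
    then show "(\<lambda>\<omega>. \<xi>' l \<omega> * of_bool (\<tau> l \<le> g i \<and> g i < \<tau> (Suc l))) \<in> borel_measurable (F (g i))"
      by (cases "\<tau> l \<le> g i") auto
  qed
  finally show ?thesis .
qed

text \<open>The inequality of Lenglart for the difference of two simple processes, written on a common refinement that
  contains the times of interest.\<close>

lemma simple_integral_maximal:
  assumes s1: "simple_integrand F n1 \<tau>1 \<xi>1" and s2: "simple_integrand F n2 \<tau>2 \<xi>2"
    and R: "finite R" "R \<subseteq> {0..T}" and T: "0 \<le> T" and pos: "0 < \<epsilon>" "0 < \<delta>"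
  shows "prob {\<omega>\<in>space M. \<exists>s\<in>R. \<epsilon> < \<bar>simple_integral n1 \<tau>1 \<xi>1 W s \<omega> - simple_integral n2 \<tau>2 \<xi>2 W s \<omega>\<bar>} \<le>
    prob {\<omega>\<in>space M. ennreal \<delta> < (\<integral>\<^sup>+s\<in>{0..T}. ennreal ((simple_process n1 \<tau>1 \<xi>1 s \<omega> - simple_process n2 \<tau>2 \<xi>2 s \<omega>)\<^sup>2) \<partial>lborel)}
    + \<delta> / \<epsilon>\<^sup>2"
proof -
  define R' where "R' = insert 0 (insert T (R \<union> ((\<tau>1 ` {..n1} \<union> \<tau>2 ` {..n2}) \<inter> {0..T})))"
  obtain g k where g: "g 0 = 0" "g k = T" "\<And>i. i < k \<Longrightarrow> g i < g (Suc i)" and R': "g ` {..k} = R'"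
    using finite_set_grid[of R' T] R T unfolding R'_def by auto
  have r1: "grid_refines \<tau>1 n1 (g ` {..k}) (g k)" and r2: "grid_refines \<tau>2 n2 (g ` {..k}) (g k)"
    using simple_integrandD(5)[OF s1] simple_integrandD(5)[OF s2]
    unfolding R' g(2) by (auto simp: grid_refines_def R'_def)
  define d where "d i \<omega> = simple_process n1 \<tau>1 \<xi>1 (g (Suc i)) \<omega> - simple_process n2 \<tau>2 \<xi>2 (g (Suc i)) \<omega>" for i \<omega>
  have dF: "d i \<in> borel_measurable (F (g i))" if "i < k" for i
    unfolding d_def
    by (intro borel_measurable_diff simple_process_adapted_on_grid[OF s1 g(3) r1 that] simple_process_adapted_on_grid[OF s2 g(3) r2 that])
  have SI: "simple_integral n1 \<tau>1 \<xi>1 W (g j) \<omega> - simple_integral n2 \<tau>2 \<xi>2 W (g j) \<omega> =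
      (\<Sum>i<j. d i \<omega> * (W (g (Suc i)) \<omega> - W (g i) \<omega>))" if "j \<le> k" for j \<omega>
    using simple_integral_on_grid[OF g(1,3) r1 simple_integrandD(1,2)[OF s1] that]
      simple_integral_on_grid[OF g(1,3) r2 simple_integrandD(1,2)[OF s2] that]
    by (simp add: d_def sum_subtractf left_diff_distrib)
  have QV: "(\<integral>\<^sup>+s\<in>{0..T}. ennreal ((simple_process n1 \<tau>1 \<xi>1 s \<omega> - simple_process n2 \<tau>2 \<xi>2 s \<omega>)\<^sup>2) \<partial>lborel) =
      ennreal (\<Sum>i<k. (d i \<omega>)\<^sup>2 * (g (Suc i) - g i))" for \<omega>
    unfolding g(2)[symmetric]
  proof (rule nn_integral_step[OF g(1,3)])
    show "(\<lambda>s. ennreal ((simple_process n1 \<tau>1 \<xi>1 s \<omega> - simple_process n2 \<tau>2 \<xi>2 s \<omega>)\<^sup>2)) \<in> borel_measurable borel"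
      unfolding simple_process_def by measurable
    fix i s assume *: "i < k" "g i < s" "s \<le> g (Suc i)"
    show "ennreal ((simple_process n1 \<tau>1 \<xi>1 s \<omega> - simple_process n2 \<tau>2 \<xi>2 s \<omega>)\<^sup>2) = ennreal ((d i \<omega>)\<^sup>2)"
      using * g(3)[OF *(1)] by (simp add: d_def simple_process_on_grid[OF g(3) r1] simple_process_on_grid[OF g(3) r2])
  qed auto
  have "{\<omega>\<in>space M. \<exists>s\<in>R. \<epsilon> < \<bar>simple_integral n1 \<tau>1 \<xi>1 W s \<omega> - simple_integral n2 \<tau>2 \<xi>2 W s \<omega>\<bar>} \<subseteq>
    {\<omega>\<in>space M. \<exists>j\<le>k. \<epsilon> < \<bar>\<Sum>i<j. d i \<omega> * (W (g (Suc i)) \<omega> - W (g i) \<omega>)\<bar>}"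
  proof safe
    fix \<omega> s assume "s \<in> R" and *: "\<epsilon> < \<bar>simple_integral n1 \<tau>1 \<xi>1 W s \<omega> - simple_integral n2 \<tau>2 \<xi>2 W s \<omega>\<bar>"
    then have "s \<in> g ` {..k}" unfolding R' R'_def by simp
    then obtain j where "j \<le> k" "s = g j" by auto
    then show "\<exists>j\<le>k. \<epsilon> < \<bar>\<Sum>i<j. d i \<omega> * (W (g (Suc i)) \<omega> - W (g i) \<omega>)\<bar>"
      using * SI[of j \<omega>] by auto
  qed
  moreover have "{\<omega>\<in>space M. \<exists>j\<le>k. \<epsilon> < \<bar>\<Sum>i<j. d i \<omega> * (W (g (Suc i)) \<omega> - W (g i) \<omega>)\<bar>} \<in> events"
  proof -
    have "{\<omega>\<in>space M. \<epsilon> < \<bar>\<Sum>i<j. d i \<omega> * (W (g (Suc i)) \<omega> - W (g i) \<omega>)\<bar>} \<in> events" if "j \<in> {..k}" for j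
    proof -
      define D where "D \<omega> = (\<Sum>i<j. d i \<omega> * (W (g (Suc i)) \<omega> - W (g i) \<omega>))" for \<omega>
      have "D \<in> borel_measurable (F (g j))"
        unfolding D_def
        by (rule increment_sum_measurable[where g=g and k=k and d=d]) (use that g dF in auto)
      then have [measurable]: "random_variable borel D"
        by (rule measurable_F_M)
      have "{\<omega>\<in>space M. \<epsilon> < \<bar>D \<omega>\<bar>} \<in> events"
        by measurable
      then show ?thesis by (simp add: D_def)
    qed
    then have "(\<Union>j\<in>{..k}. {\<omega>\<in>space M. \<epsilon> < \<bar>\<Sum>i<j. d i \<omega> * (W (g (Suc i)) \<omega> - W (g i) \<omega>)\<bar>}) \<in> events"
      by (intro sets.finite_UN) auto
    also have "(\<Union>j\<in>{..k}. {\<omega>\<in>space M. \<epsilon> < \<bar>\<Sum>i<j. d i \<omega> * (W (g (Suc i)) \<omega> - W (g i) \<omega>)\<bar>}) =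
      {\<omega>\<in>space M. \<exists>j\<le>k. \<epsilon> < \<bar>\<Sum>i<j. d i \<omega> * (W (g (Suc i)) \<omega> - W (g i) \<omega>)\<bar>}"
      by auto
    finally show ?thesis .
  qed
  ultimately have "prob {\<omega>\<in>space M. \<exists>s\<in>R. \<epsilon> < \<bar>simple_integral n1 \<tau>1 \<xi>1 W s \<omega> - simple_integral n2 \<tau>2 \<xi>2 W s \<omega>\<bar>} \<le>
    prob {\<omega>\<in>space M. \<exists>j\<le>k. \<epsilon> < \<bar>\<Sum>i<j. d i \<omega> * (W (g (Suc i)) \<omega> - W (g i) \<omega>)\<bar>}"
    by (rule finite_measure_mono)
  also have "\<dots> \<le> prob {\<omega>\<in>space M. \<delta> < (\<Sum>i<k. (d i \<omega>)\<^sup>2 * (g (Suc i) - g i))} + \<delta> / \<epsilon>\<^sup>2"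
    by (rule lenglart_inequality[where g=g and k=k and d=d]) (use g dF pos in auto)
  also have "{\<omega>\<in>space M. \<delta> < (\<Sum>i<k. (d i \<omega>)\<^sup>2 * (g (Suc i) - g i))} =
     {\<omega>\<in>space M. ennreal \<delta> < (\<integral>\<^sup>+s\<in>{0..T}. ennreal ((simple_process n1 \<tau>1 \<xi>1 s \<omega> - simple_process n2 \<tau>2 \<xi>2 s \<omega>)\<^sup>2) \<partial>lborel)}"
    unfolding QV using pos by (simp add: ennreal_less_iff)
  finally show ?thesis .
qed

end

section \<open>Uniform approximation of the Ito integral\<close>

text \<open>Among the multiples of \<open>T / (i + 1)\<close> the next one above \<open>s\<close> is close to \<open>s\<close>.\<close>

lemma uniform_mesh_point:
  assumes "0 < T" "s \<in> {0..T}"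
  obtains l where "l \<le> Suc i" "s \<le> T * real l / real (Suc i)" "T * real l / real (Suc i) \<le> s + T / real (Suc i)"
proof
  define x where "x = s * real (Suc i) / T"
  have x: "0 \<le> x" "x \<le> real (Suc i)"
    using assms mult_right_mono[of s T "real (Suc i)"]
    by (simp_all add: x_def divide_le_eq mult.commute)
  have l: "x \<le> real (nat \<lceil>x\<rceil>)" "real (nat \<lceil>x\<rceil>) \<le> x + 1"
    using x(1) le_of_int_ceiling[of x] of_int_ceiling_le_add_one[of x] by auto
  show "nat \<lceil>x\<rceil> \<le> Suc i"
    using x by (simp add: nat_le_iff ceiling_le_iff)
  have s: "s = T * x / real (Suc i)"
    using assms by (simp add: x_def)
  show "s \<le> T * real (nat \<lceil>x\<rceil>) / real (Suc i)"
    unfolding s using l assms by (intro divide_right_mono mult_left_mono) auto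
  have "T * real (nat \<lceil>x\<rceil>) / real (Suc i) \<le> T * (x + 1) / real (Suc i)"
    using l assms by (intro divide_right_mono mult_left_mono) auto
  also have "\<dots> = s + T / real (Suc i)"
    unfolding s by (simp add: distrib_left add_divide_distrib)
  finally show "T * real (nat \<lceil>x\<rceil>) / real (Suc i) \<le> s + T / real (Suc i)" .
qed

context prob_space
begin

lemma expectation_tendsto_0_of_prob:
  fixes X :: "nat \<Rightarrow> 'a \<Rightarrow> real"
  assumes X[measurable]: "\<And>n. random_variable borel (X n)" and b: "\<And>n \<omega>. 0 \<le> X n \<omega>" "\<And>n \<omega>. X n \<omega> \<le> 1"
    and lim: "\<And>\<epsilon>. 0 < \<epsilon> \<Longrightarrow> (\<lambda>n. prob {\<omega>\<in>space M. \<epsilon> < X n \<omega>}) \<longlonglongrightarrow> 0"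
  shows "(\<lambda>n. expectation (X n)) \<longlonglongrightarrow> 0"
proof (rule LIMSEQ_I)
  fix r :: real assume r: "0 < r"
  then obtain N where N: "\<And>n. N \<le> n \<Longrightarrow> norm (prob {\<omega>\<in>space M. r / 2 < X n \<omega>} - 0) < r / 2"
    using LIMSEQ_D[OF lim[of "r / 2"], of "r / 2"] by auto
  have int: "integrable M (X n)" for n
    using b by (intro integrable_const_bound[of _ 1]) auto
  have "expectation (X n) \<le> r / 2 + prob {\<omega>\<in>space M. r / 2 < X n \<omega>}" for n
  proof -
    have "expectation (X n) \<le> expectation (\<lambda>\<omega>. r / 2 + indicator {\<omega>\<in>space M. r / 2 < X n \<omega>} \<omega>)"
    proof (rule integral_mono[OF int])
      show "integrable M (\<lambda>\<omega>. r / 2 + indicat_real {\<omega>\<in>space M. r / 2 < X n \<omega>} \<omega>)"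
        by (intro Bochner_Integration.integrable_add) (auto simp: emeasure_eq_measure)
      show "X n \<omega> \<le> r / 2 + indicat_real {\<omega>\<in>space M. r / 2 < X n \<omega>} \<omega>" if "\<omega> \<in> space M" for \<omega>
        using b(2)[of n \<omega>] r that by (auto split: split_indicator)
    qed
    also have "\<dots> = r / 2 + prob {\<omega>\<in>space M. r / 2 < X n \<omega>}"
      by (subst Bochner_Integration.integral_add) (auto simp: emeasure_eq_measure prob_space)
    finally show ?thesis .
  qed
  have "0 \<le> expectation (X n)" for n
    using b by (intro integral_nonneg_AE) auto
  have "norm (expectation (X n) - 0) < r" if "N \<le> n" for n
  proof -
    have "prob {\<omega>\<in>space M. r / 2 < X n \<omega>} < r / 2"
      using N[OF that] by simp
    then have "expectation (X n) < r"
      using \<open>\<And>n. expectation (X n) \<le> r / 2 + prob {\<omega>\<in>space M. r / 2 < X n \<omega>}\<close>[of n] by linarith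
    then show ?thesis
      using \<open>\<And>n. 0 \<le> expectation (X n)\<close>[of n] by simp
  qed
  then show "\<exists>N. \<forall>n\<ge>N. norm (expectation (X n) - 0) < r"
    by blast
qed

end

lemma square_diff_le:
  fixes a b c :: real
  shows "(a - b)\<^sup>2 \<le> 2 * (a - c)\<^sup>2 + 2 * (b - c)\<^sup>2"
proof -
  have "0 \<le> ((a - c) + (b - c))\<^sup>2" by simp
  then show ?thesis by (simp add: power2_eq_square algebra_simps)
qed

context driving_noise
begin

text \<open>Clamping time to \<open>[0, T]\<close> turns progressive measurability into ordinary joint measurability.\<close>

lemma progressive_clamped_measurable:
  assumes H: "progressive F H" and T: "0 \<le> T"
  shows "(\<lambda>x. H (max 0 (min T (snd x))) (fst x)) \<in> borel_measurable (M \<Otimes>\<^sub>M borel)"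
proof -
  have idF: "(\<lambda>x. x) \<in> measurable M (F T)"
    using sets_F_events[of T] by (auto simp: measurable_def sets.Int_space_eq2)
  have "(\<lambda>x. (max 0 (min T (snd x)), fst x)) \<in> measurable (M \<Otimes>\<^sub>M borel) (restrict_space borel {0..T} \<Otimes>\<^sub>M F T)"
  proof (rule measurable_Pair)
    show "(\<lambda>x. max 0 (min T (snd x))) \<in> measurable (M \<Otimes>\<^sub>M borel) (restrict_space borel {0..T})"
      using T by (intro measurable_restrict_space2) auto
    show "fst \<in> measurable (M \<Otimes>\<^sub>M borel) (F T)"
      by (rule measurable_compose[OF measurable_fst idF])
  qed
  from measurable_compose[OF this, of "\<lambda>(s, \<omega>). H s \<omega>"] show ?thesis
    using H T by (simp add: progressive_def)
qed

text \<open>Convergence in probability of the elementary integrals is only known at each single time. To control all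
  points of \<open>R i\<close> at once, compare the \<open>i\<close>-th with the \<open>j\<close>-th elementary integral by \<open>simple_integral_maximal\<close>
  and let \<open>j\<close> tend to infinity: for fixed \<open>i\<close> only finitely many times occur. The grid \<open>R i\<close> may therefore depend on
  \<open>i\<close>; it is chosen to contain the jump times of the \<open>i\<close>-th integrand and to have mesh of order \<open>1 / i\<close>. A
  subsequence then converges almost surely.\<close>

lemma ito_integral_uniform_approximation:
  assumes ito: "has_ito_integral F W H I" and T: "0 < T"
  obtains n \<tau> \<xi>' R where
    "\<And>i. simple_integrand F (n i) (\<tau> i) (\<xi>' i)"
    "\<And>i. finite (R i)" "\<And>i. R i \<subseteq> {0..T}" "\<And>i. 0 \<in> R i" "\<And>i. T \<in> R i"
    "\<And>i. grid_refines (\<tau> i) (n i) (R i) T"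
    "\<And>i s. s \<in> {0..T} \<Longrightarrow> \<exists>r\<in>R i. s \<le> r \<and> r \<le> s + T / real (Suc i)"
    "AE \<omega> in M. (\<lambda>i. MAX s\<in>R i. \<bar>simple_integral (n i) (\<tau> i) (\<xi>' i) W s \<omega> - I s \<omega>\<bar>) \<longlonglongrightarrow> 0"
    "AE \<omega> in M. (\<lambda>i. \<integral>\<^sup>+s\<in>{0..T}. ennreal ((simple_process (n i) (\<tau> i) (\<xi>' i) s \<omega> - H s \<omega>)\<^sup>2) \<partial>lborel) \<longlonglongrightarrow> 0"
proof -
  from ito obtain n \<tau> \<xi>' where simple: "\<And>i. simple_integrand F (n i) (\<tau> i) (\<xi>' i)"
    and limH: "\<And>t \<epsilon>. 0 \<le> t \<Longrightarrow> 0 < \<epsilon> \<Longrightarrow> (\<lambda>i. prob {\<omega> \<in> space M.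
               (\<integral>\<^sup>+s\<in>{0..t}. ennreal ((simple_process (n i) (\<tau> i) (\<xi>' i) s \<omega> - H s \<omega>)\<^sup>2) \<partial>lborel)
                 > ennreal \<epsilon>}) \<longlonglongrightarrow> 0"
    and limI: "\<And>t. 0 \<le> t \<Longrightarrow> tendsto_prob (\<lambda>i. simple_integral (n i) (\<tau> i) (\<xi>' i) W t) (I t)"
    unfolding has_ito_integral_def by blast
  define SP where "SP i s \<omega> = simple_process (n i) (\<tau> i) (\<xi>' i) s \<omega>" for i s \<omega>
  define SI where "SI i s \<omega> = simple_integral (n i) (\<tau> i) (\<xi>' i) W s \<omega>" for i s \<omega>
  define U where "U i \<omega> = (\<integral>\<^sup>+s\<in>{0..T}. ennreal ((SP i s \<omega> - H s \<omega>)\<^sup>2) \<partial>lborel)" for i \<omega>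
  define R where "R i = insert 0 (insert T ((\<tau> i ` {..n i} \<inter> {0..T}) \<union> (\<lambda>l. T * real l / real (Suc i)) ` {..Suc i}))" for i
  define V where "V i \<omega> = (MAX s\<in>R i. \<bar>SI i s \<omega> - I s \<omega>\<bar>)" for i \<omega>
  have "T * real l / real (Suc i) \<le> T" if "l \<le> Suc i" for l i
    using that T mult_left_mono[of "real l" "real (Suc i)" T] by (simp add: divide_le_eq del: of_nat_Suc)
  then have R: "finite (R i)" "R i \<subseteq> {0..T}" "0 \<in> R i" "T \<in> R i" "grid_refines (\<tau> i) (n i) (R i) T" "R i \<noteq> {}" for i
    using T simple_integrandD(5)[OF simple[of i]]
    by (auto simp: R_def grid_refines_def simp del: of_nat_Suc)
  have mesh: "\<exists>r\<in>R i. s \<le> r \<and> r \<le> s + T / real (Suc i)" if s: "s \<in> {0..T}" for i s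
  proof -
    obtain l where "l \<le> Suc i" "s \<le> T * real l / real (Suc i)" "T * real l / real (Suc i) \<le> s + T / real (Suc i)"
      by (rule uniform_mesh_point[OF T s])
    then show ?thesis
      by (intro bexI[of _ "T * real l / real (Suc i)"]) (auto simp: R_def)
  qed
  have prog: "progressive F H"
    using ito by (simp add: has_ito_integral_def)
  have Hm: "(\<lambda>x. H (max 0 (min T (snd x))) (fst x)) \<in> borel_measurable (M \<Otimes>\<^sub>M borel)"
    using progressive_clamped_measurable[OF prog] T by simp
  have SPm: "(\<lambda>x. SP i (snd x) (fst x)) \<in> borel_measurable (M \<Otimes>\<^sub>M borel)" for i
    unfolding SP_def by (rule simple_process_measurable) (rule simple_integrandD(4)[OF simple])
  have clamp: "s \<in> {0..T} \<Longrightarrow> max 0 (min T s) = s" for s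
    by auto
  have Ueq: "U i \<omega> = (\<integral>\<^sup>+s. ennreal ((SP i s \<omega> - H (max 0 (min T s)) \<omega>)\<^sup>2) * indicator {0..T} s \<partial>lborel)" for i \<omega>
    unfolding U_def by (intro nn_integral_cong) (simp add: clamp split: split_indicator)
  have mU[measurable]: "random_variable borel (U i)" for i
  proof -
    have "(\<lambda>x. ennreal ((SP i (snd x) (fst x) - H (max 0 (min T (snd x))) (fst x))\<^sup>2) * indicator {0..T} (snd x))
      \<in> borel_measurable (M \<Otimes>\<^sub>M borel)"
      using Hm SPm[of i] by measurable
    then have "(\<lambda>(\<omega>, s). ennreal ((SP i s \<omega> - H (max 0 (min T s)) \<omega>)\<^sup>2) * indicator {0..T} s)
      \<in> borel_measurable (M \<Otimes>\<^sub>M lborel)"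
      by (simp add: split_beta')
    then show ?thesis
      unfolding Ueq by (rule lborel.borel_measurable_nn_integral)
  qed
  have SIm[measurable]: "random_variable borel (SI i s)" if "0 \<le> s" for i s
    unfolding SI_def simple_integral_def using that simple_integrandD(4,5)[OF simple[of i]]
    by (intro borel_measurable_sum borel_measurable_times borel_measurable_diff W_measurable) auto
  have Im[measurable]: "random_variable borel (I s)" if "0 \<le> s" for s
    using ito[unfolded has_ito_integral_def, THEN conjunct2, THEN conjunct2, THEN conjunct1, rule_format, OF that]
    by (rule measurable_F_M)
  have Vm[measurable]: "random_variable borel (V i)" for i
    unfolding V_def using R(2)[of i]
    by (intro borel_measurable_Max R(1)) (auto intro!: borel_measurable_abs borel_measurable_diff SIm Im)
  have V0: "0 \<le> V i \<omega>" for i \<omega>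
    unfolding V_def using R[of i] by (auto simp: Max_ge_iff)
  have Vlim: "(\<lambda>i. prob {\<omega>\<in>space M. \<epsilon> < V i \<omega>}) \<longlonglongrightarrow> 0" if "0 < \<epsilon>" for \<epsilon>
  proof (rule LIMSEQ_I)
    fix r :: real assume r: "0 < r"
    \<comment> \<open>Then \<open>\<delta> / (\<epsilon> / 2)\<^sup>2 = r / 2\<close>, the error term of the maximal inequality at level \<open>\<epsilon> / 2\<close>.\<close>
    define \<delta> where "\<delta> = (r / 2) * (\<epsilon> / 2)\<^sup>2"
    have \<delta>: "0 < \<delta>" using r that by (simp add: \<delta>_def)
    \<comment> \<open>The index \<open>i\<close> stays fixed and the limit is taken in the comparison index \<open>j\<close>. The factor \<open>1/4\<close> comes from
      \<open>(a - b)\<^sup>2 \<le> 2 * (a - c)\<^sup>2 + 2 * (b - c)\<^sup>2\<close>.\<close>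
    have bound: "prob {\<omega>\<in>space M. \<epsilon> < V i \<omega>} \<le> prob {\<omega>\<in>space M. ennreal (\<delta> / 4) < U i \<omega>} + r / 2" for i
    proof (rule LIMSEQ_le_const)
      let ?a = "\<lambda>j. (\<Sum>s\<in>R i. prob {\<omega>\<in>space M. \<epsilon> / 2 < \<bar>SI j s \<omega> - I s \<omega>\<bar>})"
      let ?u = "\<lambda>j. prob {\<omega>\<in>space M. ennreal (\<delta> / 4) < U j \<omega>}"
      have "(\<lambda>j. prob {\<omega>\<in>space M. \<epsilon> / 2 < \<bar>SI j s \<omega> - I s \<omega>\<bar>}) \<longlonglongrightarrow> 0" if "s \<in> R i" for s
      proof -
        have "0 \<le> s" "0 < \<epsilon> / 2"
          using R(2)[of i] that \<open>0 < \<epsilon>\<close> by auto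
        then show ?thesis
          unfolding SI_def by (intro limI[unfolded tendsto_prob_def, rule_format])
      qed
      then have a0: "?a \<longlonglongrightarrow> (\<Sum>s\<in>R i. 0)"
        by (intro tendsto_sum)
      have u0: "?u \<longlonglongrightarrow> 0"
        using limH[of T "\<delta> / 4"] T \<delta> by (simp add: U_def SP_def)
      from tendsto_add[OF tendsto_add[OF tendsto_add[OF tendsto_const u0] tendsto_const] a0]
      have "(\<lambda>j. ?u i + ?u j + r / 2 + ?a j) \<longlonglongrightarrow> ?u i + 0 + r / 2 + (\<Sum>s\<in>R i. 0)" .
      then show "(\<lambda>j. ?u i + ?u j + r / 2 + ?a j) \<longlonglongrightarrow> ?u i + r / 2"
        by simp
      have "prob {\<omega>\<in>space M. \<epsilon> < V i \<omega>} \<le> ?u i + ?u j + r / 2 + ?a j" for j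
      proof -
        let ?A = "{\<omega>\<in>space M. \<exists>s\<in>R i. \<epsilon> / 2 < \<bar>SI i s \<omega> - SI j s \<omega>\<bar>}"
        let ?B = "\<lambda>s. {\<omega>\<in>space M. \<epsilon> / 2 < \<bar>SI j s \<omega> - I s \<omega>\<bar>}"
        let ?C = "{\<omega>\<in>space M. ennreal \<delta> < (\<integral>\<^sup>+s\<in>{0..T}. ennreal ((SP i s \<omega> - SP j s \<omega>)\<^sup>2) \<partial>lborel)}"
        have sub: "{\<omega>\<in>space M. \<epsilon> < V i \<omega>} \<subseteq> ?A \<union> (\<Union>s\<in>R i. ?B s)"
        proof
          fix \<omega> assume "\<omega> \<in> {\<omega>\<in>space M. \<epsilon> < V i \<omega>}"
          then obtain s where s: "s \<in> R i" "\<epsilon> < \<bar>SI i s \<omega> - I s \<omega>\<bar>" "\<omega> \<in> space M"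
            unfolding V_def using R(1,6)[of i] by (auto simp: Max_gr_iff)
          then have "\<epsilon> / 2 < \<bar>SI i s \<omega> - SI j s \<omega>\<bar> \<or> \<epsilon> / 2 < \<bar>SI j s \<omega> - I s \<omega>\<bar>"
            by linarith
          then show "\<omega> \<in> ?A \<union> (\<Union>s\<in>R i. ?B s)"
            using s by auto
        qed
        have Bev: "?B s \<in> events" if "s \<in> R i" for s
        proof -
          have [measurable]: "random_variable borel (SI j s)" "random_variable borel (I s)"
            using R(2)[of i] that by (auto intro!: SIm Im)
          show ?thesis by measurable
        qed
        have Aev: "?A \<in> events"
        proof -
          have "{\<omega>\<in>space M. \<epsilon> / 2 < \<bar>SI i s \<omega> - SI j s \<omega>\<bar>} \<in> events" if "s \<in> R i" for s
          proof -
            have [measurable]: "random_variable borel (SI j s)" "random_variable borel (SI i s)"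
              using R(2)[of i] that by (auto intro!: SIm)
            show ?thesis by measurable
          qed
          then have "(\<Union>s\<in>R i. {\<omega>\<in>space M. \<epsilon> / 2 < \<bar>SI i s \<omega> - SI j s \<omega>\<bar>}) \<in> events"
            by (intro sets.finite_UN R(1))
          also have "(\<Union>s\<in>R i. {\<omega>\<in>space M. \<epsilon> / 2 < \<bar>SI i s \<omega> - SI j s \<omega>\<bar>}) = ?A"
            by auto
          finally show ?thesis .
        qed
        have "prob {\<omega>\<in>space M. \<epsilon> < V i \<omega>} \<le> prob (?A \<union> (\<Union>s\<in>R i. ?B s))"
          by (intro finite_measure_mono sub sets.Un Aev sets.finite_UN R(1) Bev)
        also have "\<dots> \<le> prob ?A + prob (\<Union>s\<in>R i. ?B s)"
          by (intro measure_Un_le Aev sets.finite_UN R(1) Bev)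
        also have "prob (\<Union>s\<in>R i. ?B s) \<le> ?a j"
          by (intro finite_measure_subadditive_finite R(1)) (use Bev in auto)
        also have "prob ?A \<le> prob ?C + \<delta> / (\<epsilon> / 2)\<^sup>2"
          unfolding SI_def SP_def
          by (rule simple_integral_maximal[OF simple simple R(1,2)]) (use T \<open>0 < \<epsilon>\<close> \<delta> in auto)
        also have "\<delta> / (\<epsilon> / 2)\<^sup>2 = r / 2"
          using \<open>0 < \<epsilon>\<close> by (simp add: \<delta>_def)
        also have "prob ?C \<le> prob ({\<omega>\<in>space M. ennreal (\<delta> / 4) < U i \<omega>} \<union> {\<omega>\<in>space M. ennreal (\<delta> / 4) < U j \<omega>})"
        proof (rule finite_measure_mono)
          show "?C \<subseteq> {\<omega>\<in>space M. ennreal (\<delta> / 4) < U i \<omega>} \<union> {\<omega>\<in>space M. ennreal (\<delta> / 4) < U j \<omega>}"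
          proof (rule subsetI, rule ccontr)
            fix \<omega> assume C: "\<omega> \<in> ?C" and "\<omega> \<notin> {\<omega>\<in>space M. ennreal (\<delta> / 4) < U i \<omega>} \<union> {\<omega>\<in>space M. ennreal (\<delta> / 4) < U j \<omega>}"
            then have le: "U i \<omega> \<le> ennreal (\<delta> / 4)" "U j \<omega> \<le> ennreal (\<delta> / 4)" and \<omega>: "\<omega> \<in> space M"
              by (auto simp: not_less)
            have m: "(\<lambda>s. ennreal ((SP i s \<omega> - H (max 0 (min T s)) \<omega>)\<^sup>2) * indicator {0..T} s) \<in> borel_measurable lborel" for i
              using measurable_Pair2[OF Hm \<omega>] measurable_Pair2[OF SPm \<omega>, of i] by simp
            have "(\<integral>\<^sup>+s\<in>{0..T}. ennreal ((SP i s \<omega> - SP j s \<omega>)\<^sup>2) \<partial>lborel) \<le>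
               (\<integral>\<^sup>+s. 2 * (ennreal ((SP i s \<omega> - H (max 0 (min T s)) \<omega>)\<^sup>2) * indicator {0..T} s) +
                 2 * (ennreal ((SP j s \<omega> - H (max 0 (min T s)) \<omega>)\<^sup>2) * indicator {0..T} s) \<partial>lborel)"
            proof (rule nn_integral_mono)
              fix s
              have "ennreal ((SP i s \<omega> - SP j s \<omega>)\<^sup>2) \<le>
                ennreal (2 * (SP i s \<omega> - H (max 0 (min T s)) \<omega>)\<^sup>2 + 2 * (SP j s \<omega> - H (max 0 (min T s)) \<omega>)\<^sup>2)"
                by (intro ennreal_leI square_diff_le)
              also have "\<dots> = 2 * ennreal ((SP i s \<omega> - H (max 0 (min T s)) \<omega>)\<^sup>2) + 2 * ennreal ((SP j s \<omega> - H (max 0 (min T s)) \<omega>)\<^sup>2)"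
                by (simp add: ennreal_plus ennreal_mult)
              finally have "ennreal ((SP i s \<omega> - SP j s \<omega>)\<^sup>2) \<le>
                2 * ennreal ((SP i s \<omega> - H (max 0 (min T s)) \<omega>)\<^sup>2) + 2 * ennreal ((SP j s \<omega> - H (max 0 (min T s)) \<omega>)\<^sup>2)" .
              from mult_right_mono[OF this zero_le, of "indicator {0..T} s"]
              show "ennreal ((SP i s \<omega> - SP j s \<omega>)\<^sup>2) * indicator {0..T} s \<le>
                2 * (ennreal ((SP i s \<omega> - H (max 0 (min T s)) \<omega>)\<^sup>2) * indicator {0..T} s) +
                 2 * (ennreal ((SP j s \<omega> - H (max 0 (min T s)) \<omega>)\<^sup>2) * indicator {0..T} s)"
                by (simp only: distrib_right mult.assoc)
            qed
            also have "\<dots> = 2 * U i \<omega> + 2 * U j \<omega>"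
              unfolding Ueq using m by (simp add: nn_integral_add nn_integral_cmult)
            also have "\<dots> \<le> 2 * ennreal (\<delta> / 4) + 2 * ennreal (\<delta> / 4)"
              by (intro add_mono mult_left_mono le) auto
            also have "\<dots> = ennreal (2 * (\<delta> / 4)) + ennreal (2 * (\<delta> / 4))"
              using \<delta> ennreal_mult[of 2 "\<delta> / 4"] by simp
            also have "\<dots> = ennreal \<delta>"
              using \<delta> by (subst ennreal_plus[symmetric]) auto
            finally have "(\<integral>\<^sup>+s\<in>{0..T}. ennreal ((SP i s \<omega> - SP j s \<omega>)\<^sup>2) \<partial>lborel) \<le> ennreal \<delta>" .
            moreover have "ennreal \<delta> < (\<integral>\<^sup>+s\<in>{0..T}. ennreal ((SP i s \<omega> - SP j s \<omega>)\<^sup>2) \<partial>lborel)"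
              using C unfolding mem_Collect_eq by (rule conjunct2)
            ultimately show False
              by (rule leD[THEN notE])
          qed
        qed measurable
        also have "\<dots> \<le> ?u i + ?u j"
          by (intro measure_Un_le) measurable
        finally show ?thesis by simp
      qed
      then show "\<exists>N. \<forall>j\<ge>N. prob {\<omega>\<in>space M. \<epsilon> < V i \<omega>} \<le> ?u i + ?u j + r / 2 + ?a j"
        by (intro exI[of _ 0] allI impI)
    qed
    have "(\<lambda>i. prob {\<omega>\<in>space M. ennreal (\<delta> / 4) < U i \<omega>}) \<longlonglongrightarrow> 0"
      using limH[of T "\<delta> / 4"] T \<delta> by (simp add: U_def SP_def)
    from LIMSEQ_D[OF this, of "r / 2"] r obtain N where
      "\<And>i. N \<le> i \<Longrightarrow> prob {\<omega>\<in>space M. ennreal (\<delta> / 4) < U i \<omega>} < r / 2"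
      by auto
    then have "norm (prob {\<omega>\<in>space M. \<epsilon> < V i \<omega>} - 0) < r" if "N \<le> i" for i
    proof -
      have "prob {\<omega>\<in>space M. \<epsilon> < V i \<omega>} < r"
        using bound[of i] \<open>\<And>i. N \<le> i \<Longrightarrow> prob {\<omega>\<in>space M. ennreal (\<delta> / 4) < U i \<omega>} < r / 2\<close>[OF that] by linarith
      then show ?thesis by simp
    qed
    then show "\<exists>N. \<forall>i\<ge>N. norm (prob {\<omega>\<in>space M. \<epsilon> < V i \<omega>} - 0) < r"
      by blast
  qed
  \<comment> \<open>Both errors are packed into one bounded variable, so that a single subsequence serves both.\<close>
  define X where "X i \<omega> = (min 1 (V i \<omega>) + enn2real (min 1 (U i \<omega>))) / 2" for i \<omega>
  have u1: "enn2real (min 1 (U i \<omega>)) \<le> 1" for i \<omega>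
    using enn2real_mono[of "min 1 (U i \<omega>)" 1] by simp
  have [measurable]: "random_variable borel (X i)" for i
    unfolding X_def by measurable
  have X01: "0 \<le> X i \<omega>" "X i \<omega> \<le> 1" for i \<omega>
    using u1[of i \<omega>] V0[of i \<omega>] by (auto simp: X_def)
  have Xlim: "(\<lambda>i. prob {\<omega>\<in>space M. \<epsilon> < X i \<omega>}) \<longlonglongrightarrow> 0" if "0 < \<epsilon>" for \<epsilon>
  proof (rule tendsto_sandwich[OF _ _ tendsto_const])
    let ?u = "\<lambda>j. prob {\<omega>\<in>space M. ennreal \<epsilon> < U j \<omega>}"
    have "?u \<longlonglongrightarrow> 0"
      using limH[of T \<epsilon>] T that by (simp add: U_def SP_def)
    from tendsto_add[OF Vlim[OF that] this]
    show "(\<lambda>i. prob {\<omega>\<in>space M. \<epsilon> < V i \<omega>} + ?u i) \<longlonglongrightarrow> 0" by simp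
    have "prob {\<omega>\<in>space M. \<epsilon> < X i \<omega>} \<le> prob {\<omega>\<in>space M. \<epsilon> < V i \<omega>} + ?u i" for i
    proof -
      have "{\<omega>\<in>space M. \<epsilon> < X i \<omega>} \<subseteq> {\<omega>\<in>space M. \<epsilon> < V i \<omega>} \<union> {\<omega>\<in>space M. ennreal \<epsilon> < U i \<omega>}"
      proof (rule subsetI, rule ccontr)
        fix \<omega> assume "\<omega> \<in> {\<omega>\<in>space M. \<epsilon> < X i \<omega>}"
          and "\<omega> \<notin> {\<omega>\<in>space M. \<epsilon> < V i \<omega>} \<union> {\<omega>\<in>space M. ennreal \<epsilon> < U i \<omega>}"
        then have *: "\<epsilon> < X i \<omega>" "V i \<omega> \<le> \<epsilon>" "U i \<omega> \<le> ennreal \<epsilon>" by (auto simp: not_less)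
        have "min 1 (U i \<omega>) \<le> ennreal \<epsilon>"
          using *(3) by (rule min.coboundedI2)
        then have "enn2real (min 1 (U i \<omega>)) \<le> \<epsilon>"
          using that by (intro enn2real_leI) auto
        then show False
          using * by (simp add: X_def min_def split: if_splits)
      qed
      then have "prob {\<omega>\<in>space M. \<epsilon> < X i \<omega>} \<le> prob ({\<omega>\<in>space M. \<epsilon> < V i \<omega>} \<union> {\<omega>\<in>space M. ennreal \<epsilon> < U i \<omega>})"
        by (rule finite_measure_mono) measurable
      also have "\<dots> \<le> prob {\<omega>\<in>space M. \<epsilon> < V i \<omega>} + ?u i"
        by (rule measure_Un_le) measurable
      finally show ?thesis .
    qed
    then show "\<forall>\<^sub>F i in sequentially. prob {\<omega>\<in>space M. \<epsilon> < X i \<omega>} \<le> prob {\<omega>\<in>space M. \<epsilon> < V i \<omega>} + ?u i"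
      by simp
  qed simp
  have intX: "integrable M (X i)" for i
    using X01 by (intro integrable_const_bound[of _ 1]) auto
  have "(\<lambda>i. \<integral>\<omega>. norm (X i \<omega>) \<partial>M) \<longlonglongrightarrow> 0"
    using expectation_tendsto_0_of_prob[of X, OF _ X01 Xlim] X01 by simp
  from tendsto_L1_AE_subseq[OF intX this] obtain \<rho> where \<rho>: "strict_mono \<rho>" "AE \<omega> in M. (\<lambda>i. X (\<rho> i) \<omega>) \<longlonglongrightarrow> 0"
    by blast
  have small: "\<And>i. i \<le> \<rho> i" using \<rho>(1) by (rule seq_suble)
  show thesis
  proof (rule that[of "n \<circ> \<rho>" "\<tau> \<circ> \<rho>" "\<xi>' \<circ> \<rho>" "R \<circ> \<rho>"]; (unfold comp_def)?)
    show "\<exists>r\<in>R (\<rho> i). s \<le> r \<and> r \<le> s + T / real (Suc i)" if s: "s \<in> {0..T}" for i s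
    proof -
      obtain r where "r \<in> R (\<rho> i)" "s \<le> r" "r \<le> s + T / real (Suc (\<rho> i))"
        using mesh[OF s, of "\<rho> i"] by blast
      moreover have "T / real (Suc (\<rho> i)) \<le> T / real (Suc i)"
        using small[of i] T by (intro divide_left_mono) auto
      ultimately show ?thesis
        by (intro bexI[of _ r]) auto
    qed
    show "AE \<omega> in M. (\<lambda>i. MAX s\<in>R (\<rho> i). \<bar>simple_integral (n (\<rho> i)) (\<tau> (\<rho> i)) (\<xi>' (\<rho> i)) W s \<omega> - I s \<omega>\<bar>) \<longlonglongrightarrow> 0"
      using \<rho>(2)
    proof eventually_elim
      case (elim \<omega>)
      have "(\<lambda>i. min 1 (V (\<rho> i) \<omega>)) \<longlonglongrightarrow> 0"
      proof (rule tendsto_sandwich[OF _ _ tendsto_const])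
        show "(\<lambda>i. 2 * X (\<rho> i) \<omega>) \<longlonglongrightarrow> 0"
          using tendsto_mult_left[OF elim, of 2] by simp
      qed (auto simp: X_def V0)
      then have "\<forall>\<^sub>F i in sequentially. min 1 (V (\<rho> i) \<omega>) < 1"
        by (rule order_tendstoD) simp
      then have "\<forall>\<^sub>F i in sequentially. min 1 (V (\<rho> i) \<omega>) = V (\<rho> i) \<omega>"
        by eventually_elim auto
      from Lim_transform_eventually[OF \<open>(\<lambda>i. min 1 (V (\<rho> i) \<omega>)) \<longlonglongrightarrow> 0\<close> this]
      show ?case by (simp add: V_def SI_def)
    qed
    show "AE \<omega> in M. (\<lambda>i. \<integral>\<^sup>+s\<in>{0..T}. ennreal ((simple_process (n (\<rho> i)) (\<tau> (\<rho> i)) (\<xi>' (\<rho> i)) s \<omega> - H s \<omega>)\<^sup>2) \<partial>lborel) \<longlonglongrightarrow> 0"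
      using \<rho>(2)
    proof eventually_elim
      case (elim \<omega>)
      have "(\<lambda>i. enn2real (min 1 (U (\<rho> i) \<omega>))) \<longlonglongrightarrow> 0"
      proof (rule tendsto_sandwich[OF _ _ tendsto_const])
        show "(\<lambda>i. 2 * X (\<rho> i) \<omega>) \<longlonglongrightarrow> 0"
          using tendsto_mult_left[OF elim, of 2] by simp
      qed (auto simp: X_def V0)
      from tendsto_ennrealI[OF this] have 1: "(\<lambda>i. min 1 (U (\<rho> i) \<omega>)) \<longlonglongrightarrow> 0"
        by (simp only: ennreal_enn2real[OF le_less_trans[OF min.cobounded1 ennreal_one_less_top]] ennreal_0)
      then have "\<forall>\<^sub>F i in sequentially. min 1 (U (\<rho> i) \<omega>) < 1"
        by (rule order_tendstoD) simp
      then have "\<forall>\<^sub>F i in sequentially. min 1 (U (\<rho> i) \<omega>) = U (\<rho> i) \<omega>"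
        by eventually_elim (auto simp: min_def split: if_splits)
      from Lim_transform_eventually[OF 1 this]
      show ?case by (simp add: U_def SP_def)
    qed
  qed (use simple R in auto)
qed

end

section \<open>Cadlag functions and step functions\<close>

text \<open>One-sided limits bound the function near every point, and compactness of \<open>[0, T]\<close> does the rest.\<close>

lemma cadlag_bounded:
  assumes y: "cadlag y"
  obtains B where "0 \<le> B" "\<And>s. s \<in> {0..T} \<Longrightarrow> \<bar>y s\<bar> \<le> B"
proof -
  \<comment> \<open>Nothing is known to the left of \<open>0\<close>, where the value is therefore replaced.\<close>
  define y' where "y' s = (if s < 0 then 0 else y s)" for s :: real
  have loc: "\<exists>d>0. \<exists>B. \<forall>u. dist u s < d \<longrightarrow> \<bar>y' u\<bar> \<le> B" if s: "0 \<le> s" for s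
  proof -
    have "(y \<longlongrightarrow> y s) (at_right s)"
      using y s by (simp add: cadlag_def)
    then have "((\<lambda>u. \<bar>y u\<bar>) \<longlongrightarrow> \<bar>y s\<bar>) (at_right s)"
      by (rule tendsto_rabs)
    from order_tendstoD(2)[OF this, of "\<bar>y s\<bar> + 1"]
    have "\<forall>\<^sub>F u in at_right s. \<bar>y u\<bar> < \<bar>y s\<bar> + 1" by simp
    moreover have "\<forall>\<^sub>F u in at_right s. s < u"
      by (simp add: eventually_at_right_less)
    ultimately have r: "\<forall>\<^sub>F u in at_right s. \<bar>y' u\<bar> \<le> \<bar>y s\<bar> + 1"
      by eventually_elim (use s in \<open>simp add: y'_def\<close>)
    have "\<exists>B. \<forall>\<^sub>F u in at_left s. \<bar>y' u\<bar> \<le> B"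
    proof (cases "s = 0")
      case True
      have "\<forall>\<^sub>F u in at_left s. u < s"
        by (simp add: eventually_at_filter)
      then have "\<forall>\<^sub>F u in at_left s. \<bar>y' u\<bar> \<le> 0"
        by eventually_elim (simp add: y'_def True)
      then show ?thesis by blast
    next
      case False
      then obtain l where "(y \<longlongrightarrow> l) (at_left s)"
        using y s unfolding cadlag_def by (metis order_le_less)
      then have "((\<lambda>u. \<bar>y u\<bar>) \<longlongrightarrow> \<bar>l\<bar>) (at_left s)"
        by (rule tendsto_rabs)
      from order_tendstoD(2)[OF this, of "\<bar>l\<bar> + 1"]
      have "\<forall>\<^sub>F u in at_left s. \<bar>y u\<bar> < \<bar>l\<bar> + 1" by simp
      then have "\<forall>\<^sub>F u in at_left s. \<bar>y' u\<bar> \<le> \<bar>l\<bar> + 1"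
        by eventually_elim (simp add: y'_def)
      then show ?thesis by blast
    qed
    then obtain B where l: "\<forall>\<^sub>F u in at_left s. \<bar>y' u\<bar> \<le> B" by blast
    define C where "C = max (max B (\<bar>y s\<bar> + 1)) \<bar>y' s\<bar>"
    have "\<forall>\<^sub>F u in at s. \<bar>y' u\<bar> \<le> C"
      unfolding eventually_at_split
    proof
      show "\<forall>\<^sub>F u in at_left s. \<bar>y' u\<bar> \<le> C"
        using l by eventually_elim (auto simp: C_def)
      show "\<forall>\<^sub>F u in at_right s. \<bar>y' u\<bar> \<le> C"
        using r by eventually_elim (auto simp: C_def)
    qed
    then obtain d where d: "0 < d" "\<And>u. u \<noteq> s \<Longrightarrow> dist u s < d \<Longrightarrow> \<bar>y' u\<bar> \<le> C"
      unfolding eventually_at by auto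
    have "\<bar>y' u\<bar> \<le> C" if "dist u s < d" for u
      using d(2)[of u] that by (cases "u = s") (auto simp: C_def)
    then show ?thesis using d(1) by blast
  qed
  then obtain d B where dB: "\<And>s. 0 \<le> s \<Longrightarrow> 0 < d s" "\<And>s u. 0 \<le> s \<Longrightarrow> dist u s < d s \<Longrightarrow> \<bar>y' u\<bar> \<le> B s"
    by metis
  obtain C where C: "C \<subseteq> {0..T}" "finite C" "{0..T} \<subseteq> (\<Union>s\<in>C. ball s (d s))"
    by (rule compactE_image[of "{0..T}" "{0..T}" "\<lambda>s. ball s (d s)"]) (use dB(1) in auto)
  define m where "m = Max (insert 0 (B ` C))"
  show thesis
  proof (rule that[of m])
    show "0 \<le> m" using C(2) by (simp add: m_def)
    fix s assume s: "s \<in> {0..T}"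
    then obtain c where c: "c \<in> C" "s \<in> ball c (d c)" using C(3) by auto
    then have "\<bar>y' s\<bar> \<le> B c"
      using dB(2)[of c s] C(1) by (auto simp: dist_commute)
    also have "B c \<le> m"
      using C(2) c by (simp add: m_def)
    finally show "\<bar>y s\<bar> \<le> m" using s by (simp add: y'_def)
  qed
qed

definition step_function :: "(nat \<Rightarrow> real) \<Rightarrow> nat \<Rightarrow> (nat \<Rightarrow> real) \<Rightarrow> real \<Rightarrow> real" where
  "step_function g k c s = (\<Sum>i<k. c i * indicator {g i<..g (Suc i)} s)"

lemma step_function_measurable [measurable]: "step_function g k c \<in> borel_measurable borel"
  unfolding step_function_def by measurable

lemma step_function_cell:
  fixes g :: "nat \<Rightarrow> real"
  assumes g: "\<And>i. i < k \<Longrightarrow> g i < g (Suc i)" and i: "i < k" "g i < s" "s \<le> g (Suc i)"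
  shows "step_function g k c s = c i"
proof -
  have "c l * indicator {g l<..g (Suc l)} s = (if l = i then c i else 0)" if "l < k" for l
  proof (cases l i rule: linorder_cases)
    case less
    then have "g (Suc l) \<le> g i" using grid_mono[of k g "Suc l" i] g i by auto
    then show ?thesis using less i by simp
  next
    case greater
    then have "g (Suc i) \<le> g l" using grid_mono[of k g "Suc i" l] g that by auto
    then show ?thesis using greater i by simp
  qed (use i in simp)
  then have "step_function g k c s = (\<Sum>l<k. if l = i then c i else 0)"
    unfolding step_function_def by (intro sum.cong) auto
  also have "\<dots> = c i" using i by simp
  finally show ?thesis .
qed

lemma grid_cell_exists:
  fixes g :: "nat \<Rightarrow> real"
  assumes "g 0 < s" "s \<le> g k"
  obtains i where "i < k" "g i < s" "s \<le> g (Suc i)"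
proof -
  define j where "j = (LEAST j. s \<le> g j)"
  have j: "s \<le> g j" "j \<le> k"
    unfolding j_def using LeastI[of "\<lambda>j. s \<le> g j" k] Least_le[of "\<lambda>j. s \<le> g j" k] assms by auto
  then obtain i where i: "j = Suc i" using assms by (cases j) auto
  have "\<not> s \<le> g i"
    using not_less_Least[of i "\<lambda>j. s \<le> g j"] i by (simp add: j_def)
  then show thesis using that[of i] i j by auto
qed

lemma step_function_bound:
  fixes g :: "nat \<Rightarrow> real"
  assumes g: "\<And>i. i < k \<Longrightarrow> g i < g (Suc i)" and c: "\<And>i. i < k \<Longrightarrow> \<bar>c i\<bar> \<le> B" "0 \<le> B"
  shows "\<bar>step_function g k c s\<bar> \<le> B"
proof (cases "\<exists>i<k. g i < s \<and> s \<le> g (Suc i)")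
  case True
  then obtain i where "i < k" "g i < s" "s \<le> g (Suc i)" by blast
  then show ?thesis using step_function_cell[where g=g and k=k and c=c, OF g, of i s] c by simp
next
  case False
  then have "step_function g k c s = 0"
    unfolding step_function_def by (intro sum.neutral) (auto simp: indicator_def)
  then show ?thesis using c by simp
qed

lemma integrable_indicator_Icc: "integrable lborel (indicat_real {a..b::real})"
  by (intro integrable_real_indicator) (auto simp: emeasure_lborel_Icc_eq)

lemma bounded_set_integrable:
  fixes f :: "real \<Rightarrow> real"
  assumes "set_borel_measurable lborel {0..T} f" "\<And>s. s \<in> {0..T} \<Longrightarrow> \<bar>f s\<bar> \<le> B"
  shows "set_integrable lborel {0..T} f"
proof -
  have "0 \<le> T \<longrightarrow> 0 \<le> B"
    using assms(2)[of 0] by auto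
  have "set_integrable lborel {0..T} (\<lambda>_. B)"
    by (simp add: set_integrable_def integrable_indicator_Icc)
  then show ?thesis
    unfolding set_integrable_def
    by (rule Bochner_Integration.integrable_bound)
      (use assms in \<open>auto simp: set_borel_measurable_def split: split_indicator intro!: AE_I2 order_trans[OF assms(2)]\<close>)
qed

lemma set_integral_grid:
  fixes f :: "real \<Rightarrow> real"
  assumes g: "g 0 = 0" "g k = T" "\<And>i. i < k \<Longrightarrow> g i < g (Suc i)"
    and f: "set_integrable lborel {0..T} f" and j: "j \<le> k"
  shows "(LBINT s:{0..g j}. f s) = (\<Sum>i<j. LBINT s:{g i<..g (Suc i)}. f s)"
  using j
proof (induction j)
  case 0
  have "AE s in lborel. indicator {0..g 0} s *\<^sub>R f s = 0"
    using AE_lborel_singleton[of "0::real"] by eventually_elim (simp add: g)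
  then have "(LBINT s:{0..g 0}. f s) = 0"
    unfolding set_lebesgue_integral_def by (rule integral_eq_zero_AE)
  then show ?case by simp
next
  case (Suc j)
  have le: "0 \<le> g j" "g j < g (Suc j)" "g (Suc j) \<le> T"
    using grid_mono[of k g 0 j] grid_mono[of k g "Suc j" k] g Suc.prems by auto
  then have "{0..g (Suc j)} = {0..g j} \<union> {g j<..g (Suc j)}"
    by auto
  then have "(LBINT s:{0..g (Suc j)}. f s) = (LBINT s:{0..g j}. f s) + (LBINT s:{g j<..g (Suc j)}. f s)"
    using le by (simp only:) (intro set_integral_Un set_integrable_subset[OF f]; auto)
  then show ?case using Suc by simp
qed

text \<open>The factor \<open>2\<close> in the mesh condition is what \<open>grid_sequence_of_mesh\<close> delivers, which looks at midpoints of cells.\<close>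

locale grid_sequence =
  fixes T :: real and g :: "nat \<Rightarrow> nat \<Rightarrow> real" and k :: "nat \<Rightarrow> nat"
  assumes T_pos: "0 < T" and grid_0: "\<And>n. g n 0 = 0" and grid_T: "\<And>n. g n (k n) = T"
    and grid_less: "\<And>n i. i < k n \<Longrightarrow> g n i < g n (Suc i)"
    and mesh: "\<And>n i. i < k n \<Longrightarrow> g n (Suc i) - g n i \<le> 2 * T / real (Suc n)"
begin

lemma grid_range: "i \<le> k n \<Longrightarrow> g n i \<in> {0..T}"
  using grid_mono[of "k n" "g n" 0 i] grid_mono[of "k n" "g n" i "k n"] grid_less[of _ n] grid_0 grid_T by auto

lemma mesh_tendsto: "(\<lambda>n. 2 * T / real (Suc n)) \<longlonglongrightarrow> 0"
  using LIMSEQ_Suc[OF lim_const_over_n[of "2 * T"]] by simp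

text \<open>A cadlag function is continuous from the right, and right endpoints of cells approach from the right. Summation
  by parts produces exactly the right endpoints.\<close>

lemma right_endpoint_tendsto:
  assumes y: "cadlag y" and s: "0 < s" "s \<le> T"
  shows "(\<lambda>n. step_function (g n) (k n) (\<lambda>i. y (g n (Suc i))) s) \<longlonglongrightarrow> y s"
proof -
  define r where "r n = step_function (g n) (k n) (\<lambda>i. g n (Suc i)) s" for n
  have r: "s \<le> r n \<and> r n \<le> s + 2 * T / real (Suc n) \<and>
      step_function (g n) (k n) (\<lambda>i. y (g n (Suc i))) s = y (r n)" for n
  proof -
    obtain i where i: "i < k n" "g n i < s" "s \<le> g n (Suc i)"
      by (rule grid_cell_exists[of "g n" s "k n"]) (use s grid_0 grid_T in auto)
    have "r n = g n (Suc i)"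
      "step_function (g n) (k n) (\<lambda>i. y (g n (Suc i))) s = y (g n (Suc i))"
      unfolding r_def by (rule step_function_cell[OF grid_less i]; assumption)+
    then show ?thesis
      using mesh[of i n] i by simp
  qed
  have "r \<longlonglongrightarrow> s"
  proof (rule tendsto_sandwich[OF _ _ tendsto_const])
    show "(\<lambda>n. s + 2 * T / real (Suc n)) \<longlonglongrightarrow> s"
      using tendsto_add[OF tendsto_const mesh_tendsto, of s] by simp
  qed (use r in auto)
  moreover have "continuous (at s within {s..}) y"
    using y s by (auto simp: cadlag_def continuous_within at_within_Ici_at_right)
  ultimately have "(\<lambda>n. y (r n)) \<longlonglongrightarrow> y s"
    using r by (intro continuous_within_tendsto_compose'[of s "{s..}" y r]) auto
  then show ?thesis using r by simp
qed

lemma cadlag_set_measurable: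
  assumes y: "cadlag y"
  shows "set_borel_measurable lborel {0..T} y"
proof -
  have "(\<lambda>s. y s * indicator {0<..T} s) \<in> borel_measurable borel"
  proof (rule borel_measurable_LIMSEQ_real)
    show "(\<lambda>n. step_function (g n) (k n) (\<lambda>i. y (g n (Suc i))) s * indicator {0<..T} s) \<longlonglongrightarrow> y s * indicator {0<..T} s" for s
      using right_endpoint_tendsto[OF y, of s] by (cases "s \<in> {0<..T}") auto
  qed measurable
  then have "(\<lambda>s. y s * indicator {0<..T} s + y 0 * indicator {0} s) \<in> borel_measurable borel"
    by measurable
  also have "(\<lambda>s. y s * indicator {0<..T} s + y 0 * indicator {0} s) = (\<lambda>s. indicator {0..T} s *\<^sub>R y s)"
    using T_pos by (auto simp: fun_eq_iff split: split_indicator)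
  finally show ?thesis by (simp add: set_borel_measurable_def)
qed

lemma cadlag_set_integrable:
  assumes y: "cadlag y"
  shows "set_integrable lborel {0..T} y"
proof -
  obtain B where "0 \<le> B" "\<And>s. s \<in> {0..T} \<Longrightarrow> \<bar>y s\<bar> \<le> B"
    by (rule cadlag_bounded[OF y, of T]) (rule that; assumption)
  from cadlag_set_measurable[OF y] this(2) show ?thesis
    by (rule bounded_set_integrable)
qed

lemma right_endpoint_L1:
  assumes y: "cadlag y"
  shows "(\<lambda>n. LBINT s:{0..T}. \<bar>step_function (g n) (k n) (\<lambda>i. y (g n (Suc i))) s - y s\<bar>) \<longlonglongrightarrow> 0"
proof -
  obtain B where B: "0 \<le> B" "\<And>s. s \<in> {0..T} \<Longrightarrow> \<bar>y s\<bar> \<le> B"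
    by (rule cadlag_bounded[OF y, of T]) (rule that; assumption)
  let ?f = "\<lambda>n. step_function (g n) (k n) (\<lambda>i. y (g n (Suc i)))"
  have fB: "\<bar>?f n s\<bar> \<le> B" for n s
  proof (rule step_function_bound)
    show "\<bar>y (g n (Suc i))\<bar> \<le> B" if "i < k n" for i
      using that by (intro B(2) grid_range Suc_leI)
  qed (fact grid_less, fact B(1))
  note [measurable] = cadlag_set_measurable[OF y, unfolded set_borel_measurable_def]
  have "(\<lambda>n. LINT s|lborel. indicator {0..T} s *\<^sub>R \<bar>?f n s - y s\<bar>) \<longlonglongrightarrow> (LINT s|(lborel :: real measure). (0::real))"
  proof (rule integral_dominated_convergence[where w="\<lambda>s. indicator {0..T} s *\<^sub>R (2 * B)"])
    have eq: "(\<lambda>s. indicator {0..T} s *\<^sub>R \<bar>?f n s - y s\<bar>) =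
      (\<lambda>s. \<bar>indicator {0..T} s *\<^sub>R ?f n s - indicator {0..T} s *\<^sub>R y s\<bar>)" for n
      by (rule ext) (simp add: indicator_def)
    show "(\<lambda>s. indicator {0..T} s *\<^sub>R \<bar>?f n s - y s\<bar>) \<in> borel_measurable lborel" for n
      unfolding eq by measurable
    show "AE s in lborel. (\<lambda>n. indicator {0..T} s *\<^sub>R \<bar>?f n s - y s\<bar>) \<longlonglongrightarrow> 0"
      using AE_lborel_singleton[of "0::real"]
    proof eventually_elim
      case (elim s)
      show ?case
      proof (cases "s \<in> {0<..T}")
        case True
        then have "(\<lambda>n. ?f n s - y s) \<longlonglongrightarrow> y s - y s"
          by (intro tendsto_diff right_endpoint_tendsto[OF y] tendsto_const) auto
        then show ?thesis
          using True by (auto intro: tendsto_rabs_zero)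
      next
        case False
        then have "s \<notin> {0..T}" using elim by auto
        then show ?thesis by simp
      qed
    qed
    show "AE s in lborel. norm (indicator {0..T} s *\<^sub>R \<bar>?f n s - y s\<bar>) \<le> indicator {0..T} s *\<^sub>R (2 * B)" for n
    proof (rule AE_I2)
      fix s
      show "norm (indicator {0..T} s *\<^sub>R \<bar>?f n s - y s\<bar>) \<le> indicator {0..T} s *\<^sub>R (2 * B)"
        using fB[of n s] B(2)[of s] by (auto split: split_indicator)
    qed
  qed (auto intro!: integrable_mult_left integrable_indicator_Icc)
  then show ?thesis
    by (simp add: set_lebesgue_integral_def)
qed

end

section \<open>Integration by parts along a discretized path\<close>

lemma set_borel_measurable_mult:
  fixes f g :: "real \<Rightarrow> real"
  assumes "set_borel_measurable M A f" "set_borel_measurable M A g"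
  shows "set_borel_measurable M A (\<lambda>x. f x * g x)"
proof -
  have "(\<lambda>x. indicator A x *\<^sub>R (f x * g x)) = (\<lambda>x. (indicator A x *\<^sub>R f x) * (indicator A x *\<^sub>R g x))"
    by (rule ext) (simp add: indicator_def)
  then show ?thesis
    using assms by (simp add: set_borel_measurable_def)
qed

lemma set_borel_measurable_add:
  fixes f g :: "real \<Rightarrow> real"
  assumes "set_borel_measurable M A f" "set_borel_measurable M A g"
  shows "set_borel_measurable M A (\<lambda>x. f x + g x)"
  using assms by (simp add: set_borel_measurable_def distrib_left)

lemma set_borel_measurable_minus:
  fixes f g :: "real \<Rightarrow> real"
  assumes "set_borel_measurable M A f" "set_borel_measurable M A g"
  shows "set_borel_measurable M A (\<lambda>x. f x - g x)"
  using assms by (simp add: set_borel_measurable_def right_diff_distrib)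

lemma set_borel_measurable_power:
  fixes f :: "real \<Rightarrow> real"
  assumes "set_borel_measurable M A f"
  shows "set_borel_measurable M A (\<lambda>x. (f x)\<^sup>2)"
  unfolding power2_eq_square by (intro set_borel_measurable_mult assms)

lemma set_borel_measurable_borel:
  fixes f :: "real \<Rightarrow> real"
  assumes [measurable]: "f \<in> borel_measurable borel"
  shows "set_borel_measurable lborel {0..T} f"
  by (simp add: set_borel_measurable_def)

lemmas set_borel_measurable_arith = set_borel_measurable_mult set_borel_measurable_add
  set_borel_measurable_minus set_borel_measurable_power

lemma set_integral_const_Ioc:
  "a \<le> b \<Longrightarrow> (LBINT s:{a<..b}. (c :: real)) = c * (b - a)"
  by (simp add: set_lebesgue_integral_def)

lemma set_integral_FTC_Ioc:
  fixes F f :: "real \<Rightarrow> real"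
  assumes ab: "a \<le> b" and F: "\<And>s. s \<in> {a..b} \<Longrightarrow> (F has_real_derivative f s) (at s within {a..b})"
    and f: "continuous_on {a..b} f"
  shows "(LBINT s:{a<..b}. f s) = F b - F a"
proof -
  have int: "set_integrable lborel {a..b} f"
    unfolding set_integrable_def using borel_integrable_atLeastAtMost'[OF f]
    by (simp add: set_integrable_def)
  have "AE s in lborel. indicator {a} s *\<^sub>R f s = 0"
    using AE_lborel_singleton[of a] by eventually_elim simp
  then have 0: "(LBINT s:{a}. f s) = 0"
    unfolding set_lebesgue_integral_def by (rule integral_eq_zero_AE)
  have "F b - F a = (LBINT s:{a..b}. f s)"
    unfolding set_lebesgue_integral_def
    by (rule integral_FTC_Icc[OF ab, symmetric])
      (use F f in \<open>auto simp: has_real_derivative_iff_has_vector_derivative\<close>)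
  also have "{a..b} = {a} \<union> {a<..b}" using ab by auto
  also have "(LBINT s:{a} \<union> {a<..b}. f s) = (LBINT s:{a}. f s) + (LBINT s:{a<..b}. f s)"
    by (intro set_integral_Un set_integrable_subset[OF int]) (use ab in auto)
  finally show ?thesis using 0 by simp
qed

lemma abs_set_integral_initial_le:
  fixes f :: "real \<Rightarrow> real"
  assumes f: "set_integrable lborel {0..T} f" and t: "t \<le> T"
  shows "\<bar>LBINT s:{0..t}. f s\<bar> \<le> (LBINT s:{0..T}. \<bar>f s\<bar>)"
proof -
  have ft: "set_integrable lborel {0..t} f"
    by (rule set_integrable_subset[OF f]) (use t in auto)
  have "\<bar>LBINT s:{0..t}. f s\<bar> \<le> (LINT s|lborel. \<bar>indicator {0..t} s *\<^sub>R f s\<bar>)"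
    unfolding set_lebesgue_integral_def by (rule integral_abs_bound)
  also have "\<dots> \<le> (LINT s|lborel. indicator {0..T} s *\<^sub>R \<bar>f s\<bar>)"
    using set_integrable_abs[OF f] ft t
    by (intro integral_mono) (auto simp: set_integrable_def split: split_indicator)
  finally show ?thesis by (simp add: set_lebesgue_integral_def)
qed

lemma summation_by_parts:
  fixes p e :: "nat \<Rightarrow> real"
  shows "(\<Sum>i<j. p i * (e (Suc i) - e i)) = p j * e j - p 0 * e 0 - (\<Sum>i<j. e (Suc i) * (p (Suc i) - p i))"
  by (induction j) (auto simp: algebra_simps)

lemma C1_bounds:
  fixes f f' :: "real \<Rightarrow> real"
  assumes T: "0 \<le> T" and deriv: "\<And>s. s \<in> {0..T} \<Longrightarrow> (f has_real_derivative f' s) (at s within {0..T})"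
    and cont: "continuous_on {0..T} f'"
  obtains P where "0 \<le> P" "\<And>s. s \<in> {0..T} \<Longrightarrow> \<bar>f s\<bar> \<le> P" "\<And>s. s \<in> {0..T} \<Longrightarrow> \<bar>f' s\<bar> \<le> P"
    "\<And>s r. s \<in> {0..T} \<Longrightarrow> r \<in> {0..T} \<Longrightarrow> \<bar>f s - f r\<bar> \<le> P * \<bar>s - r\<bar>"
proof -
  have "continuous_on {0..T} f"
    using deriv by (rule DERIV_continuous_on)
  then have "compact (f ` {0..T})" "compact (f' ` {0..T})"
    by (auto intro: compact_continuous_image cont)
  then have "bounded (f ` {0..T})" "bounded (f' ` {0..T})"
    by (auto intro: compact_imp_bounded)
  then have "\<exists>P1. \<forall>s\<in>{0..T}. \<bar>f s\<bar> \<le> P1" "\<exists>P2. \<forall>s\<in>{0..T}. \<bar>f' s\<bar> \<le> P2"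
    unfolding bounded_iff by auto
  then obtain P1 P2 where P: "\<And>s. s \<in> {0..T} \<Longrightarrow> \<bar>f s\<bar> \<le> P1" "\<And>s. s \<in> {0..T} \<Longrightarrow> \<bar>f' s\<bar> \<le> P2"
    by metis
  have P0: "0 \<le> P1" "0 \<le> P2"
    using P(1)[of 0] P(2)[of 0] T by auto
  define P where "P = P1 + P2"
  have PP: "\<bar>f s\<bar> \<le> P" "\<bar>f' s\<bar> \<le> P" if "s \<in> {0..T}" for s
    using P(1)[OF that] P(2)[OF that] P0 by (auto simp: P_def)
  have lip: "\<bar>f s - f r\<bar> \<le> P * \<bar>s - r\<bar>" if "s \<in> {0..T}" "r \<in> {0..T}" for s r
  proof -
    have "norm (f s - f r) \<le> P * norm (s - r)"
      by (rule field_differentiable_bound[of "{0..T}" f f']) (use deriv PP(2) that in auto)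
    then show ?thesis by simp
  qed
  show thesis
    by (rule that[of P]) (use P0 PP lip in \<open>auto simp: P_def\<close>)
qed

text \<open>Everything here is deterministic: \<open>y\<close>, \<open>x\<close>, \<open>z\<close> and \<open>w\<close> stand for a path of the solution, of the Ito integral of its
  square root, of the subordinator and of the Wiener process, and \<open>h n\<close> for the values of the \<open>n\<close>-th simple
  integrand on the cells of the \<open>n\<close>-th grid. The path \<open>x\<close> is related to \<open>w\<close> only through the bound \<open>V\<close>.\<close>

locale discretized_path = grid_sequence T g k for T g k +
  fixes p p' y x z w :: "real \<Rightarrow> real" and h :: "nat \<Rightarrow> nat \<Rightarrow> real" and V :: "nat \<Rightarrow> real" and a b \<sigma> v :: real
  assumes p_deriv: "\<And>s. s \<in> {0..T} \<Longrightarrow> (p has_real_derivative p' s) (at s within {0..T})"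
    and p'_cont: "continuous_on {0..T} p'"
    and riccati: "\<And>s. s \<in> {0..T} \<Longrightarrow> p' s = - (\<sigma>\<^sup>2 / 2 * (p s)\<^sup>2 - b * p s + v)"
    and y_cadlag: "cadlag y" and y_nonneg: "\<And>s. 0 \<le> s \<Longrightarrow> 0 \<le> y s"
    and sde: "\<And>t. t \<in> {0..T} \<Longrightarrow> y t = y 0 + (LBINT s:{0..t}. a - b * y s) + \<sigma> * x t + z t"
    and V_lim: "V \<longlonglongrightarrow> 0"
    and V: "\<And>n j. j \<le> k n \<Longrightarrow> \<bar>(\<Sum>i<j. h n i * (w (g n (Suc i)) - w (g n i))) - x (g n j)\<bar> \<le> V n"
    and QV: "(\<lambda>n. \<integral>\<^sup>+s\<in>{0..T}. ennreal ((step_function (g n) (k n) (h n) s - sqrt (y s))\<^sup>2) \<partial>lborel) \<longlonglongrightarrow> 0"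
begin

abbreviation hs :: "nat \<Rightarrow> real \<Rightarrow> real" where "hs n \<equiv> step_function (g n) (k n) (h n)"

lemma y_measurable: "set_borel_measurable lborel {0..T} y"
  by (rule cadlag_set_measurable[OF y_cadlag])

lemma sqrt_y_measurable: "set_borel_measurable lborel {0..T} (\<lambda>s. sqrt (y s))"
proof -
  have "(\<lambda>s. sqrt (indicator {0..T} s *\<^sub>R y s)) \<in> borel_measurable lborel"
    using y_measurable unfolding set_borel_measurable_def by measurable
  also have "(\<lambda>s. sqrt (indicator {0..T} s *\<^sub>R y s)) = (\<lambda>s. indicator {0..T} s *\<^sub>R sqrt (y s))"
    by (rule ext) (simp add: indicator_def)
  finally show ?thesis by (simp add: set_borel_measurable_def)
qed

lemma hs_measurable: "set_borel_measurable lborel {0..T} (hs n)"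
  by (rule set_borel_measurable_borel) measurable

lemma hs_bounded:
  obtains C where "0 \<le> C" "\<And>s. \<bar>hs n s\<bar> \<le> C"
proof -
  define C where "C = Max (insert 0 ((\<lambda>i. \<bar>h n i\<bar>) ` {..<k n}))"
  have C: "0 \<le> C" "\<And>i. i < k n \<Longrightarrow> \<bar>h n i\<bar> \<le> C"
    by (auto simp: C_def intro!: Max_ge)
  have "\<bar>hs n s\<bar> \<le> C" for s
    by (rule step_function_bound) (use C grid_less in auto)
  then show thesis using C(1) by (rule that[rotated])
qed

lemma y_bounded:
  obtains B where "0 \<le> B" "\<And>s. s \<in> {0..T} \<Longrightarrow> \<bar>y s\<bar> \<le> B"
  by (rule cadlag_bounded[OF y_cadlag, of T]) (rule that; assumption)

lemma square_error_integrable: "set_integrable lborel {0..T} (\<lambda>s. (hs n s - sqrt (y s))\<^sup>2)"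
proof -
  obtain B where B: "0 \<le> B" "\<And>s. s \<in> {0..T} \<Longrightarrow> \<bar>y s\<bar> \<le> B"
    by (rule y_bounded) (rule that; assumption)
  obtain C where C: "0 \<le> C" "\<And>s. \<bar>hs n s\<bar> \<le> C"
    by (rule hs_bounded[of n]) (rule that; assumption)
  show ?thesis
  proof (rule bounded_set_integrable)
    show "set_borel_measurable lborel {0..T} (\<lambda>s. (hs n s - sqrt (y s))\<^sup>2)"
      by (intro set_borel_measurable_arith hs_measurable sqrt_y_measurable)
    fix s assume s: "s \<in> {0..T}"
    have "\<bar>hs n s - sqrt (y s)\<bar> \<le> C + sqrt B"
    proof -
      have "sqrt (y s) \<le> sqrt B" "0 \<le> sqrt (y s)"
        using B(2)[OF s] y_nonneg[of s] s by auto
      then show ?thesis using C(2)[of s] by linarith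
    qed
    then have "\<bar>hs n s - sqrt (y s)\<bar>\<^sup>2 \<le> (C + sqrt B)\<^sup>2"
      by (intro power_mono) auto
    then show "\<bar>(hs n s - sqrt (y s))\<^sup>2\<bar> \<le> (C + sqrt B)\<^sup>2" by simp
  qed
qed

lemma square_error_tendsto: "(\<lambda>n. LBINT s:{0..T}. (hs n s - sqrt (y s))\<^sup>2) \<longlonglongrightarrow> 0"
proof -
  have "(\<integral>\<^sup>+s\<in>{0..T}. ennreal ((hs n s - sqrt (y s))\<^sup>2) \<partial>lborel) = ennreal (LBINT s:{0..T}. (hs n s - sqrt (y s))\<^sup>2)" for n
  proof -
    have "(\<integral>\<^sup>+s\<in>{0..T}. ennreal ((hs n s - sqrt (y s))\<^sup>2) \<partial>lborel) =
      (\<integral>\<^sup>+s. ennreal (indicator {0..T} s *\<^sub>R (hs n s - sqrt (y s))\<^sup>2) \<partial>lborel)"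
      by (rule nn_integral_cong) (simp add: indicator_def)
    also have "\<dots> = ennreal (LBINT s:{0..T}. (hs n s - sqrt (y s))\<^sup>2)"
      unfolding set_lebesgue_integral_def
      using square_error_integrable[of n] by (intro nn_integral_eq_integral) (auto simp: set_integrable_def)
    finally show ?thesis .
  qed
  moreover have "0 \<le> (LBINT s:{0..T}. (hs n s - sqrt (y s))\<^sup>2)" for n
    unfolding set_lebesgue_integral_def by (rule integral_nonneg_AE) auto
  ultimately show ?thesis
    using QV by (simp add: ennreal_tendsto_0_iff)
qed

lemma square_integrable: "set_integrable lborel {0..T} (\<lambda>s. (hs n s)\<^sup>2)"
proof -
  obtain C where C: "0 \<le> C" "\<And>s. \<bar>hs n s\<bar> \<le> C"
    by (rule hs_bounded[of n]) (rule that; assumption)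
  have "\<bar>(hs n s)\<^sup>2\<bar> \<le> C\<^sup>2" for s
    using power_mono[OF C(2)[of s], of 2] by simp
  then show ?thesis
    by (intro bounded_set_integrable set_borel_measurable_arith hs_measurable)
qed

lemma y_integrable: "set_integrable lborel {0..T} y"
  by (rule cadlag_set_integrable[OF y_cadlag])

text \<open>Write \<open>d\<close> for the difference of \<open>hs n\<close> and \<open>sqrt y\<close>. Then \<open>hs\<^sup>2 - y = d\<^sup>2 + 2 * sqrt y * d\<close>, where \<open>\<bar>d\<bar> \<le> \<eta> + d\<^sup>2 / \<eta>\<close> for every
  \<open>\<eta> > 0\<close>. Choosing \<open>\<eta>\<close> of the order of the \<open>L\<^sup>2\<close> norm of \<open>d\<close> makes both terms small.\<close>

lemma quadratic_variation_L1: "(\<lambda>n. LBINT s:{0..T}. \<bar>(hs n s)\<^sup>2 - y s\<bar>) \<longlonglongrightarrow> 0"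
proof -
  obtain B where B: "0 \<le> B" "\<And>s. s \<in> {0..T} \<Longrightarrow> \<bar>y s\<bar> \<le> B"
    by (rule y_bounded) (rule that; assumption)
  define u where "u n = (LBINT s:{0..T}. (hs n s - sqrt (y s))\<^sup>2)" for n
  \<comment> \<open>The summand \<open>1 / (n + 1)\<close> only keeps \<open>\<eta> n\<close> positive when \<open>u n = 0\<close>.\<close>
  define \<eta> where "\<eta> n = sqrt (u n + 1 / real (Suc n))" for n
  have u0: "0 \<le> u n" for n
    unfolding u_def set_lebesgue_integral_def by (rule integral_nonneg_AE) auto
  have ulim: "u \<longlonglongrightarrow> 0"
    unfolding u_def by (rule square_error_tendsto)
  have \<eta>0: "0 < \<eta> n" for n
    using u0[of n] by (auto simp: \<eta>_def intro!: add_nonneg_pos)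
  have "(\<lambda>n. u n + 1 / real (Suc n)) \<longlonglongrightarrow> 0 + 0"
    by (intro tendsto_add ulim LIMSEQ_Suc[OF lim_1_over_n])
  from tendsto_real_sqrt[OF this] have \<eta>lim: "\<eta> \<longlonglongrightarrow> 0"
    by (simp add: \<eta>_def[abs_def])
  have ue: "u n / \<eta> n \<le> \<eta> n" for n
  proof -
    have "u n \<le> \<eta> n * \<eta> n"
      using u0[of n] by (simp add: \<eta>_def)
    then show ?thesis using \<eta>0[of n] by (simp add: divide_le_eq)
  qed
  have bound: "(LBINT s:{0..T}. \<bar>(hs n s)\<^sup>2 - y s\<bar>) \<le> u n + 2 * sqrt B * (\<eta> n * T + \<eta> n)" for n
  proof -
    let ?d = "\<lambda>s. hs n s - sqrt (y s)"
    have int: "set_integrable lborel {0..T} (\<lambda>s. (?d s)\<^sup>2)" by (rule square_error_integrable)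
    have intc: "set_integrable lborel {0..T} (\<lambda>s. 2 * sqrt B * \<eta> n)"
      by (simp add: set_integrable_def integrable_indicator_Icc)
    have pt: "\<bar>(hs n s)\<^sup>2 - y s\<bar> \<le> (1 + 2 * sqrt B / \<eta> n) * (?d s)\<^sup>2 + 2 * sqrt B * \<eta> n" if s: "s \<in> {0..T}" for s
    proof -
      have q: "sqrt (y s) \<le> sqrt B" "0 \<le> sqrt (y s)" "(sqrt (y s))\<^sup>2 = y s"
        using B(2)[OF s] y_nonneg[of s] s by auto
      have "(hs n s)\<^sup>2 - y s = (?d s)\<^sup>2 + 2 * sqrt (y s) * ?d s"
        using q(3) by (simp add: power2_eq_square algebra_simps)
      then have "\<bar>(hs n s)\<^sup>2 - y s\<bar> \<le> \<bar>(?d s)\<^sup>2\<bar> + \<bar>2 * sqrt (y s) * ?d s\<bar>"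
        by (simp only: abs_triangle_ineq)
      also have "\<dots> = (?d s)\<^sup>2 + 2 * sqrt (y s) * \<bar>?d s\<bar>"
        using q(2) by (simp add: abs_mult)
      also have "2 * sqrt (y s) * \<bar>?d s\<bar> \<le> 2 * sqrt B * (\<eta> n + (?d s)\<^sup>2 / \<eta> n)"
      proof (intro mult_mono)
        show "\<bar>?d s\<bar> \<le> \<eta> n + (?d s)\<^sup>2 / \<eta> n"
        proof (cases "\<bar>?d s\<bar> \<le> \<eta> n")
          case True
          then show ?thesis using \<eta>0[of n] by (simp add: add_increasing2)
        next
          case False
          then have "\<bar>?d s\<bar> * \<eta> n \<le> \<bar>?d s\<bar> * \<bar>?d s\<bar>"
            by (intro mult_left_mono) auto
          then have "\<bar>?d s\<bar> \<le> (?d s)\<^sup>2 / \<eta> n"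
            using \<eta>0[of n] by (simp add: le_divide_eq power2_eq_square)
          then show ?thesis using \<eta>0[of n] by linarith
        qed
      qed (use q B \<eta>0[of n] in auto)
      finally show ?thesis
        by (simp add: algebra_simps)
    qed
    have "(LBINT s:{0..T}. \<bar>(hs n s)\<^sup>2 - y s\<bar>) \<le> (LBINT s:{0..T}. (1 + 2 * sqrt B / \<eta> n) * (?d s)\<^sup>2 + 2 * sqrt B * \<eta> n)"
      by (intro set_integral_mono set_integrable_abs set_integral_diff(1) square_integrable y_integrable
         set_integral_add(1) set_integrable_mult_right int intc pt)
    also have "\<dots> = (1 + 2 * sqrt B / \<eta> n) * u n + 2 * sqrt B * \<eta> n * T"
    proof -
      have "(LBINT s:{0..T}. 2 * sqrt B * \<eta> n) = 2 * sqrt B * \<eta> n * T"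
        using T_pos by (simp add: set_lebesgue_integral_def)
      then show ?thesis
        using int intc by (subst set_integral_add(2)) (auto simp: u_def set_integral_mult_right)
    qed
    also have "\<dots> = u n + 2 * sqrt B * (\<eta> n * T + u n / \<eta> n)"
      by (simp add: algebra_simps)
    also have "\<dots> \<le> u n + 2 * sqrt B * (\<eta> n * T + \<eta> n)"
      using B(1) ue[of n] by (intro add_left_mono mult_left_mono) auto
    finally show ?thesis .
  qed
  show ?thesis
  proof (rule tendsto_sandwich[OF _ _ tendsto_const])
    have "(\<lambda>n. u n + 2 * sqrt B * (\<eta> n * T + \<eta> n)) \<longlonglongrightarrow> 0 + 2 * sqrt B * (0 * T + 0)"
      by (intro tendsto_intros ulim \<eta>lim)
    then show "(\<lambda>n. u n + 2 * sqrt B * (\<eta> n * T + \<eta> n)) \<longlonglongrightarrow> 0" by simp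
    have "0 \<le> (LBINT s:{0..T}. \<bar>(hs n s)\<^sup>2 - y s\<bar>)" for n
      unfolding set_lebesgue_integral_def by (rule integral_nonneg_AE) auto
    then show "\<forall>\<^sub>F n in sequentially. 0 \<le> (LBINT s:{0..T}. \<bar>(hs n s)\<^sup>2 - y s\<bar>)" by simp
  qed (use bound in simp)
qed

lemma cell_subset: "i < k n \<Longrightarrow> {g n i<..g n (Suc i)} \<subseteq> {0..T}"
  using grid_range[of i n] grid_range[of "Suc i" n] by auto

lemma quadratic_variation_sum:
  "(\<lambda>n. \<Sum>i<k n. (h n i)\<^sup>2 * (g n (Suc i) - g n i)) \<longlonglongrightarrow> (LBINT s:{0..T}. y s)"
proof -
  have eq: "(\<Sum>i<k n. (h n i)\<^sup>2 * (g n (Suc i) - g n i)) = (LBINT s:{0..T}. (hs n s)\<^sup>2)" for n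
  proof -
    have "(LBINT s:{0..T}. (hs n s)\<^sup>2) = (\<Sum>i<k n. LBINT s:{g n i<..g n (Suc i)}. (hs n s)\<^sup>2)"
      using set_integral_grid[where g="g n" and k="k n" and j="k n", OF grid_0 grid_T grid_less square_integrable[of n] order_refl]
      by (simp add: grid_T)
    also have "\<dots> = (\<Sum>i<k n. (h n i)\<^sup>2 * (g n (Suc i) - g n i))"
    proof (rule sum.cong[OF refl])
      fix i assume "i \<in> {..<k n}"
      then have i: "i < k n" by simp
      have "(LBINT s:{g n i<..g n (Suc i)}. (hs n s)\<^sup>2) = (LBINT s:{g n i<..g n (Suc i)}. (h n i)\<^sup>2)"
        by (rule set_lebesgue_integral_cong)
          (use step_function_cell[where g="g n" and k="k n" and c="h n", OF grid_less i] in auto)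
      then show "(LBINT s:{g n i<..g n (Suc i)}. (hs n s)\<^sup>2) = (h n i)\<^sup>2 * (g n (Suc i) - g n i)"
        using grid_less[OF i] by (simp add: set_integral_const_Ioc)
    qed
    finally show ?thesis by simp
  qed
  have "(\<lambda>n. (LBINT s:{0..T}. (hs n s)\<^sup>2) - (LBINT s:{0..T}. y s)) \<longlonglongrightarrow> 0"
  proof (rule Lim_null_comparison[OF _ quadratic_variation_L1])
    have "norm ((LBINT s:{0..T}. (hs n s)\<^sup>2) - (LBINT s:{0..T}. y s)) \<le> (LBINT s:{0..T}. \<bar>(hs n s)\<^sup>2 - y s\<bar>)" for n
      using abs_set_integral_initial_le[OF set_integral_diff(1)[OF square_integrable[of n] y_integrable] order_refl]
      by (simp add: set_integral_diff(2)[OF square_integrable[of n] y_integrable])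
    then show "\<forall>\<^sub>F n in sequentially. norm ((LBINT s:{0..T}. (hs n s)\<^sup>2) - (LBINT s:{0..T}. y s))
      \<le> (LBINT s:{0..T}. \<bar>(hs n s)\<^sup>2 - y s\<bar>)" by simp
  qed
  then show ?thesis
    unfolding eq by (rule LIM_zero_cancel)
qed

end

lemma abs_sum4_le:
  fixes x1 x2 x3 x4 :: real
  shows "X = x1 + x2 + x3 + x4 \<Longrightarrow> \<bar>x1\<bar> \<le> b1 \<Longrightarrow> \<bar>x2\<bar> \<le> b2 \<Longrightarrow> \<bar>x3\<bar> \<le> b3 \<Longrightarrow> \<bar>x4\<bar> \<le> b4 \<Longrightarrow> \<bar>X\<bar> \<le> b1 + b2 + b3 + b4"
  by linarith

lemma abs_diff_le_add:
  fixes r :: real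
  shows "X = r - (I1 - I2) \<Longrightarrow> \<bar>r\<bar> \<le> c \<Longrightarrow> I1 - I2 = I3 \<Longrightarrow> \<bar>I3\<bar> \<le> I4 \<Longrightarrow> I4 \<le> d \<Longrightarrow> \<bar>X\<bar> \<le> c + d"
  by linarith

context discretized_path
begin

text \<open>The exponent in \<open>exponential_martingale\<close> for the integrand \<open>\<sigma> * p * h n\<close>, along the path.\<close>

definition discrete_exponent :: "nat \<Rightarrow> nat \<Rightarrow> real" where
  "discrete_exponent n j = (\<Sum>i<j. \<sigma> * p (g n i) * h n i * (w (g n (Suc i)) - w (g n i))
     - (\<sigma> * p (g n i) * h n i)\<^sup>2 * (g n (Suc i) - g n i) / 2
     + p (g n i) * (z (g n (Suc i)) - z (g n i)))"

text \<open>By the Riccati equation the limit of the discrete exponents involves neither \<open>x\<close> nor \<open>z\<close>.\<close>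

definition exponent :: "real \<Rightarrow> real" where
  "exponent s = p s * y s - p 0 * y 0 + v * (LBINT r:{0..s}. y r) - a * (LBINT r:{0..s}. p r)"

lemma p_cont: "continuous_on {0..T} p"
  using p_deriv by (rule DERIV_continuous_on)

lemma p_bounds:
  obtains P where "0 \<le> P" "\<And>s. s \<in> {0..T} \<Longrightarrow> \<bar>p s\<bar> \<le> P" "\<And>s. s \<in> {0..T} \<Longrightarrow> \<bar>p' s\<bar> \<le> P"
    "\<And>s r. s \<in> {0..T} \<Longrightarrow> r \<in> {0..T} \<Longrightarrow> \<bar>p s - p r\<bar> \<le> P * \<bar>s - r\<bar>"
  by (rule C1_bounds[OF less_imp_le[OF T_pos], where f=p and f'=p']) (rule p_deriv p'_cont that; assumption?)+

lemma p_measurable: "set_borel_measurable lborel {0..T} p"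
  and p'_measurable: "set_borel_measurable lborel {0..T} p'"
proof -
  have "set_borel_measurable borel {0..T} p" "set_borel_measurable borel {0..T} p'"
    by (auto intro: set_measurable_continuous_on p_cont p'_cont)
  then show "set_borel_measurable lborel {0..T} p" "set_borel_measurable lborel {0..T} p'"
    by (simp_all add: set_borel_measurable_def)
qed

lemma p_integrable: "set_integrable lborel {0..T} p"
proof -
  obtain P where "\<And>s. s \<in> {0..T} \<Longrightarrow> \<bar>p s\<bar> \<le> P"
    by (rule p_bounds) (rule that; assumption)
  then show ?thesis by (rule bounded_set_integrable[OF p_measurable])
qed

abbreviation drift :: "real \<Rightarrow> real" where "drift s \<equiv> a - b * y s"

text \<open>What \<open>discrete_exponent\<close> leaves under the time integral after summation by parts; \<open>y\<close> appears at right endpoints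
  and \<open>p\<close> at left endpoints of cells.\<close>

abbreviation time_integrand :: "nat \<Rightarrow> real \<Rightarrow> real" where
  "time_integrand n s \<equiv> step_function (g n) (k n) (\<lambda>i. y (g n (Suc i))) s * p' s + step_function (g n) (k n) (\<lambda>i. p (g n i)) s * drift s +
    \<sigma>\<^sup>2 / 2 * ((step_function (g n) (k n) (\<lambda>i. p (g n i)) s)\<^sup>2 * (hs n s)\<^sup>2)"

lemma drift_integrable: "set_integrable lborel {0..T} drift"
  by (intro set_integral_diff(1) set_integrable_mult_right y_integrable)
    (simp add: set_integrable_def integrable_indicator_Icc)

lemma step_p_bound:
  assumes "\<And>s. s \<in> {0..T} \<Longrightarrow> \<bar>p s\<bar> \<le> P" "0 \<le> P"
  shows "\<bar>step_function (g n) (k n) (\<lambda>i. p (g n i)) s\<bar> \<le> P"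
proof (rule step_function_bound)
  show "\<bar>p (g n i)\<bar> \<le> P" if "i < k n" for i
    by (rule assms(1)[OF grid_range]) (use that in simp)
qed (use grid_less assms in auto)

lemma step_y_bound:
  assumes "\<And>s. s \<in> {0..T} \<Longrightarrow> \<bar>y s\<bar> \<le> B" "0 \<le> B"
  shows "\<bar>step_function (g n) (k n) (\<lambda>i. y (g n (Suc i))) s\<bar> \<le> B"
proof (rule step_function_bound)
  show "\<bar>y (g n (Suc i))\<bar> \<le> B" if "i < k n" for i
    by (rule assms(1)[OF grid_range]) (use that in simp)
qed (use grid_less assms in auto)

lemma time_integrand_integrable: "set_integrable lborel {0..T} (time_integrand n)"
proof -
  obtain P where P: "0 \<le> P" "\<And>s. s \<in> {0..T} \<Longrightarrow> \<bar>p s\<bar> \<le> P" "\<And>s. s \<in> {0..T} \<Longrightarrow> \<bar>p' s\<bar> \<le> P"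
    by (rule p_bounds) (rule that; assumption)
  obtain B where B: "0 \<le> B" "\<And>s. s \<in> {0..T} \<Longrightarrow> \<bar>y s\<bar> \<le> B"
    by (rule y_bounded) (rule that; assumption)
  obtain C where C: "0 \<le> C" "\<And>s. \<bar>hs n s\<bar> \<le> C"
    by (rule hs_bounded[of n]) (rule that; assumption)
  have m: "set_borel_measurable lborel {0..T} (step_function (g n) (k n) c)" for c
    by (rule set_borel_measurable_borel) measurable
  have const: "set_borel_measurable lborel {0..T} (\<lambda>_. c)" for c :: real
    by (rule set_borel_measurable_borel) measurable
  show ?thesis
  proof (rule bounded_set_integrable)
    show "set_borel_measurable lborel {0..T} (time_integrand n)"
      by (intro set_borel_measurable_arith m const p'_measurable y_measurable)
    fix s assume s: "s \<in> {0..T}"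
    let ?u = "step_function (g n) (k n) (\<lambda>i. y (g n (Suc i))) s" and ?d = "step_function (g n) (k n) (\<lambda>i. p (g n i)) s"
    have ud: "\<bar>?u\<bar> \<le> B" "\<bar>?d\<bar> \<le> P"
      by (rule step_y_bound[OF B(2,1)], assumption) (rule step_p_bound[OF P(2,1)], assumption)
    have "\<bar>?u * p' s\<bar> \<le> B * P"
      unfolding abs_mult using ud P(3)[OF s] B(1) by (intro mult_mono) auto
    moreover have "\<bar>?d * drift s\<bar> \<le> P * (\<bar>a\<bar> + \<bar>b\<bar> * B)"
    proof -
      have "\<bar>b * y s\<bar> \<le> \<bar>b\<bar> * B"
        unfolding abs_mult using B(2)[OF s] by (intro mult_left_mono) auto
      then have "\<bar>drift s\<bar> \<le> \<bar>a\<bar> + \<bar>b\<bar> * B" by linarith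
      then show ?thesis
        unfolding abs_mult using ud P(1) by (intro mult_mono) auto
    qed
    moreover have "\<bar>\<sigma>\<^sup>2 / 2 * (?d\<^sup>2 * (hs n s)\<^sup>2)\<bar> \<le> \<sigma>\<^sup>2 / 2 * (P\<^sup>2 * C\<^sup>2)"
    proof -
      have "?d\<^sup>2 \<le> P\<^sup>2" "(hs n s)\<^sup>2 \<le> C\<^sup>2"
        using power_mono[OF ud(2), of 2] power_mono[OF C(2)[of s], of 2] by simp_all
      then have "?d\<^sup>2 * (hs n s)\<^sup>2 \<le> P\<^sup>2 * C\<^sup>2"
        by (intro mult_mono) auto
      then have "\<sigma>\<^sup>2 / 2 * (?d\<^sup>2 * (hs n s)\<^sup>2) \<le> \<sigma>\<^sup>2 / 2 * (P\<^sup>2 * C\<^sup>2)"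
        by (intro mult_left_mono) auto
      then show ?thesis by simp
    qed
    ultimately show "\<bar>time_integrand n s\<bar> \<le> B * P + P * (\<bar>a\<bar> + \<bar>b\<bar> * B) + \<sigma>\<^sup>2 / 2 * (P\<^sup>2 * C\<^sup>2)"
      by linarith
  qed
qed

lemma time_integrand_cell:
  assumes i: "i < k n"
  shows "(LBINT s:{g n i<..g n (Suc i)}. time_integrand n s) = y (g n (Suc i)) * (p (g n (Suc i)) - p (g n i)) +
    p (g n i) * (LBINT s:{g n i<..g n (Suc i)}. drift s) + (\<sigma> * p (g n i) * h n i)\<^sup>2 * (g n (Suc i) - g n i) / 2"
proof -
  let ?C = "{g n i<..g n (Suc i)}"
  have sub: "{g n i..g n (Suc i)} \<subseteq> {0..T}"
    using grid_range[of i n] grid_range[of "Suc i" n] i by auto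
  have "set_integrable lborel {0..T} p'"
    unfolding set_integrable_def using borel_integrable_atLeastAtMost'[OF p'_cont]
    by (simp add: set_integrable_def)
  then have i1: "set_integrable lborel ?C p'"
    by (rule set_integrable_subset) (use cell_subset[OF i] in auto)
  have i2: "set_integrable lborel ?C drift"
    by (rule set_integrable_subset[OF drift_integrable]) (use cell_subset[OF i] in auto)
  have i3: "set_integrable lborel ?C (\<lambda>_. c)" for c :: real
    by (rule set_integrable_subset[of _ "{0..T}"])
      (use cell_subset[OF i] in \<open>auto simp: set_integrable_def integrable_indicator_Icc\<close>)
  have "(LBINT s:?C. time_integrand n s) =
    (LBINT s:?C. y (g n (Suc i)) * p' s + p (g n i) * drift s + (\<sigma> * p (g n i) * h n i)\<^sup>2 / 2)"
  proof (rule set_lebesgue_integral_cong)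
    show "\<forall>s. s \<in> ?C \<longrightarrow> time_integrand n s = y (g n (Suc i)) * p' s + p (g n i) * drift s + (\<sigma> * p (g n i) * h n i)\<^sup>2 / 2"
    proof safe
      fix s assume "s \<in> ?C"
      then have *: "g n i < s" "s \<le> g n (Suc i)" by auto
      have cell: "step_function (g n) (k n) c s = c i" for c
        by (rule step_function_cell[OF grid_less i *])
      show "time_integrand n s = y (g n (Suc i)) * p' s + p (g n i) * drift s + (\<sigma> * p (g n i) * h n i)\<^sup>2 / 2"
        unfolding cell by (simp add: power_mult_distrib)
    qed
  qed simp
  also have "\<dots> = y (g n (Suc i)) * (LBINT s:?C. p' s) + p (g n i) * (LBINT s:?C. drift s) +
      (LBINT s:?C. (\<sigma> * p (g n i) * h n i)\<^sup>2 / 2)"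
    using i1 i2 i3 by (simp add: set_integral_add set_integrable_mult_right set_integral_mult_right)
  also have "(LBINT s:?C. p' s) = p (g n (Suc i)) - p (g n i)"
  proof (rule set_integral_FTC_Ioc)
    show "g n i \<le> g n (Suc i)" using grid_less[OF i] by simp
    show "(p has_real_derivative p' s) (at s within {g n i..g n (Suc i)})" if "s \<in> {g n i..g n (Suc i)}" for s
      using p_deriv[of s] that sub by (blast intro: DERIV_subset)
    show "continuous_on {g n i..g n (Suc i)} p'"
      by (rule continuous_on_subset[OF p'_cont sub])
  qed
  also have "(LBINT s:?C. (\<sigma> * p (g n i) * h n i)\<^sup>2 / 2) = (\<sigma> * p (g n i) * h n i)\<^sup>2 / 2 * (g n (Suc i) - g n i)"
    using grid_less[OF i] by (intro set_integral_const_Ioc) simp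
  finally show ?thesis by simp
qed

definition integral_error :: "nat \<Rightarrow> nat \<Rightarrow> real" where
  "integral_error n j = (\<Sum>i<j. h n i * (w (g n (Suc i)) - w (g n i))) - x (g n j)"

text \<open>Replace the increment of the elementary integral by that of \<open>x\<close> and an error, eliminate \<open>x\<close> with the equation,
  and sum by parts, which moves the increments from \<open>y\<close> to \<open>p\<close>.\<close>

lemma discrete_exponent_eq:
  assumes j: "j \<le> k n"
  shows "discrete_exponent n j = p (g n j) * y (g n j) - p 0 * y 0 + \<sigma> * (\<Sum>i<j. p (g n i) * (integral_error n (Suc i) - integral_error n i))
    - (LBINT s:{0..g n j}. time_integrand n s)"
proof -
  let ?I = "\<lambda>i. LBINT s:{g n i<..g n (Suc i)}. drift s"
  have inc: "\<sigma> * x (g n (Suc i)) + z (g n (Suc i)) - (\<sigma> * x (g n i) + z (g n i)) = y (g n (Suc i)) - y (g n i) - ?I i"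
    if "i < k n" for i
  proof -
    have "(LBINT s:{0..g n j}. drift s) = (\<Sum>l<j. ?I l)" if "j \<le> k n" for j
      by (rule set_integral_grid[where g="g n" and k="k n", OF grid_0 grid_T grid_less drift_integrable that])
    from this[of "Suc i"] this[of i] that
    have "(LBINT s:{0..g n (Suc i)}. drift s) = (LBINT s:{0..g n i}. drift s) + ?I i"
      by simp
    then show ?thesis
      using sde[OF grid_range[of "Suc i" n]] sde[OF grid_range[of i n]] that by simp
  qed
  have summand: "\<sigma> * p (g n i) * h n i * (w (g n (Suc i)) - w (g n i)) - (\<sigma> * p (g n i) * h n i)\<^sup>2 * (g n (Suc i) - g n i) / 2
     + p (g n i) * (z (g n (Suc i)) - z (g n i)) =
     p (g n i) * (y (g n (Suc i)) - y (g n i)) + y (g n (Suc i)) * (p (g n (Suc i)) - p (g n i)) +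
       \<sigma> * (p (g n i) * (integral_error n (Suc i) - integral_error n i)) - (LBINT s:{g n i<..g n (Suc i)}. time_integrand n s)"
    if "i < k n" for i
  proof -
    have dE: "h n i * (w (g n (Suc i)) - w (g n i)) = integral_error n (Suc i) - integral_error n i + (x (g n (Suc i)) - x (g n i))"
      by (simp add: integral_error_def)
    have "\<sigma> * p (g n i) * h n i * (w (g n (Suc i)) - w (g n i)) = \<sigma> * p (g n i) * (h n i * (w (g n (Suc i)) - w (g n i)))"
      by (simp only: mult.assoc)
    also have "\<dots> = \<sigma> * (p (g n i) * (integral_error n (Suc i) - integral_error n i)) + p (g n i) * (\<sigma> * x (g n (Suc i)) - \<sigma> * x (g n i))"
      unfolding dE by (simp add: algebra_simps)
    finally have "\<sigma> * p (g n i) * h n i * (w (g n (Suc i)) - w (g n i)) =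
      \<sigma> * (p (g n i) * (integral_error n (Suc i) - integral_error n i)) + p (g n i) * (\<sigma> * x (g n (Suc i)) - \<sigma> * x (g n i))" .
    moreover have "\<sigma> * x (g n (Suc i)) - \<sigma> * x (g n i) = y (g n (Suc i)) - y (g n i) - ?I i - (z (g n (Suc i)) - z (g n i))"
      using inc[OF that] by simp
    ultimately show ?thesis
      unfolding time_integrand_cell[OF that] by (simp add: algebra_simps)
  qed
  have "discrete_exponent n j = (\<Sum>i<j. p (g n i) * (y (g n (Suc i)) - y (g n i)) + y (g n (Suc i)) * (p (g n (Suc i)) - p (g n i)) +
       \<sigma> * (p (g n i) * (integral_error n (Suc i) - integral_error n i)) - (LBINT s:{g n i<..g n (Suc i)}. time_integrand n s))"
    unfolding discrete_exponent_def using j by (intro sum.cong) (auto simp: summand)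
  also have "\<dots> = (\<Sum>i<j. p (g n i) * (y (g n (Suc i)) - y (g n i))) + (\<Sum>i<j. y (g n (Suc i)) * (p (g n (Suc i)) - p (g n i))) +
     \<sigma> * (\<Sum>i<j. p (g n i) * (integral_error n (Suc i) - integral_error n i)) - (\<Sum>i<j. LBINT s:{g n i<..g n (Suc i)}. time_integrand n s)"
    by (simp add: sum.distrib sum_subtractf sum_distrib_left)
  also have "(\<Sum>i<j. LBINT s:{g n i<..g n (Suc i)}. time_integrand n s) = (LBINT s:{0..g n j}. time_integrand n s)"
    by (rule set_integral_grid[where g="g n" and k="k n", OF grid_0 grid_T grid_less time_integrand_integrable j, symmetric])
  also have "(\<Sum>i<j. p (g n i) * (y (g n (Suc i)) - y (g n i))) =
    p (g n j) * y (g n j) - p 0 * y 0 - (\<Sum>i<j. y (g n (Suc i)) * (p (g n (Suc i)) - p (g n i)))"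
    using summation_by_parts[of "\<lambda>i. p (g n i)" "\<lambda>i. y (g n i)" j] by (simp add: grid_0)
  finally show ?thesis by simp
qed

lemma exponent_eq:
  assumes t: "t \<in> {0..T}"
  shows "exponent t = p t * y t - p 0 * y 0 - (LBINT s:{0..t}. a * p s - v * y s)"
proof -
  have "set_integrable lborel {0..t} y" "set_integrable lborel {0..t} p"
    using t by (auto intro: set_integrable_subset[OF y_integrable] set_integrable_subset[OF p_integrable])
  then have "(LBINT s:{0..t}. a * p s - v * y s) = a * (LBINT s:{0..t}. p s) - v * (LBINT s:{0..t}. y s)"
    by (simp add: set_integral_diff set_integrable_mult_right set_integral_mult_right)
  then show ?thesis by (simp add: exponent_def)
qed

text \<open>The integral error enters through sums \<open>\<Sum>p * \<Delta>e\<close>, which a second summation by parts bounds by the maximum of \<open>e\<close>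
  times a bound for \<open>p\<close> and its variation. By the Riccati equation the time integrands differ by four terms: \<open>y\<close> at
  right endpoints against \<open>y\<close>, the step function of \<open>p\<close> against \<open>p\<close> (twice), and \<open>(hs n)\<^sup>2\<close> against \<open>y\<close>. Each is small
  in \<open>L\<^sup>1([0, T])\<close>, which makes the bound uniform in the upper limit of integration.\<close>

lemma exponent_uniform_limit: "\<exists>e. e \<longlonglongrightarrow> 0 \<and> (\<forall>n. \<forall>j\<le>k n. \<bar>discrete_exponent n j - exponent (g n j)\<bar> \<le> e n)"
proof -
  obtain P where P: "0 \<le> P" "\<And>s. s \<in> {0..T} \<Longrightarrow> \<bar>p s\<bar> \<le> P" "\<And>s. s \<in> {0..T} \<Longrightarrow> \<bar>p' s\<bar> \<le> P"
    "\<And>s r. s \<in> {0..T} \<Longrightarrow> r \<in> {0..T} \<Longrightarrow> \<bar>p s - p r\<bar> \<le> P * \<bar>s - r\<bar>"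
    by (rule p_bounds) (rule that; assumption)
  obtain B where B: "0 \<le> B" "\<And>s. s \<in> {0..T} \<Longrightarrow> \<bar>y s\<bar> \<le> B"
    by (rule y_bounded) (rule that; assumption)
  define \<mu> where "\<mu> n = 2 * T / real (Suc n)" for n
  have \<mu>: "0 \<le> \<mu> n" "\<mu> \<longlonglongrightarrow> 0" for n
    using T_pos mesh_tendsto by (auto simp: \<mu>_def[abs_def])
  define A where "A n = (LBINT s:{0..T}. \<bar>step_function (g n) (k n) (\<lambda>i. y (g n (Suc i))) s - y s\<bar>)" for n
  define C where "C n = (LBINT s:{0..T}. \<bar>(hs n s)\<^sup>2 - y s\<bar>)" for n
  define c where "c = \<bar>a\<bar> + \<bar>b\<bar> * B + \<sigma>\<^sup>2 * P * B"
  define e where "e n = \<bar>\<sigma>\<bar> * (2 * P + P * T) * V n + (P * A n + P * \<mu> n * c * T + \<sigma>\<^sup>2 / 2 * P\<^sup>2 * C n)" for n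
  have "e \<longlonglongrightarrow> \<bar>\<sigma>\<bar> * (2 * P + P * T) * 0 + (P * 0 + P * 0 * c * T + \<sigma>\<^sup>2 / 2 * P\<^sup>2 * 0)"
    unfolding e_def A_def C_def
    by (intro tendsto_intros V_lim right_endpoint_L1[OF y_cadlag] \<mu> quadratic_variation_L1)
  then have "e \<longlonglongrightarrow> 0" by simp
  moreover have "\<bar>discrete_exponent n j - exponent (g n j)\<bar> \<le> e n" if j: "j \<le> k n" for n j
  proof -
    let ?u = "step_function (g n) (k n) (\<lambda>i. y (g n (Suc i)))" and ?d = "step_function (g n) (k n) (\<lambda>i. p (g n i))"
    have V0: "0 \<le> V n" using V[of 0 n] by simp
    have EV: "\<bar>integral_error n i\<bar> \<le> V n" if "i \<le> k n" for i
      unfolding integral_error_def by (rule V[OF that])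
    have sbp: "\<bar>\<Sum>i<j. p (g n i) * (integral_error n (Suc i) - integral_error n i)\<bar> \<le> (2 * P + P * T) * V n"
    proof -
      have "\<bar>p (g n i) * integral_error n i\<bar> \<le> P * V n" if "i \<le> k n" for i
        unfolding abs_mult by (intro mult_mono P(2) grid_range EV that P(1)) auto
      from this[of j] this[of 0] have "\<bar>p (g n j) * integral_error n j\<bar> \<le> P * V n" "\<bar>p (g n 0) * integral_error n 0\<bar> \<le> P * V n"
        using j by auto
      moreover have "\<bar>\<Sum>i<j. integral_error n (Suc i) * (p (g n (Suc i)) - p (g n i))\<bar> \<le> P * T * V n"
      proof -
        have "\<bar>\<Sum>i<j. integral_error n (Suc i) * (p (g n (Suc i)) - p (g n i))\<bar> \<le> (\<Sum>i<j. V n * (P * (g n (Suc i) - g n i)))"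
        proof (rule order_trans[OF sum_abs sum_mono])
          fix i assume "i \<in> {..<j}"
          then have i: "i < k n" using j by simp
          have "\<bar>p (g n (Suc i)) - p (g n i)\<bar> \<le> P * (g n (Suc i) - g n i)"
            using P(4)[of "g n (Suc i)" "g n i"] grid_range[of i n] grid_range[of "Suc i" n] grid_less[OF i] i by auto
          then show "\<bar>integral_error n (Suc i) * (p (g n (Suc i)) - p (g n i))\<bar> \<le> V n * (P * (g n (Suc i) - g n i))"
            unfolding abs_mult using EV[of "Suc i"] i V0 by (intro mult_mono) auto
        qed
        also have "\<dots> = V n * P * (\<Sum>i<j. g n (Suc i) - g n i)"
          by (simp add: sum_distrib_left mult.assoc)
        also have "(\<Sum>i<j. g n (Suc i) - g n i) = g n j"
          using sum_lessThan_telescope[of "g n" j] by (simp add: grid_0)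
        also have "V n * P * g n j \<le> V n * P * T"
          using grid_range[OF j] V0 P(1) by (intro mult_left_mono) auto
        finally show ?thesis by (simp add: mult.commute mult.left_commute)
      qed
      ultimately show ?thesis
        unfolding summation_by_parts[of "\<lambda>i. p (g n i)" "integral_error n" j] by (simp add: distrib_right)
    qed
    have m: "set_borel_measurable lborel {0..T} (step_function (g n) (k n) c)" for c
      by (rule set_borel_measurable_borel) measurable
    have int: "set_integrable lborel {0..T} (\<lambda>s. a * p s - v * y s)"
      by (intro set_integral_diff(1) set_integrable_mult_right y_integrable p_integrable)
    have intd: "set_integrable lborel {0..T} (\<lambda>s. time_integrand n s - (a * p s - v * y s))"
      by (intro set_integral_diff(1) time_integrand_integrable int)
    have tj: "g n j \<in> {0..T}" by (rule grid_range[OF j])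
    have I1: "(LBINT s:{0..g n j}. time_integrand n s) - (LBINT s:{0..g n j}. a * p s - v * y s) =
      (LBINT s:{0..g n j}. time_integrand n s - (a * p s - v * y s))"
      by (rule set_integral_diff(2)[symmetric]; rule set_integrable_subset[OF time_integrand_integrable] set_integrable_subset[OF int]) (use tj in auto)
    have I2: "\<bar>LBINT s:{0..g n j}. time_integrand n s - (a * p s - v * y s)\<bar> \<le> (LBINT s:{0..T}. \<bar>time_integrand n s - (a * p s - v * y s)\<bar>)"
      using tj by (intro abs_set_integral_initial_le intd) auto
    have I3: "(LBINT s:{0..T}. \<bar>time_integrand n s - (a * p s - v * y s)\<bar>) \<le> P * A n + P * \<mu> n * c * T + \<sigma>\<^sup>2 / 2 * P\<^sup>2 * C n"
    proof -
      have iu: "set_integrable lborel {0..T} ?u"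
        by (rule bounded_set_integrable[OF m]) (rule step_y_bound[OF B(2,1)], assumption)
      have i1: "set_integrable lborel {0..T} (\<lambda>s. \<bar>?u s - y s\<bar>)"
        by (intro set_integrable_abs set_integral_diff(1) iu y_integrable)
      have i2: "set_integrable lborel {0..T} (\<lambda>s. P * \<mu> n * c)"
        by (simp add: set_integrable_def integrable_indicator_Icc)
      have i3: "set_integrable lborel {0..T} (\<lambda>s. \<bar>(hs n s)\<^sup>2 - y s\<bar>)"
        by (intro set_integrable_abs set_integral_diff(1) square_integrable y_integrable)
      have pt: "\<bar>time_integrand n s - (a * p s - v * y s)\<bar> \<le> P * \<bar>?u s - y s\<bar> + P * \<mu> n * c + \<sigma>\<^sup>2 / 2 * P\<^sup>2 * \<bar>(hs n s)\<^sup>2 - y s\<bar>"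
        if s: "0 < s" "s \<le> T" for s
      proof -
        obtain i where i: "i < k n" "g n i < s" "s \<le> g n (Suc i)"
          by (rule grid_cell_exists[of "g n" s "k n"]) (use s grid_0 grid_T in auto)
        have sT: "s \<in> {0..T}" using s by simp
        have d: "?d s = p (g n i)"
          by (rule step_function_cell[OF grid_less i])
        have dP: "\<bar>?d s\<bar> \<le> P"
          by (rule step_p_bound[OF P(2,1)])
        have "\<bar>?d s - p s\<bar> \<le> P * \<bar>g n i - s\<bar>"
          unfolding d by (rule P(4)[OF grid_range sT]) (use i in simp)
        also have "\<dots> \<le> P * \<mu> n"
          using i mesh[OF i(1)] P(1) by (intro mult_left_mono) (auto simp: \<mu>_def)
        finally have dd: "\<bar>?d s - p s\<bar> \<le> P * \<mu> n" .
        have "a * p s - v * y s = y s * p' s + p s * drift s + \<sigma>\<^sup>2 / 2 * ((p s)\<^sup>2 * y s)"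
          unfolding riccati[OF sT] by (simp add: algebra_simps)
        then have eq: "time_integrand n s - (a * p s - v * y s) = (?u s - y s) * p' s + (?d s - p s) * drift s +
          \<sigma>\<^sup>2 / 2 * ((?d s)\<^sup>2 * ((hs n s)\<^sup>2 - y s)) + \<sigma>\<^sup>2 / 2 * ((?d s - p s) * (?d s + p s) * y s)"
          by (simp add: algebra_simps power2_eq_square)
        have 1: "\<bar>(?u s - y s) * p' s\<bar> \<le> P * \<bar>?u s - y s\<bar>"
          using mult_left_mono[OF P(3)[OF sT], of "\<bar>?u s - y s\<bar>"] by (simp add: abs_mult mult.commute)
        have 2: "\<bar>(?d s - p s) * drift s\<bar> \<le> P * \<mu> n * (\<bar>a\<bar> + \<bar>b\<bar> * B)"
        proof -
          have "\<bar>b * y s\<bar> \<le> \<bar>b\<bar> * B"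
            unfolding abs_mult using B(2)[OF sT] by (intro mult_left_mono) auto
          then have "\<bar>drift s\<bar> \<le> \<bar>a\<bar> + \<bar>b\<bar> * B" by linarith
          then show ?thesis
            unfolding abs_mult using dd P(1) \<mu>(1) by (intro mult_mono) auto
        qed
        have 3: "\<bar>\<sigma>\<^sup>2 / 2 * ((?d s)\<^sup>2 * ((hs n s)\<^sup>2 - y s))\<bar> \<le> \<sigma>\<^sup>2 / 2 * P\<^sup>2 * \<bar>(hs n s)\<^sup>2 - y s\<bar>"
        proof -
          have "(?d s)\<^sup>2 \<le> P\<^sup>2"
            using power_mono[OF dP, of 2] by simp
          then have "\<sigma>\<^sup>2 / 2 * ((?d s)\<^sup>2 * \<bar>(hs n s)\<^sup>2 - y s\<bar>) \<le> \<sigma>\<^sup>2 / 2 * (P\<^sup>2 * \<bar>(hs n s)\<^sup>2 - y s\<bar>)"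
            by (intro mult_left_mono mult_right_mono) auto
          then show ?thesis by (simp add: abs_mult mult.assoc)
        qed
        have 4: "\<bar>\<sigma>\<^sup>2 / 2 * ((?d s - p s) * (?d s + p s) * y s)\<bar> \<le> P * \<mu> n * (\<sigma>\<^sup>2 * P * B)"
        proof -
          have "\<bar>?d s + p s\<bar> \<le> 2 * P"
            using dP P(2)[OF sT] by linarith
          then have "\<bar>?d s - p s\<bar> * \<bar>?d s + p s\<bar> * \<bar>y s\<bar> \<le> (P * \<mu> n) * (2 * P) * B"
            using dd B(2)[OF sT] P(1) \<mu>(1) by (intro mult_mono) auto
          then have "\<sigma>\<^sup>2 / 2 * (\<bar>?d s - p s\<bar> * \<bar>?d s + p s\<bar> * \<bar>y s\<bar>) \<le> \<sigma>\<^sup>2 / 2 * ((P * \<mu> n) * (2 * P) * B)"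
            by (intro mult_left_mono) auto
          moreover have "\<bar>\<sigma>\<^sup>2 / 2 * ((?d s - p s) * (?d s + p s) * y s)\<bar> =
              \<sigma>\<^sup>2 / 2 * (\<bar>?d s - p s\<bar> * \<bar>?d s + p s\<bar> * \<bar>y s\<bar>)"
            by (simp add: abs_mult)
          moreover have "\<sigma>\<^sup>2 / 2 * ((P * \<mu> n) * (2 * P) * B) = P * \<mu> n * (\<sigma>\<^sup>2 * P * B)"
            by simp
          ultimately show ?thesis by (simp only:)
        qed
        have "\<bar>time_integrand n s - (a * p s - v * y s)\<bar> \<le> P * \<bar>?u s - y s\<bar> + P * \<mu> n * (\<bar>a\<bar> + \<bar>b\<bar> * B)
          + \<sigma>\<^sup>2 / 2 * P\<^sup>2 * \<bar>(hs n s)\<^sup>2 - y s\<bar> + P * \<mu> n * (\<sigma>\<^sup>2 * P * B)"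
          by (rule abs_sum4_le[OF eq 1 2 3 4])
        then show ?thesis by (simp add: c_def distrib_left)
      qed
      have "(LBINT s:{0..T}. \<bar>time_integrand n s - (a * p s - v * y s)\<bar>) \<le>
        (LBINT s:{0..T}. P * \<bar>?u s - y s\<bar> + P * \<mu> n * c + \<sigma>\<^sup>2 / 2 * P\<^sup>2 * \<bar>(hs n s)\<^sup>2 - y s\<bar>)"
      proof (rule set_integral_mono_AE)
        show "AE s\<in>{0..T} in lborel. \<bar>time_integrand n s - (a * p s - v * y s)\<bar> \<le>
          P * \<bar>?u s - y s\<bar> + P * \<mu> n * c + \<sigma>\<^sup>2 / 2 * P\<^sup>2 * \<bar>(hs n s)\<^sup>2 - y s\<bar>"
          using AE_lborel_singleton[of "0::real"]
        proof eventually_elim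
          case (elim s)
          then show ?case using pt[of s] by auto
        qed
      qed (intro set_integrable_abs intd set_integral_add(1) set_integrable_mult_right i1 i2 i3)+
      also have "\<dots> = P * A n + P * \<mu> n * c * T + \<sigma>\<^sup>2 / 2 * P\<^sup>2 * C n"
      proof -
        have "(LBINT s:{0..T}. P * \<mu> n * c) = P * \<mu> n * c * T"
          using T_pos by (simp add: set_lebesgue_integral_def)
        then show ?thesis
          using i1 i2 i3 by (simp add: set_integral_add set_integrable_mult_right set_integral_mult_right A_def C_def)
      qed
      finally show ?thesis .
    qed
    have D: "discrete_exponent n j - exponent (g n j) = \<sigma> * (\<Sum>i<j. p (g n i) * (integral_error n (Suc i) - integral_error n i)) -
      ((LBINT s:{0..g n j}. time_integrand n s) - (LBINT s:{0..g n j}. a * p s - v * y s))"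
      unfolding discrete_exponent_eq[OF j] exponent_eq[OF tj] by simp
    have R: "\<bar>\<sigma> * (\<Sum>i<j. p (g n i) * (integral_error n (Suc i) - integral_error n i))\<bar> \<le> \<bar>\<sigma>\<bar> * (2 * P + P * T) * V n"
      using mult_left_mono[OF sbp, of "\<bar>\<sigma>\<bar>"] by (simp add: abs_mult mult.assoc)
    show ?thesis
      unfolding e_def by (rule abs_diff_le_add[OF D R I1 I2 I3])
  qed
  ultimately show ?thesis by blast
qed

end

section \<open>Passing to the limit under the expectation\<close>

context prob_space
begin

text \<open>For fixed \<open>K\<close> the second moments are bounded and \<open>Z' K i \<le> L\<close> eventually, so truncation at \<open>L\<close> does not change the
  limit \<open>c\<close> of the expectations. On \<open>{A < K}\<close> the truncated variables converge to \<open>Z\<close> boundedly, and off this set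
  they contribute at most \<open>L\<close> times its probability. It is essential that \<open>L\<close> does not depend on \<open>K\<close>, while the bound
  \<open>D K\<close> on the second moments may.\<close>

lemma expectation_eq_of_stopped_approximation:
  fixes Z A :: "'a \<Rightarrow> real" and Z' :: "nat \<Rightarrow> nat \<Rightarrow> 'a \<Rightarrow> real"
  assumes [measurable]: "random_variable borel Z" "random_variable borel A" "\<And>K i. random_variable borel (Z' K i)"
    and L: "0 \<le> L" "AE \<omega> in M. 0 \<le> Z \<omega> \<and> Z \<omega> \<le> L" and nonneg: "\<And>K i \<omega>. 0 \<le> Z' K i \<omega>"
    and int: "\<And>K i. integrable M (Z' K i)" and lim: "\<And>K. (\<lambda>i. expectation (Z' K i)) \<longlonglongrightarrow> c"
    and int2: "\<And>K i. integrable M (\<lambda>\<omega>. (Z' K i \<omega>)\<^sup>2)" and D: "\<And>K i. expectation (\<lambda>\<omega>. (Z' K i \<omega>)\<^sup>2) \<le> D K"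
    and ev: "\<And>K. AE \<omega> in M. \<forall>\<^sub>F i in sequentially. Z' K i \<omega> \<le> L"
    and conv: "\<And>K. AE \<omega> in M. A \<omega> < real K \<longrightarrow> (\<lambda>i. Z' K i \<omega>) \<longlonglongrightarrow> Z \<omega>"
  shows "expectation Z = c"
proof -
  have intZ: "integrable M Z"
    using L(2) by (intro integrable_const_bound[of _ L]) auto
  have bound: "\<bar>c - expectation Z\<bar> \<le> L * prob {\<omega>\<in>space M. real K \<le> A \<omega>}" for K
  proof -
    define X where "X i \<omega> = min (Z' K i \<omega>) L" for i \<omega>
    have X[measurable]: "random_variable borel (X i)" for i
      unfolding X_def by measurable
    have X01: "0 \<le> X i \<omega>" "X i \<omega> \<le> L" for i \<omega>
      using nonneg[of K i \<omega>] L(1) by (auto simp: X_def)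
    have intX: "integrable M (X i)" for i
      using X01 by (intro integrable_const_bound[of _ L]) auto
    have Plim: "(\<lambda>i. prob {\<omega>\<in>space M. L < Z' K i \<omega>}) \<longlonglongrightarrow> 0"
    proof -
      have "(\<lambda>i. \<integral>\<omega>. indicator {\<omega>\<in>space M. L < Z' K i \<omega>} \<omega> \<partial>M) \<longlonglongrightarrow> (\<integral>\<omega>. (0::real) \<partial>M)"
      proof (rule integral_dominated_convergence[where w="\<lambda>_. 1"])
        show "AE \<omega> in M. (\<lambda>i. indicat_real {\<omega>\<in>space M. L < Z' K i \<omega>} \<omega>) \<longlonglongrightarrow> 0"
          using ev[of K]
        proof eventually_elim
          case (elim \<omega>)
          then have "\<forall>\<^sub>F i in sequentially. indicat_real {\<omega>\<in>space M. L < Z' K i \<omega>} \<omega> = 0"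
            by eventually_elim (simp add: indicator_def)
          then show ?case by (rule tendsto_eventually)
        qed
      qed (auto split: split_indicator)
      then show ?thesis by (simp add: emeasure_eq_measure)
    qed
    have "(\<lambda>i. expectation (Z' K i) - expectation (X i)) \<longlonglongrightarrow> 0"
    proof (rule LIMSEQ_I)
      fix r :: real assume r: "0 < r"
      have D0: "0 \<le> D K"
        by (rule order_trans[OF _ D[of K 0]]) (rule integral_nonneg_AE, simp)
      \<comment> \<open>The excess over \<open>L\<close> is estimated by \<open>z \<le> \<epsilon> * z\<^sup>2 + 1 / \<epsilon>\<close> on the event \<open>L < z\<close>.\<close>
      define \<epsilon> where "\<epsilon> = r / (2 * (D K + 1))"
      have \<epsilon>: "0 < \<epsilon>" "\<epsilon> * D K < r / 2"
        using r D0 by (auto simp: \<epsilon>_def field_simps)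
      from LIMSEQ_D[OF Plim, of "\<epsilon> * (r / 2)"] \<epsilon> r
      obtain N where N: "\<And>i. N \<le> i \<Longrightarrow> prob {\<omega>\<in>space M. L < Z' K i \<omega>} < \<epsilon> * (r / 2)"
        by auto
      have "norm (expectation (Z' K i) - expectation (X i) - 0) < r" if "N \<le> i" for i
      proof -
        have intI: "integrable M (\<lambda>\<omega>. \<epsilon> * (Z' K i \<omega>)\<^sup>2 + 1 / \<epsilon> * indicator {\<omega>\<in>space M. L < Z' K i \<omega>} \<omega>)"
          by (intro Bochner_Integration.integrable_add integrable_mult_right int2) (auto simp: emeasure_eq_measure)
        have "expectation (Z' K i) - expectation (X i) = expectation (\<lambda>\<omega>. Z' K i \<omega> - X i \<omega>)"
          by (intro Bochner_Integration.integral_diff[symmetric] int intX)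
        also have "\<dots> \<le> expectation (\<lambda>\<omega>. \<epsilon> * (Z' K i \<omega>)\<^sup>2 + 1 / \<epsilon> * indicator {\<omega>\<in>space M. L < Z' K i \<omega>} \<omega>)"
        proof (rule integral_mono[OF _ intI])
          show "integrable M (\<lambda>\<omega>. Z' K i \<omega> - X i \<omega>)"
            by (intro Bochner_Integration.integrable_diff int intX)
          fix \<omega> assume \<omega>: "\<omega> \<in> space M"
          show "Z' K i \<omega> - X i \<omega> \<le> \<epsilon> * (Z' K i \<omega>)\<^sup>2 + 1 / \<epsilon> * indicator {\<omega>\<in>space M. L < Z' K i \<omega>} \<omega>"
          proof (cases "L < Z' K i \<omega>")
            case True
            let ?z = "Z' K i \<omega>"
            have "?z \<le> \<epsilon> * ?z\<^sup>2 + 1 / \<epsilon>"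
            proof (cases "?z \<le> 1 / \<epsilon>")
              case False
              then have "1 \<le> \<epsilon> * ?z" using \<epsilon>(1) by (simp add: field_simps)
              from mult_right_mono[OF this nonneg[of K i \<omega>]] have "?z \<le> \<epsilon> * ?z\<^sup>2"
                by (simp add: power2_eq_square mult.assoc)
              then show ?thesis using \<epsilon>(1) by (simp add: add_increasing2)
            qed (use \<epsilon>(1) in \<open>simp add: add_increasing\<close>)
            then show ?thesis
              using True \<omega> L(1) by (simp add: X_def)
          next
            case False
            then show ?thesis using \<epsilon>(1) by (simp add: X_def)
          qed
        qed
        also have "\<dots> = \<epsilon> * expectation (\<lambda>\<omega>. (Z' K i \<omega>)\<^sup>2) + 1 / \<epsilon> * prob {\<omega>\<in>space M. L < Z' K i \<omega>}"
          using int2 by (subst Bochner_Integration.integral_add) (auto simp: emeasure_eq_measure)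
        also have "\<dots> \<le> \<epsilon> * D K + 1 / \<epsilon> * prob {\<omega>\<in>space M. L < Z' K i \<omega>}"
          using \<epsilon>(1) D[of K i] by (intro add_right_mono mult_left_mono) auto
        also have "1 / \<epsilon> * prob {\<omega>\<in>space M. L < Z' K i \<omega>} < 1 / \<epsilon> * (\<epsilon> * (r / 2))"
          using \<epsilon>(1) N[OF that] by (intro mult_strict_left_mono) auto
        finally have "expectation (Z' K i) - expectation (X i) < r"
          using \<epsilon> by simp
        moreover have "expectation (X i) \<le> expectation (Z' K i)"
          by (intro integral_mono intX int) (simp add: X_def)
        ultimately show ?thesis by simp
      qed
      then show "\<exists>N. \<forall>i\<ge>N. norm (expectation (Z' K i) - expectation (X i) - 0) < r"
        by blast
    qed
    from tendsto_diff[OF lim[of K] this] have Xlim: "(\<lambda>i. expectation (X i)) \<longlonglongrightarrow> c"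
      by simp
    define B where "B = {\<omega>\<in>space M. A \<omega> < real K}"
    have [measurable]: "B \<in> events" unfolding B_def by measurable
    have Blim: "(\<lambda>i. \<integral>\<omega>. X i \<omega> * indicator B \<omega> \<partial>M) \<longlonglongrightarrow> (\<integral>\<omega>. Z \<omega> * indicator B \<omega> \<partial>M)"
    proof (rule integral_dominated_convergence[where w="\<lambda>_. L"])
      show "AE \<omega> in M. (\<lambda>i. X i \<omega> * indicator B \<omega>) \<longlonglongrightarrow> Z \<omega> * indicator B \<omega>"
        using conv[of K] L(2)
      proof eventually_elim
        case (elim \<omega>)
        show ?case
        proof (cases "\<omega> \<in> B")
          case True
          then have "(\<lambda>i. min (Z' K i \<omega>) L) \<longlonglongrightarrow> min (Z \<omega>) L"
            using elim by (intro tendsto_min tendsto_const) (auto simp: B_def)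
          then show ?thesis
            using elim True by (simp add: X_def min_absorb1)
        qed simp
      qed
      show "AE \<omega> in M. norm (X i \<omega> * indicator B \<omega>) \<le> L" for i
        using X01 L(1) by (intro AE_I2) (auto split: split_indicator)
    qed auto
    have step: "\<bar>expectation (X i) - expectation Z\<bar> \<le>
      \<bar>(\<integral>\<omega>. X i \<omega> * indicator B \<omega> \<partial>M) - (\<integral>\<omega>. Z \<omega> * indicator B \<omega> \<partial>M)\<bar> + L * prob {\<omega>\<in>space M. real K \<le> A \<omega>}" for i
    proof -
      have i1: "integrable M (\<lambda>\<omega>. X i \<omega> * indicator B \<omega>)" "integrable M (\<lambda>\<omega>. Z \<omega> * indicator B \<omega>)"
        using intX[of i] intZ by (auto intro!: integrable_real_mult_indicator)
      have i2: "integrable M (\<lambda>\<omega>. L * indicator {\<omega>\<in>space M. real K \<le> A \<omega>} \<omega>)"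
        by (auto simp: emeasure_eq_measure)
      have "expectation (X i) - expectation Z - ((\<integral>\<omega>. X i \<omega> * indicator B \<omega> \<partial>M) - (\<integral>\<omega>. Z \<omega> * indicator B \<omega> \<partial>M))
        = expectation (\<lambda>\<omega>. X i \<omega> - Z \<omega> - (X i \<omega> * indicator B \<omega> - Z \<omega> * indicator B \<omega>))"
        using intX[of i] intZ i1 by simp
      also have "\<bar>\<dots>\<bar> \<le> expectation (\<lambda>\<omega>. \<bar>X i \<omega> - Z \<omega> - (X i \<omega> * indicator B \<omega> - Z \<omega> * indicator B \<omega>)\<bar>)"
        by (rule integral_abs_bound)
      also have "\<dots> \<le> expectation (\<lambda>\<omega>. L * indicator {\<omega>\<in>space M. real K \<le> A \<omega>} \<omega>)"
      proof (rule integral_mono_AE)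
        show "AE \<omega> in M. \<bar>X i \<omega> - Z \<omega> - (X i \<omega> * indicator B \<omega> - Z \<omega> * indicator B \<omega>)\<bar>
            \<le> L * indicator {\<omega>\<in>space M. real K \<le> A \<omega>} \<omega>"
          using L(2) AE_space
        proof eventually_elim
          case (elim \<omega>)
          then show ?case
            using X01[of i \<omega>] by (auto simp: B_def indicator_def)
        qed
      qed (use intX[of i] intZ i1 i2 in auto)
      also have "\<dots> = L * prob {\<omega>\<in>space M. real K \<le> A \<omega>}"
        by simp
      finally show ?thesis by linarith
    qed
    show ?thesis
    proof (rule LIMSEQ_le)
      show "(\<lambda>i. \<bar>expectation (X i) - expectation Z\<bar>) \<longlonglongrightarrow> \<bar>c - expectation Z\<bar>"
        by (intro tendsto_intros Xlim)
      have "(\<lambda>i. \<bar>(\<integral>\<omega>. X i \<omega> * indicator B \<omega> \<partial>M) - (\<integral>\<omega>. Z \<omega> * indicator B \<omega> \<partial>M)\<bar> + L * prob {\<omega>\<in>space M. real K \<le> A \<omega>})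
        \<longlonglongrightarrow> \<bar>(\<integral>\<omega>. Z \<omega> * indicator B \<omega> \<partial>M) - (\<integral>\<omega>. Z \<omega> * indicator B \<omega> \<partial>M)\<bar> + L * prob {\<omega>\<in>space M. real K \<le> A \<omega>}"
        by (intro tendsto_intros Blim)
      then show "(\<lambda>i. \<bar>(\<integral>\<omega>. X i \<omega> * indicator B \<omega> \<partial>M) - (\<integral>\<omega>. Z \<omega> * indicator B \<omega> \<partial>M)\<bar> + L * prob {\<omega>\<in>space M. real K \<le> A \<omega>})
        \<longlonglongrightarrow> L * prob {\<omega>\<in>space M. real K \<le> A \<omega>}" by simp
    qed (use step in auto)
  qed
  have "(\<lambda>K. \<integral>\<omega>. indicator {\<omega>\<in>space M. real K \<le> A \<omega>} \<omega> \<partial>M) \<longlonglongrightarrow> (\<integral>\<omega>. (0::real) \<partial>M)"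
  proof (rule integral_dominated_convergence[where w="\<lambda>_. 1"])
    have "(\<lambda>K. indicat_real {\<omega>\<in>space M. real K \<le> A \<omega>} \<omega>) \<longlonglongrightarrow> 0" for \<omega>
    proof -
      obtain N :: nat where "A \<omega> < real N" using reals_Archimedean2 by blast
      then have "\<forall>\<^sub>F K in sequentially. indicat_real {\<omega>\<in>space M. real K \<le> A \<omega>} \<omega> = 0"
        unfolding eventually_sequentially by (intro exI[of _ N]) (auto simp: indicator_def)
      then show ?thesis by (rule tendsto_eventually)
    qed
    then show "AE \<omega> in M. (\<lambda>K. indicat_real {\<omega>\<in>space M. real K \<le> A \<omega>} \<omega>) \<longlonglongrightarrow> 0" by simp
  qed (auto split: split_indicator)
  then have "(\<lambda>K. prob {\<omega>\<in>space M. real K \<le> A \<omega>}) \<longlonglongrightarrow> 0"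
    by (simp add: emeasure_eq_measure)
  from tendsto_mult_left[OF this, of L] have "(\<lambda>K. L * prob {\<omega>\<in>space M. real K \<le> A \<omega>}) \<longlonglongrightarrow> 0"
    by simp
  from LIMSEQ_le_const[OF this, of "\<bar>c - expectation Z\<bar>"] bound have "\<bar>c - expectation Z\<bar> \<le> 0"
    by blast
  then show ?thesis by simp
qed

end

lemma sum_stopped_index:
  fixes q :: "nat \<Rightarrow> real"
  assumes q: "\<And>i. i < k \<Longrightarrow> 0 \<le> q i"
  obtains j where "j \<le> k" "\<And>i. i < k \<Longrightarrow> (\<Sum>l\<le>i. q l) \<le> K \<longleftrightarrow> i < j" "(\<Sum>i<k. q i) \<le> K \<Longrightarrow> j = k"
proof -
  define j where "j = (LEAST j. j = k \<or> (j < k \<and> K < (\<Sum>l\<le>j. q l)))"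
  have j: "j = k \<or> (j < k \<and> K < (\<Sum>l\<le>j. q l))"
    unfolding j_def by (rule LeastI[of _ k]) simp
  have mono: "(\<Sum>l\<le>i. q l) \<le> (\<Sum>l\<le>i'. q l)" if "i \<le> i'" "i' < k" for i i'
    using that q by (intro sum_mono2) auto
  have iff: "(\<Sum>l\<le>i. q l) \<le> K \<longleftrightarrow> i < j" if "i < k" for i
  proof
    assume "i < j"
    then have "\<not> (i = k \<or> (i < k \<and> K < (\<Sum>l\<le>i. q l)))"
      unfolding j_def by (rule not_less_Least)
    then show "(\<Sum>l\<le>i. q l) \<le> K" using that by auto
  next
    assume "(\<Sum>l\<le>i. q l) \<le> K"
    then show "i < j"
      using j mono[of j i] that by (cases "i < j") auto
  qed
  have "j = k" if "(\<Sum>i<k. q i) \<le> K"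
  proof (rule ccontr)
    assume "j \<noteq> k"
    then have "j < k" "K < (\<Sum>l\<le>j. q l)" using j by auto
    moreover have "(\<Sum>l\<le>j. q l) \<le> (\<Sum>i<k. q i)"
      using \<open>j < k\<close> q by (intro sum_mono2) auto
    ultimately show False using that by simp
  qed
  with j iff show thesis by (intro that[of j]) auto
qed

section \<open>The exponential functional of the solution\<close>

context grid_sequence
begin

lemma riemann_sum_tendsto:
  assumes lip: "\<And>s r. s \<in> {0..T} \<Longrightarrow> r \<in> {0..T} \<Longrightarrow> \<bar>\<phi> s - \<phi> r\<bar> \<le> C * \<bar>s - r\<bar>" and C: "0 \<le> C"
    and int: "set_integrable lborel {0..T} \<phi>"
  shows "(\<lambda>n. \<Sum>i<k n. (g n (Suc i) - g n i) * \<phi> (g n i)) \<longlonglongrightarrow> (LBINT s:{0..T}. \<phi> s)"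
proof -
  have "norm ((\<Sum>i<k n. (g n (Suc i) - g n i) * \<phi> (g n i)) - (LBINT s:{0..T}. \<phi> s)) \<le> C * T * (2 * T / real (Suc n))" for n
  proof -
    let ?C = "\<lambda>i. {g n i<..g n (Suc i)}"
    have "(LBINT s:{0..T}. \<phi> s) = (\<Sum>i<k n. LBINT s:?C i. \<phi> s)"
      using set_integral_grid[where g="g n" and k="k n" and j="k n", OF grid_0 grid_T grid_less int order_refl]
      by (simp add: grid_T)
    then have "(\<Sum>i<k n. (g n (Suc i) - g n i) * \<phi> (g n i)) - (LBINT s:{0..T}. \<phi> s) =
      (\<Sum>i<k n. (g n (Suc i) - g n i) * \<phi> (g n i) - (LBINT s:?C i. \<phi> s))"
      by (simp add: sum_subtractf)
    also have "norm \<dots> \<le> (\<Sum>i<k n. C * (2 * T / real (Suc n)) * (g n (Suc i) - g n i))"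
    proof (rule sum_norm_le)
      fix i assume "i \<in> {..<k n}"
      then have i: "i < k n" by simp
      have r: "g n i \<in> {0..T}" "g n (Suc i) \<in> {0..T}" "g n i < g n (Suc i)"
        using grid_range[of i n] grid_range[of "Suc i" n] grid_less[OF i] i by auto
      have sub: "?C i \<subseteq> {0..T}" using r by auto
      have ic: "set_integrable lborel (?C i) (\<lambda>_. c)" for c :: real
        by (rule set_integrable_subset[of _ "{0..T}"])
          (use sub in \<open>auto simp: set_integrable_def integrable_indicator_Icc\<close>)
      have i\<phi>: "set_integrable lborel (?C i) \<phi>"
        by (rule set_integrable_subset[OF int]) (use sub in auto)
      have "(g n (Suc i) - g n i) * \<phi> (g n i) - (LBINT s:?C i. \<phi> s) = (LBINT s:?C i. \<phi> (g n i) - \<phi> s)"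
        using r by (simp add: set_integral_diff(2)[OF ic i\<phi>] set_integral_const_Ioc mult.commute)
      also have "\<bar>\<dots>\<bar> \<le> (LBINT s:?C i. \<bar>\<phi> (g n i) - \<phi> s\<bar>)"
        using integral_abs_bound[of lborel "\<lambda>s. indicator (?C i) s *\<^sub>R (\<phi> (g n i) - \<phi> s)"]
        by (simp add: set_lebesgue_integral_def abs_mult)
      also have "\<dots> \<le> (LBINT s:?C i. C * (2 * T / real (Suc n)))"
      proof (rule set_integral_mono)
        show "set_integrable lborel (?C i) (\<lambda>s. \<bar>\<phi> (g n i) - \<phi> s\<bar>)"
          by (intro set_integrable_abs set_integral_diff(1) ic i\<phi>)
        fix s assume s: "s \<in> ?C i"
        then have "\<bar>\<phi> (g n i) - \<phi> s\<bar> \<le> C * \<bar>g n i - s\<bar>"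
          using r sub by (intro lip) auto
        also have "\<dots> \<le> C * (2 * T / real (Suc n))"
          using s mesh[OF i] C by (intro mult_left_mono) auto
        finally show "\<bar>\<phi> (g n i) - \<phi> s\<bar> \<le> C * (2 * T / real (Suc n))" .
      qed (rule ic)
      also have "\<dots> = C * (2 * T / real (Suc n)) * (g n (Suc i) - g n i)"
        using r by (intro set_integral_const_Ioc) simp
      finally show "norm ((g n (Suc i) - g n i) * \<phi> (g n i) - (LBINT s:?C i. \<phi> s)) \<le> C * (2 * T / real (Suc n)) * (g n (Suc i) - g n i)"
        by simp
    qed
    also have "\<dots> = C * (2 * T / real (Suc n)) * (g n (k n) - g n 0)"
      by (simp only: sum_distrib_left[symmetric] sum_lessThan_telescope)
    also have "C * (2 * T / real (Suc n)) * (g n (k n) - g n 0) = C * T * (2 * T / real (Suc n))"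
      by (simp add: grid_0 grid_T)
    finally show ?thesis .
  qed
  then have bound: "\<forall>n. norm ((\<Sum>i<k n. (g n (Suc i) - g n i) * \<phi> (g n i)) - (LBINT s:{0..T}. \<phi> s)) \<le> C * T * (2 * T / real (Suc n))"
    by (rule allI)
  have "(\<lambda>n. C * T * (2 * T / real (Suc n))) \<longlonglongrightarrow> C * T * 0"
    by (intro tendsto_mult_left mesh_tendsto)
  then have lim0: "(\<lambda>n. C * T * (2 * T / real (Suc n))) \<longlonglongrightarrow> 0"
    by simp
  have "(\<lambda>n. (\<Sum>i<k n. (g n (Suc i) - g n i) * \<phi> (g n i)) - (LBINT s:{0..T}. \<phi> s)) \<longlonglongrightarrow> 0"
    by (rule Lim_null_comparison[OF always_eventually[OF bound] lim0])
  then show ?thesis by (rule LIM_zero_cancel)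
qed

end

text \<open>The next point of \<open>R i\<close> above the midpoint of a cell is the right end of this cell or lies beyond it, so half
  the cell is at most \<open>T / (i + 1)\<close> long.\<close>

lemma grid_sequence_of_mesh:
  assumes T: "0 < T" and R: "\<And>i. finite (R i)" "\<And>i. R i \<subseteq> {0..T}" "\<And>i. 0 \<in> R i" "\<And>i. T \<in> R i"
    and mesh: "\<And>i s. s \<in> {0..T} \<Longrightarrow> \<exists>r\<in>R i. s \<le> r \<and> r \<le> s + T / real (Suc i)"
  obtains g k where "grid_sequence T g k" "\<And>i. g i ` {..k i} = R i"
proof -
  have "\<exists>g k. g 0 = 0 \<and> g k = T \<and> (\<forall>l<k. g l < g (Suc l)) \<and> g ` {..k} = R i" for i
    by (rule finite_set_grid[OF R(1)[of i] R(2)[of i] R(3)[of i] R(4)[of i]]) blast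
  then obtain g k where gk: "\<And>i. g i 0 = 0" "\<And>i. g i (k i) = T" "\<And>i l. l < k i \<Longrightarrow> g i l < g i (Suc l)"
      "\<And>i. g i ` {..k i} = R i"
    by metis
  have "grid_sequence T g k"
  proof
    fix n l assume l: "l < k n"
    define c where "c = (g n l + g n (Suc l)) / 2"
    have "g n l \<in> R n" "g n (Suc l) \<in> R n"
      using l gk(4)[of n] by auto
    then have "g n l \<in> {0..T}" "g n (Suc l) \<in> {0..T}"
      using R(2)[of n] by (auto dest: subsetD)
    then have c: "c \<in> {0..T}"
      by (simp add: c_def)
    from mesh[OF c, of n] obtain r where r: "r \<in> R n" "c \<le> r" "r \<le> c + T / real (Suc n)"
      by (elim bexE conjE)
    then obtain j where j: "j \<le> k n" "r = g n j"
      using gk(4)[of n] by auto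
    have "g n (Suc l) \<le> r"
    proof (cases "Suc l \<le> j")
      case True
      then show ?thesis
        using grid_mono[of "k n" "g n" "Suc l" j] gk(3) j by auto
    next
      case False
      then have "r \<le> g n l"
        using grid_mono[of "k n" "g n" j l] gk(3) j l by auto
      then show ?thesis
        using r(2) gk(3)[OF l] by (simp add: c_def)
    qed
    then have "g n (Suc l) \<le> c + T / real (Suc n)"
      using r(3) by linarith
    then show "g n (Suc l) - g n l \<le> 2 * T / real (Suc n)"
      by (simp add: c_def field_simps)
  qed (use T gk in auto)
  then show thesis using gk(4) by (rule that)
qed

context driving_noise
begin

text \<open>The stopped variables \<open>Z' K i\<close> use the integrand \<open>d K i\<close>, which is switched off before its quadratic variation
  exceeds \<open>K\<close>. Stopping turns the discrete exponent into its value at some earlier grid point, up to the remaining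
  increments of \<open>J\<close>, which only lower it because \<open>p \<le> 0\<close>. The discrete exponents at all grid points are eventually
  at most \<open>B + 1\<close>, where \<open>B\<close> bounds the exponent itself.\<close>

lemma exponential_functional:
  fixes Y I :: "real \<Rightarrow> 'a \<Rightarrow> real" and p p' :: "real \<Rightarrow> real" and T a b \<sigma> v y0 C :: real
  assumes T: "0 < T"
    and p_deriv: "\<And>s. s \<in> {0..T} \<Longrightarrow> (p has_real_derivative p' s) (at s within {0..T})"
    and p'_cont: "continuous_on {0..T} p'"
    and riccati: "\<And>s. s \<in> {0..T} \<Longrightarrow> p' s = - (\<sigma>\<^sup>2 / 2 * (p s)\<^sup>2 - b * p s + v)"
    and p_neg: "\<And>s. s \<in> {0..T} \<Longrightarrow> p s \<le> 0" and av: "0 \<le> a" "v \<le> 0"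
    and cadlag: "\<And>\<omega>. \<omega> \<in> space M \<Longrightarrow> cadlag (\<lambda>t. Y t \<omega>)"
    and Y_nonneg: "AE \<omega> in M. \<forall>t\<ge>0. 0 \<le> Y t \<omega>"
    and ito: "has_ito_integral F W (\<lambda>s \<omega>. sqrt (Y s \<omega>)) I"
    and sde: "AE \<omega> in M. \<forall>t\<ge>0. Y t \<omega> = Y 0 \<omega> + (LBINT s:{0..t}. a - b * Y s \<omega>) + \<sigma> * I t \<omega> + J t \<omega>"
    and Y0: "AE \<omega> in M. Y 0 \<omega> = y0" and YT[measurable]: "random_variable borel (Y T)"
    and lip: "\<And>q r. q \<le> 0 \<Longrightarrow> r \<le> 0 \<Longrightarrow> \<bar>levy_exponent m q - levy_exponent m r\<bar> \<le> C * \<bar>q - r\<bar>" and C: "0 \<le> C"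
    and int_lev: "set_integrable lborel {0..T} (\<lambda>s. levy_exponent m (p s))"
  shows "expectation (\<lambda>\<omega>. exp (p T * Y T \<omega> - p 0 * y0 + v * (LBINT s:{0..T}. Y s \<omega>) - a * (LBINT s:{0..T}. p s))) =
    exp (LBINT s:{0..T}. levy_exponent m (p s))"
proof -
  obtain n \<tau> \<xi>' R where
    simple: "\<And>i. simple_integrand F (n i) (\<tau> i) (\<xi>' i)"
    and R: "\<And>i. finite (R i)" "\<And>i. R i \<subseteq> {0..T}" "\<And>i. 0 \<in> R i" "\<And>i. T \<in> R i"
    and refines: "\<And>i. grid_refines (\<tau> i) (n i) (R i) T"
    and mesh: "\<And>i s. s \<in> {0..T} \<Longrightarrow> \<exists>r\<in>R i. s \<le> r \<and> r \<le> s + T / real (Suc i)"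
    and Vlim: "AE \<omega> in M. (\<lambda>i. MAX s\<in>R i. \<bar>simple_integral (n i) (\<tau> i) (\<xi>' i) W s \<omega> - I s \<omega>\<bar>) \<longlonglongrightarrow> 0"
    and Ulim: "AE \<omega> in M. (\<lambda>i. \<integral>\<^sup>+s\<in>{0..T}. ennreal ((simple_process (n i) (\<tau> i) (\<xi>' i) s \<omega> - sqrt (Y s \<omega>))\<^sup>2) \<partial>lborel) \<longlonglongrightarrow> 0"
    by (rule ito_integral_uniform_approximation[OF ito T]) (rule that; assumption)
  obtain g k where grid: "grid_sequence T g k" and gR: "\<And>i. g i ` {..k i} = R i"
  proof (rule grid_sequence_of_mesh[OF T R])
    show "\<exists>r\<in>R i. s \<le> r \<and> r \<le> s + T / real (Suc i)" if "s \<in> {0..T}" for i s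
      by (rule mesh[OF that])
  qed (rule that; assumption)
  interpret grid_sequence T g k by (rule grid)
  have ref: "grid_refines (\<tau> i) (n i) (g i ` {..k i}) (g i (k i))" for i
    using refines[of i] by (simp add: gR grid_T)
  define h where "h i l = simple_process (n i) (\<tau> i) (\<xi>' i) (g i (Suc l))" for i l
  have hF: "h i l \<in> borel_measurable (F (g i l))" if "l < k i" for i l
    unfolding h_def by (rule simple_process_adapted_on_grid[OF simple grid_less ref that])
  define A where "A \<omega> = (LBINT s:{0..T}. Y s \<omega>)" for \<omega>
  define \<Delta> where "\<Delta> i l = g i (Suc l) - g i l" for i l
  define dW where "dW i l \<omega> = W (g i (Suc l)) \<omega> - W (g i l) \<omega>" for i l \<omega>
  define dJ where "dJ i l \<omega> = J (g i (Suc l)) \<omega> - J (g i l) \<omega>" for i l \<omega>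
  define Sx where "Sx i j \<omega> = (\<Sum>l<j. \<sigma> * p (g i l) * h i l \<omega> * dW i l \<omega> - (\<sigma> * p (g i l) * h i l \<omega>)\<^sup>2 * \<Delta> i l / 2
     + p (g i l) * dJ i l \<omega>)" for i j \<omega>
  define Qx where "Qx t \<omega> = p t * Y t \<omega> - p 0 * Y 0 \<omega> + v * (LBINT s:{0..t}. Y s \<omega>) - a * (LBINT s:{0..t}. p s)" for t \<omega>
  have path: "AE \<omega> in M. (\<exists>e. e \<longlonglongrightarrow> 0 \<and> (\<forall>i. \<forall>j\<le>k i. \<bar>Sx i j \<omega> - Qx (g i j) \<omega>\<bar> \<le> e i)) \<and>
     (\<lambda>i. \<Sum>l<k i. (h i l \<omega>)\<^sup>2 * \<Delta> i l) \<longlonglongrightarrow> A \<omega>"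
    using Vlim Ulim Y_nonneg sde AE_space
  proof eventually_elim
    case (elim \<omega>)
    interpret D: discretized_path T g k p p' "\<lambda>s. Y s \<omega>" "\<lambda>s. I s \<omega>" "\<lambda>s. J s \<omega>" "\<lambda>s. W s \<omega>" "\<lambda>i l. h i l \<omega>"
      "\<lambda>i. MAX s\<in>R i. \<bar>simple_integral (n i) (\<tau> i) (\<xi>' i) W s \<omega> - I s \<omega>\<bar>" a b \<sigma> v
    proof
      show "(p has_real_derivative p' s) (at s within {0..T})" if "s \<in> {0..T}" for s by (rule p_deriv[OF that])
      show "continuous_on {0..T} p'" by (rule p'_cont)
      show "p' s = - (\<sigma>\<^sup>2 / 2 * (p s)\<^sup>2 - b * p s + v)" if "s \<in> {0..T}" for s by (rule riccati[OF that])
      show "cadlag (\<lambda>s. Y s \<omega>)" by (rule cadlag[OF elim(5)])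
      show "0 \<le> Y s \<omega>" if "0 \<le> s" for s using elim(3) that by blast
      show "Y t \<omega> = Y 0 \<omega> + (LBINT s:{0..t}. a - b * Y s \<omega>) + \<sigma> * I t \<omega> + J t \<omega>" if "t \<in> {0..T}" for t
        by (rule elim(4)[rule_format]) (use that in simp)
      show "(\<lambda>i. MAX s\<in>R i. \<bar>simple_integral (n i) (\<tau> i) (\<xi>' i) W s \<omega> - I s \<omega>\<bar>) \<longlonglongrightarrow> 0" by (rule elim(1))
      show "\<bar>(\<Sum>l<j. h i l \<omega> * (W (g i (Suc l)) \<omega> - W (g i l) \<omega>)) - I (g i j) \<omega>\<bar> \<le>
        (MAX s\<in>R i. \<bar>simple_integral (n i) (\<tau> i) (\<xi>' i) W s \<omega> - I s \<omega>\<bar>)" if j: "j \<le> k i" for i j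
      proof -
        have "simple_integral (n i) (\<tau> i) (\<xi>' i) W (g i j) \<omega> = (\<Sum>l<j. h i l \<omega> * (W (g i (Suc l)) \<omega> - W (g i l) \<omega>))"
          unfolding h_def
          by (rule simple_integral_on_grid[OF grid_0 grid_less ref simple_integrandD(1)[OF simple] simple_integrandD(2)[OF simple] j])
        moreover have "g i j \<in> R i"
          unfolding gR[symmetric] using j by simp
        then have "\<bar>simple_integral (n i) (\<tau> i) (\<xi>' i) W (g i j) \<omega> - I (g i j) \<omega>\<bar> \<le>
          (MAX s\<in>R i. \<bar>simple_integral (n i) (\<tau> i) (\<xi>' i) W s \<omega> - I s \<omega>\<bar>)"
          by (intro Max_ge finite_imageI R(1)) simp
        ultimately show ?thesis by simp
      qed
      have "(\<integral>\<^sup>+s\<in>{0..T}. ennreal ((step_function (g i) (k i) (\<lambda>l. h i l \<omega>) s - sqrt (Y s \<omega>))\<^sup>2) \<partial>lborel) =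
        (\<integral>\<^sup>+s\<in>{0..T}. ennreal ((simple_process (n i) (\<tau> i) (\<xi>' i) s \<omega> - sqrt (Y s \<omega>))\<^sup>2) \<partial>lborel)" for i
      proof (rule nn_integral_cong_AE)
        show "AE s in lborel. ennreal ((step_function (g i) (k i) (\<lambda>l. h i l \<omega>) s - sqrt (Y s \<omega>))\<^sup>2) * indicator {0..T} s =
           ennreal ((simple_process (n i) (\<tau> i) (\<xi>' i) s \<omega> - sqrt (Y s \<omega>))\<^sup>2) * indicator {0..T} s"
          using AE_lborel_singleton[of "0::real"]
        proof eventually_elim
          case (elim s)
          show ?case
          proof (cases "s \<in> {0..T}")
            case True
            obtain l where l: "l < k i" "g i l < s" "s \<le> g i (Suc l)"
              by (rule grid_cell_exists[of "g i" s "k i"]) (use True elim grid_0 grid_T in auto)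
            have "step_function (g i) (k i) (\<lambda>l. h i l \<omega>) s = h i l \<omega>"
              by (rule step_function_cell[OF grid_less l])
            also have "\<dots> = simple_process (n i) (\<tau> i) (\<xi>' i) s \<omega>"
              unfolding h_def
              by (subst (1 2) simple_process_on_grid[OF grid_less ref l(1)]) (use l grid_less[OF l(1)] in auto)
            finally show ?thesis by simp
          qed simp
        qed
      qed
      then show "(\<lambda>i. \<integral>\<^sup>+s\<in>{0..T}. ennreal ((step_function (g i) (k i) (\<lambda>l. h i l \<omega>) s - sqrt (Y s \<omega>))\<^sup>2) \<partial>lborel) \<longlonglongrightarrow> 0"
        using elim(2) by simp
    qed
    show ?case
      using D.exponent_uniform_limit D.quadratic_variation_sum
      unfolding D.discrete_exponent_def D.exponent_def Sx_def Qx_def A_def \<Delta>_def dW_def dJ_def by blast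
  qed
  obtain P where P: "0 \<le> P" "\<And>s. s \<in> {0..T} \<Longrightarrow> \<bar>p s\<bar> \<le> P" "\<And>s. s \<in> {0..T} \<Longrightarrow> \<bar>p' s\<bar> \<le> P"
    "\<And>s r. s \<in> {0..T} \<Longrightarrow> r \<in> {0..T} \<Longrightarrow> \<bar>p s - p r\<bar> \<le> P * \<bar>s - r\<bar>"
    by (rule C1_bounds[OF less_imp_le[OF T], where f=p and f'=p']) (rule p_deriv p'_cont that; assumption?)+
  have p_int: "set_integrable lborel {0..T} p"
  proof -
    have "continuous_on {0..T} p"
      using p_deriv by (rule DERIV_continuous_on)
    from borel_integrable_atLeastAtMost'[OF this] show ?thesis
      by (simp add: set_integrable_def)
  qed
  define B where "B = - p 0 * y0 + a * (LBINT s:{0..T}. \<bar>p s\<bar>)"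
  have Qbound: "AE \<omega> in M. \<forall>t\<in>{0..T}. Qx t \<omega> \<le> B"
    using Y_nonneg Y0
  proof eventually_elim
    case (elim \<omega>)
    show ?case
    proof
      fix t assume t: "t \<in> {0..T}"
      have "p t * Y t \<omega> \<le> 0"
        using p_neg[OF t] elim(1) t by (intro mult_nonpos_nonneg) auto
      moreover have "v * (LBINT s:{0..t}. Y s \<omega>) \<le> 0"
        using av(2) elim(1) unfolding set_lebesgue_integral_def
        by (intro mult_nonpos_nonneg integral_nonneg_AE AE_I2) (auto split: split_indicator)
      moreover have "- (a * (LBINT s:{0..t}. p s)) \<le> a * (LBINT s:{0..T}. \<bar>p s\<bar>)"
      proof -
        have "- (LBINT s:{0..t}. p s) \<le> (LBINT s:{0..T}. \<bar>p s\<bar>)"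
          using abs_set_integral_initial_le[OF p_int, of t] t by auto
        from mult_left_mono[OF this av(1)] show ?thesis by simp
      qed
      ultimately show "Qx t \<omega> \<le> B"
        using elim(2) by (simp add: Qx_def B_def)
    qed
  qed
  \<comment> \<open>Only the square root of \<open>Y\<close> is known to be progressive. As \<open>sqrt\<close> is odd, \<open>Y = sqrt Y * \<bar>sqrt Y\<bar>\<close> even where \<open>Y < 0\<close>.\<close>
  have A_meas: "random_variable borel A'" if "A' = (\<lambda>\<omega>. LBINT s:{0..T}. sqrt (Y s \<omega>) * \<bar>sqrt (Y s \<omega>)\<bar>)" for A'
  proof -
    have clamp: "s \<in> {0..T} \<Longrightarrow> max 0 (min T s) = s" for s
      by auto
    have "progressive F (\<lambda>s \<omega>. sqrt (Y s \<omega>))"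
      using ito by (simp add: has_ito_integral_def)
    from progressive_clamped_measurable[OF this, of T] T
    have [measurable]: "(\<lambda>x. sqrt (Y (max 0 (min T (snd x))) (fst x))) \<in> borel_measurable (M \<Otimes>\<^sub>M borel)"
      by simp
    have "(\<lambda>x. indicator {0..T} (snd x) *\<^sub>R (sqrt (Y (max 0 (min T (snd x))) (fst x)) * \<bar>sqrt (Y (max 0 (min T (snd x))) (fst x))\<bar>))
      \<in> borel_measurable (M \<Otimes>\<^sub>M borel)"
      by measurable
    then have "(\<lambda>(\<omega>, s). indicator {0..T} s *\<^sub>R (sqrt (Y (max 0 (min T s)) \<omega>) * \<bar>sqrt (Y (max 0 (min T s)) \<omega>)\<bar>))
      \<in> borel_measurable (M \<Otimes>\<^sub>M lborel)"
      by (simp add: split_beta')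
    then have "random_variable borel (\<lambda>\<omega>. LINT s|lborel. indicator {0..T} s *\<^sub>R (sqrt (Y (max 0 (min T s)) \<omega>) * \<bar>sqrt (Y (max 0 (min T s)) \<omega>)\<bar>))"
      by (rule lborel.borel_measurable_lebesgue_integral)
    also have "(\<lambda>\<omega>. LINT s|lborel. indicator {0..T} s *\<^sub>R (sqrt (Y (max 0 (min T s)) \<omega>) * \<bar>sqrt (Y (max 0 (min T s)) \<omega>)\<bar>)) = A'"
      unfolding that set_lebesgue_integral_def
      by (intro ext Bochner_Integration.integral_cong refl) (simp add: clamp split: split_indicator)
    finally show ?thesis .
  qed
  have "sqrt y * \<bar>sqrt y\<bar> = y" for y
  proof (cases "0 \<le> y")
    case False
    then have "sqrt y = - sqrt (- y)" "0 \<le> - y"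
      by (simp_all add: real_sqrt_minus)
    then show ?thesis by simp
  qed simp
  then have Am[measurable]: "random_variable borel A"
    using A_meas[of A] by (simp add: A_def[abs_def])
  define Z where "Z \<omega> = exp (p T * Y T \<omega> - p 0 * y0 + v * A \<omega> - a * (LBINT s:{0..T}. p s))" for \<omega>
  have ZQ: "AE \<omega> in M. Z \<omega> = exp (Qx T \<omega>)"
    using Y0 by eventually_elim (simp add: Z_def Qx_def A_def)
  define d where "d K i l \<omega> = \<sigma> * p (g i l) * h i l \<omega> * of_bool ((\<Sum>l'\<le>l. (h i l' \<omega>)\<^sup>2 * \<Delta> i l') \<le> real K)"
    for K :: nat and i l \<omega>
  have dF: "d K i l \<in> borel_measurable (F (g i l))" if l: "l < k i" for K i l
  proof -
    have hl: "h i l' \<in> borel_measurable (F (g i l))" if "l' \<le> l" for l'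
      using that l grid_mono[of "k i" "g i" l' l] grid_less by (intro measurable_F_mono[OF _ hF]) auto
    have [measurable]: "(\<lambda>\<omega>. \<Sum>l'\<le>l. (h i l' \<omega>)\<^sup>2 * \<Delta> i l') \<in> borel_measurable (F (g i l))"
      by (intro borel_measurable_sum borel_measurable_times borel_measurable_power hl) auto
    show ?thesis
      unfolding d_def using hl[of l] by measurable
  qed
  have \<Delta>0: "0 < \<Delta> i l" if "l < k i" for i l
    using grid_less[OF that] by (simp add: \<Delta>_def)
  have gr: "0 \<le> g i l" if "l \<le> k i" for i l
    using grid_range[OF that] by simp
  have dWJ: "random_variable borel (dW i l)" "random_variable borel (dJ i l)" if "l < k i" for i l
    unfolding dW_def dJ_def using that by (auto intro!: borel_measurable_diff W_measurable J_measurable gr)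
  have pneg: "p (g i l) \<le> 0" if "l < k i" for i l
    by (rule p_neg[OF grid_range]) (use that in simp)
  have q0: "0 \<le> (h i l \<omega>)\<^sup>2 * \<Delta> i l" if "l < k i" for i l \<omega>
    using \<Delta>0[OF that] by simp
  define X where "X i e r \<omega> = (\<Sum>l<k i. e l \<omega> * dW i l \<omega> - (e l \<omega>)\<^sup>2 * \<Delta> i l / 2 + r l * dJ i l \<omega>)" for i e r \<omega>
  have expm: "random_variable borel (\<lambda>\<omega>. exp (X i e r \<omega>))"
    if e: "\<And>l. l < k i \<Longrightarrow> random_variable borel (e l)" for i e r
  proof -
    have "random_variable borel (X i e r)"
      unfolding X_def
    proof (rule borel_measurable_sum)
      fix l assume "l \<in> {..<k i}"
      then have [measurable]: "random_variable borel (e l)" "random_variable borel (dW i l)" "random_variable borel (dJ i l)"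
        using e dWJ by auto
      show "random_variable borel (\<lambda>\<omega>. e l \<omega> * dW i l \<omega> - (e l \<omega>)\<^sup>2 * \<Delta> i l / 2 + r l * dJ i l \<omega>)"
        by measurable
    qed
    then show ?thesis
      by (rule measurable_compose[OF _ borel_measurable_exp])
  qed
  define Z' where "Z' K i \<omega> = exp (X i (d K i) (\<lambda>l. p (g i l)) \<omega>)" for K i \<omega>
  have Z'm[measurable]: "random_variable borel (Z' K i)" for K i
    unfolding Z'_def by (rule expm) (rule measurable_F_M[OF dF])
  have Z'nn: "(\<integral>\<^sup>+\<omega>. ennreal (Z' K i \<omega>) \<partial>M) = ennreal (exp (\<Sum>l<k i. \<Delta> i l * levy_exponent m (p (g i l))))" for K i
    unfolding Z'_def X_def \<Delta>_def dW_def dJ_def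
    by (rule exponential_martingale[where g="g i" and k="k i" and d="d K i" and p="\<lambda>l. p (g i l)"])
      (use gr[of 0 i] grid_less dF pneg in auto)
  have Z'int: "integrable M (Z' K i)" for K i
    by (rule integrableI_nonneg) (auto simp: Z'nn Z'_def[symmetric] intro: Z'm, simp add: Z'_def)
  have Z'exp: "expectation (Z' K i) = exp (\<Sum>l<k i. \<Delta> i l * levy_exponent m (p (g i l)))" for K i
    using Z'nn[of K i] by (intro integral_eq_nn_integral[THEN trans]) (auto simp: Z'_def)
  have lim: "(\<lambda>i. expectation (Z' K i)) \<longlonglongrightarrow> exp (LBINT s:{0..T}. levy_exponent m (p s))" for K
    unfolding Z'exp \<Delta>_def
  proof (intro tendsto_exp riemann_sum_tendsto[where C="C * P"] int_lev)
    fix s r assume sr: "s \<in> {0..T}" "r \<in> {0..T}"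
    have "\<bar>levy_exponent m (p s) - levy_exponent m (p r)\<bar> \<le> C * \<bar>p s - p r\<bar>"
      by (intro lip p_neg sr)
    also have "\<dots> \<le> C * (P * \<bar>s - r\<bar>)"
      by (intro mult_left_mono P(4) sr C)
    finally show "\<bar>levy_exponent m (p s) - levy_exponent m (p r)\<bar> \<le> C * P * \<bar>s - r\<bar>"
      by (simp add: mult.assoc)
  qed (use C P in auto)
  have dJ_nonneg: "AE \<omega> in M. \<forall>i. \<forall>l<k i. 0 \<le> dJ i l \<omega>"
    using AE_J_mono
  proof eventually_elim
    case (elim \<omega>)
    have "0 \<le> dJ i l \<omega>" if "l < k i" for i l
      unfolding dJ_def using elim[rule_format, of "g i l" "g i (Suc l)"] gr[of l i] grid_less[OF that] that by simp
    then show ?case by blast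
  qed
  have qvb: "(\<Sum>l<k i. (d K i l \<omega>)\<^sup>2 * \<Delta> i l) \<le> \<sigma>\<^sup>2 * P\<^sup>2 * real K" for K i \<omega>
  proof -
    have "(\<Sum>l<k i. (d K i l \<omega>)\<^sup>2 * \<Delta> i l) \<le> (\<Sum>l<k i. \<sigma>\<^sup>2 * P\<^sup>2 * ((h i l \<omega>)\<^sup>2 * \<Delta> i l * of_bool ((\<Sum>l'\<le>l. (h i l' \<omega>)\<^sup>2 * \<Delta> i l') \<le> real K)))"
    proof (rule sum_mono)
      fix l assume l: "l \<in> {..<k i}"
      have "(p (g i l))\<^sup>2 \<le> P\<^sup>2"
        using power_mono[OF P(2)[OF grid_range[of l i]], of 2] l by simp
      then have "\<sigma>\<^sup>2 * (p (g i l))\<^sup>2 * ((h i l \<omega>)\<^sup>2 * \<Delta> i l) \<le> \<sigma>\<^sup>2 * P\<^sup>2 * ((h i l \<omega>)\<^sup>2 * \<Delta> i l)"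
        using \<Delta>0[of l i] l by (intro mult_right_mono mult_left_mono) auto
      then show "(d K i l \<omega>)\<^sup>2 * \<Delta> i l \<le> \<sigma>\<^sup>2 * P\<^sup>2 * ((h i l \<omega>)\<^sup>2 * \<Delta> i l * of_bool ((\<Sum>l'\<le>l. (h i l' \<omega>)\<^sup>2 * \<Delta> i l') \<le> real K))"
        by (auto simp: d_def power_mult_distrib mult.assoc)
    qed
    also have "\<dots> = \<sigma>\<^sup>2 * P\<^sup>2 * (\<Sum>l<k i. (h i l \<omega>)\<^sup>2 * \<Delta> i l * of_bool ((\<Sum>l'\<le>l. (h i l' \<omega>)\<^sup>2 * \<Delta> i l') \<le> real K))"
      by (rule sum_distrib_left[symmetric])
    also have "\<dots> \<le> \<sigma>\<^sup>2 * P\<^sup>2 * real K"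
      using q0 by (intro mult_left_mono sum_stopped_le) auto
    finally show ?thesis .
  qed
  \<comment> \<open>The square of the exponential for \<open>d\<close> is at most the exponential for \<open>2 * d\<close>, which has expectation \<open>1\<close>, times the exponential
    of the bounded quadratic variation; the increments of \<open>J\<close> are dropped, which means slope \<open>0\<close>.\<close>
  have sq: "(\<integral>\<^sup>+\<omega>. ennreal ((Z' K i \<omega>)\<^sup>2) \<partial>M) \<le> ennreal (exp (\<sigma>\<^sup>2 * P\<^sup>2 * real K))" for K i
  proof -
    have "(\<integral>\<^sup>+\<omega>. ennreal ((Z' K i \<omega>)\<^sup>2) \<partial>M) \<le> (\<integral>\<^sup>+\<omega>. ennreal (exp (\<sigma>\<^sup>2 * P\<^sup>2 * real K)) *
       ennreal (exp (X i (\<lambda>l \<omega>. 2 * d K i l \<omega>) (\<lambda>_. 0) \<omega>)) \<partial>M)"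
    proof (rule nn_integral_mono_AE)
      show "AE \<omega> in M. ennreal ((Z' K i \<omega>)\<^sup>2) \<le> ennreal (exp (\<sigma>\<^sup>2 * P\<^sup>2 * real K)) *
       ennreal (exp (X i (\<lambda>l \<omega>. 2 * d K i l \<omega>) (\<lambda>_. 0) \<omega>))"
        using dJ_nonneg
      proof eventually_elim
        case (elim \<omega>)
        have "2 * X i (d K i) (\<lambda>l. p (g i l)) \<omega> \<le>
          (\<Sum>l<k i. ((d K i l \<omega>)\<^sup>2 * \<Delta> i l) + ((2 * d K i l \<omega>) * dW i l \<omega> - (2 * d K i l \<omega>)\<^sup>2 * \<Delta> i l / 2 + 0 * dJ i l \<omega>))"
          unfolding X_def sum_distrib_left
        proof (rule sum_mono)
          fix l assume l: "l \<in> {..<k i}"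
          have "p (g i l) * dJ i l \<omega> \<le> 0"
            using p_neg[OF grid_range[of l i]] elim l by (intro mult_nonpos_nonneg) auto
          then show "2 * (d K i l \<omega> * dW i l \<omega> - (d K i l \<omega>)\<^sup>2 * \<Delta> i l / 2 + p (g i l) * dJ i l \<omega>) \<le>
            ((d K i l \<omega>)\<^sup>2 * \<Delta> i l) + ((2 * d K i l \<omega>) * dW i l \<omega> - (2 * d K i l \<omega>)\<^sup>2 * \<Delta> i l / 2 + 0 * dJ i l \<omega>)"
            by (simp add: power_mult_distrib algebra_simps)
        qed
        also have "\<dots> = (\<Sum>l<k i. (d K i l \<omega>)\<^sup>2 * \<Delta> i l) +
          (X i (\<lambda>l \<omega>. 2 * d K i l \<omega>) (\<lambda>_. 0) \<omega>)"
          unfolding X_def by (rule sum.distrib)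
        also have "\<dots> \<le> \<sigma>\<^sup>2 * P\<^sup>2 * real K + (X i (\<lambda>l \<omega>. 2 * d K i l \<omega>) (\<lambda>_. 0) \<omega>)"
          by (intro add_right_mono qvb)
        finally have "exp (2 * X i (d K i) (\<lambda>l. p (g i l)) \<omega>) \<le>
          exp (\<sigma>\<^sup>2 * P\<^sup>2 * real K + (X i (\<lambda>l \<omega>. 2 * d K i l \<omega>) (\<lambda>_. 0) \<omega>))"
          by (simp only: exp_le_cancel_iff)
        then show ?case
          unfolding Z'_def exp_double[symmetric] exp_add ennreal_mult[OF exp_ge_zero exp_ge_zero, symmetric]
          by (rule ennreal_leI)
      qed
    qed
    also have "\<dots> = ennreal (exp (\<sigma>\<^sup>2 * P\<^sup>2 * real K)) *
      (\<integral>\<^sup>+\<omega>. ennreal (exp (X i (\<lambda>l \<omega>. 2 * d K i l \<omega>) (\<lambda>_. 0) \<omega>)) \<partial>M)"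
    proof (rule nn_integral_cmult)
      have "random_variable borel (\<lambda>\<omega>. exp (X i (\<lambda>l \<omega>. 2 * d K i l \<omega>) (\<lambda>_. 0) \<omega>))"
        by (rule expm[of i "\<lambda>l \<omega>. 2 * d K i l \<omega>" "\<lambda>_. 0"])
          (intro borel_measurable_times borel_measurable_const measurable_F_M[OF dF])
      then show "(\<lambda>\<omega>. ennreal (exp (X i (\<lambda>l \<omega>. 2 * d K i l \<omega>) (\<lambda>_. 0) \<omega>))) \<in> borel_measurable M"
        by (rule measurable_compose[OF _ measurable_ennreal])
    qed
    also have "(\<integral>\<^sup>+\<omega>. ennreal (exp (X i (\<lambda>l \<omega>. 2 * d K i l \<omega>) (\<lambda>_. 0) \<omega>)) \<partial>M) =
      ennreal (exp (\<Sum>l<k i. \<Delta> i l * levy_exponent m 0))"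
      unfolding X_def \<Delta>_def dW_def dJ_def
    proof (rule exponential_martingale[where g="g i" and k="k i" and d="\<lambda>l \<omega>. 2 * d K i l \<omega>" and p="\<lambda>_. 0"])
      show "(\<lambda>\<omega>. 2 * d K i l \<omega>) \<in> borel_measurable (F (g i l))" if "l < k i" for l
        by (intro borel_measurable_times dF[OF that] borel_measurable_const)
    qed (use gr[of 0 i] grid_less in auto)
    finally show ?thesis
      by (simp add: levy_exponent_def set_lebesgue_integral_def)
  qed
  have sqm: "random_variable borel (\<lambda>\<omega>. (Z' K i \<omega>)\<^sup>2)" for K i
    by measurable
  have sqint: "integrable M (\<lambda>\<omega>. (Z' K i \<omega>)\<^sup>2)" for K i
    by (rule integrableI_nonneg[OF sqm]) (auto intro: le_less_trans[OF sq])
  have sqexp: "expectation (\<lambda>\<omega>. (Z' K i \<omega>)\<^sup>2) \<le> exp (\<sigma>\<^sup>2 * P\<^sup>2 * real K)" for K i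
  proof -
    have "ennreal (expectation (\<lambda>\<omega>. (Z' K i \<omega>)\<^sup>2)) = (\<integral>\<^sup>+\<omega>. ennreal ((Z' K i \<omega>)\<^sup>2) \<partial>M)"
      by (rule nn_integral_eq_integral[symmetric, OF sqint]) simp
    then have "ennreal (expectation (\<lambda>\<omega>. (Z' K i \<omega>)\<^sup>2)) \<le> ennreal (exp (\<sigma>\<^sup>2 * P\<^sup>2 * real K))"
      using sq[of K i] by simp
    then show ?thesis
      by (subst (asm) ennreal_le_iff) auto
  qed
  have stopped: "\<exists>j\<le>k i. Z' K i \<omega> \<le> exp (Sx i j \<omega>) \<and> ((\<Sum>l<k i. (h i l \<omega>)\<^sup>2 * \<Delta> i l) \<le> real K \<longrightarrow> Z' K i \<omega> = exp (Sx i (k i) \<omega>))"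
    if pos: "\<And>l. l < k i \<Longrightarrow> 0 \<le> dJ i l \<omega>" for K i \<omega>
  proof -
    let ?q = "\<lambda>l. (h i l \<omega>)\<^sup>2 * \<Delta> i l"
    let ?s = "\<lambda>l. \<sigma> * p (g i l) * h i l \<omega> * dW i l \<omega> - (\<sigma> * p (g i l) * h i l \<omega>)\<^sup>2 * \<Delta> i l / 2 + p (g i l) * dJ i l \<omega>"
    let ?t = "\<lambda>l. d K i l \<omega> * dW i l \<omega> - (d K i l \<omega>)\<^sup>2 * \<Delta> i l / 2 + p (g i l) * dJ i l \<omega>"
    have q0: "0 \<le> ?q l" if "l < k i" for l
      using \<Delta>0[OF that] by simp
    obtain j where j: "j \<le> k i" "\<And>l. l < k i \<Longrightarrow> (\<Sum>l'\<le>l. ?q l') \<le> real K \<longleftrightarrow> l < j" "(\<Sum>l<k i. ?q l) \<le> real K \<Longrightarrow> j = k i"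
      by (rule sum_stopped_index[where q="?q" and k="k i" and K="real K"]) (use q0 in blast)+
    have "(\<Sum>l<k i. ?t l) \<le> (\<Sum>l<k i. if l < j then ?s l else 0)"
    proof (rule sum_mono)
      fix l assume l: "l \<in> {..<k i}"
      have "p (g i l) * dJ i l \<omega> \<le> 0"
        using p_neg[OF grid_range[of l i]] pos l by (intro mult_nonpos_nonneg) auto
      then show "?t l \<le> (if l < j then ?s l else 0)"
        using j(2)[of l] l by (auto simp: d_def)
    qed
    also have "\<dots> = Sx i j \<omega>"
      unfolding Sx_def using j(1) by (intro sum.mono_neutral_cong_right) auto
    finally have "Z' K i \<omega> \<le> exp (Sx i j \<omega>)"
      unfolding Z'_def X_def by simp
    moreover have "Z' K i \<omega> = exp (Sx i (k i) \<omega>)" if "(\<Sum>l<k i. ?q l) \<le> real K"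
    proof -
      have "d K i l \<omega> = \<sigma> * p (g i l) * h i l \<omega>" if "l < k i" for l
        using j(2)[OF that] j(3)[OF \<open>(\<Sum>l<k i. ?q l) \<le> real K\<close>] that by (simp add: d_def)
      then show ?thesis
        unfolding Z'_def X_def Sx_def by simp
    qed
    ultimately show ?thesis using j(1) by blast
  qed
  have ev: "AE \<omega> in M. \<forall>\<^sub>F i in sequentially. Z' K i \<omega> \<le> exp (B + 1)" for K
    using path Qbound dJ_nonneg
  proof eventually_elim
    case (elim \<omega>)
    from elim(1) obtain e where e: "e \<longlonglongrightarrow> 0" "\<And>i j. j \<le> k i \<Longrightarrow> \<bar>Sx i j \<omega> - Qx (g i j) \<omega>\<bar> \<le> e i"
      by blast
    from order_tendstoD(2)[OF e(1), of 1] have "\<forall>\<^sub>F i in sequentially. e i < 1" by simp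
    then show ?case
    proof eventually_elim
      case (elim i)
      obtain j where j: "j \<le> k i" "Z' K i \<omega> \<le> exp (Sx i j \<omega>)"
        using stopped[of i \<omega> K] \<open>\<forall>i. \<forall>l<k i. 0 \<le> dJ i l \<omega>\<close> by blast
      have "Sx i j \<omega> \<le> B + 1"
        using e(2)[OF j(1)] elim \<open>\<forall>t\<in>{0..T}. Qx t \<omega> \<le> B\<close>[rule_format, OF grid_range[OF j(1)]] by linarith
      then have "exp (Sx i j \<omega>) \<le> exp (B + 1)" by simp
      with j(2) show ?case by (rule order_trans)
    qed
  qed
  have conv: "AE \<omega> in M. A \<omega> < real K \<longrightarrow> (\<lambda>i. Z' K i \<omega>) \<longlonglongrightarrow> Z \<omega>" for K
    using path dJ_nonneg ZQ
  proof eventually_elim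
    case (elim \<omega>)
    show ?case
    proof
      assume "A \<omega> < real K"
      with elim(1) have "\<forall>\<^sub>F i in sequentially. (\<Sum>l<k i. (h i l \<omega>)\<^sup>2 * \<Delta> i l) < real K"
        by (intro order_tendstoD(2)[of _ "A \<omega>"]) auto
      then have eq: "\<forall>\<^sub>F i in sequentially. exp (Sx i (k i) \<omega>) = Z' K i \<omega>"
      proof eventually_elim
        case (elim i)
        then show ?case
          using stopped[of i \<omega> K] \<open>\<forall>i. \<forall>l<k i. 0 \<le> dJ i l \<omega>\<close> by force
      qed
      from elim(1) obtain e where e: "e \<longlonglongrightarrow> 0" "\<And>i j. j \<le> k i \<Longrightarrow> \<bar>Sx i j \<omega> - Qx (g i j) \<omega>\<bar> \<le> e i"
        by blast
      have "(\<lambda>i. Sx i (k i) \<omega> - Qx T \<omega>) \<longlonglongrightarrow> 0"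
      proof (rule Lim_null_comparison[OF _ e(1)])
        show "\<forall>\<^sub>F i in sequentially. norm (Sx i (k i) \<omega> - Qx T \<omega>) \<le> e i"
          using e(2)[OF order_refl] by (simp add: grid_T)
      qed
      then have "(\<lambda>i. exp (Sx i (k i) \<omega>)) \<longlonglongrightarrow> exp (Qx T \<omega>)"
        by (rule tendsto_exp[OF LIM_zero_cancel])
      from Lim_transform_eventually[OF this eq] show "(\<lambda>i. Z' K i \<omega>) \<longlonglongrightarrow> Z \<omega>"
        by (simp add: elim(3))
    qed
  qed
  have ZL: "AE \<omega> in M. 0 \<le> Z \<omega> \<and> Z \<omega> \<le> exp (B + 1)"
    using ZQ Qbound
  proof eventually_elim
    case (elim \<omega>)
    have "Qx T \<omega> \<le> B"
      using elim(2) T by simp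
    then show ?case using elim(1) by simp
  qed
  have [measurable]: "random_variable borel Z"
    unfolding Z_def by measurable
  have "expectation Z = exp (LBINT s:{0..T}. levy_exponent m (p s))"
    by (rule expectation_eq_of_stopped_approximation[where Z=Z and A=A and Z'=Z' and L="exp (B + 1)"
        and D="\<lambda>K. exp (\<sigma>\<^sup>2 * P\<^sup>2 * real K)"])
      (use ZL Z'int lim sqint sqexp ev conv in \<open>auto simp: Z'_def[symmetric]\<close>, auto simp: Z'_def)
  then show ?thesis
    by (simp add: Z_def[abs_def] A_def)
qed

end

section \<open>The Riccati equation and the transform\<close>

text \<open>For \<open>p, q \<le> 0\<close> and \<open>z > 0\<close> one has \<open>\<bar>exp (z * p) - exp (z * q)\<bar> \<le> z * \<bar>p - q\<bar>\<close>, and \<open>z\<close> is integrable with respect to \<open>m\<close>.\<close>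

lemma levy_exponent_lipschitz:
  assumes m: "levy_measure_pos m" and fin: "(\<integral>\<^sup>+z\<in>{0<..}. ennreal z \<partial>m) < \<infinity>"
  obtains C where "0 \<le> C"
    "\<And>p q. p \<le> 0 \<Longrightarrow> q \<le> 0 \<Longrightarrow> \<bar>levy_exponent m p - levy_exponent m q\<bar> \<le> C * \<bar>p - q\<bar>"
proof -
  have sets_m[measurable_cong]: "sets m = sets borel"
    using m by (simp add: levy_measure_pos_def)
  have Ioi[measurable]: "{0<..} \<in> sets m" by (simp add: sets_m)
  have intz: "set_integrable m {0<..} (\<lambda>z. z)"
    unfolding set_integrable_def
  proof (rule integrableI_bounded)
    have "(\<integral>\<^sup>+z. ennreal (norm (indicat_real {0<..} z *\<^sub>R z)) \<partial>m) = (\<integral>\<^sup>+z\<in>{0<..}. ennreal z \<partial>m)"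
      by (rule nn_integral_cong) (simp add: indicator_def)
    then show "(\<integral>\<^sup>+z. ennreal (norm (indicat_real {0<..} z *\<^sub>R z)) \<partial>m) < \<infinity>"
      using fin by simp
  qed measurable
  define C where "C = (LINT z:{0<..}|m. z)"
  have C0: "0 \<le> C"
    unfolding C_def set_lebesgue_integral_def by (rule integral_nonneg_AE) (auto simp: indicator_def)
  have exp_lip: "\<bar>exp (z * p) - exp (z * q)\<bar> \<le> z * \<bar>p - q\<bar>" if "0 < z" "p \<le> 0" "q \<le> 0" for z p q :: real
  proof -
    have "norm (exp (z * p) - exp (z * q)) \<le> 1 * norm (z * p - z * q)"
    proof (rule field_differentiable_bound[where f=exp and f'=exp and S="{..0}"])
      show "z * p \<in> {..0}" "z * q \<in> {..0}"
        using that by (auto simp: mult_nonneg_nonpos)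
    qed (auto intro: DERIV_subset[OF DERIV_exp])
    then show ?thesis
      using that by (simp add: right_diff_distrib[symmetric] abs_mult)
  qed
  have int: "set_integrable m {0<..} (\<lambda>z. exp (z * p) - 1)" if p: "p \<le> 0" for p
    unfolding set_integrable_def
  proof (rule Bochner_Integration.integrable_bound)
    show "integrable m (\<lambda>z. indicat_real {0<..} z *\<^sub>R (\<bar>p\<bar> * z))"
      using set_integrable_mult_right[OF intz, of "\<bar>p\<bar>"] by (simp add: set_integrable_def)
    show "AE z in m. norm (indicat_real {0<..} z *\<^sub>R (exp (z * p) - 1)) \<le> norm (indicat_real {0<..} z *\<^sub>R (\<bar>p\<bar> * z))"
    proof (rule AE_I2)
      fix z
      show "norm (indicat_real {0<..} z *\<^sub>R (exp (z * p) - 1)) \<le> norm (indicat_real {0<..} z *\<^sub>R (\<bar>p\<bar> * z))"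
      proof (cases "0 < z")
        case True
        have "\<bar>exp (z * p) - 1\<bar> \<le> z * \<bar>p\<bar>"
          using exp_lip[OF True p, of 0] by simp
        then show ?thesis
          using True by (simp add: abs_mult mult.commute)
      qed simp
    qed
  qed measurable
  have "\<bar>levy_exponent m p - levy_exponent m q\<bar> \<le> C * \<bar>p - q\<bar>" if pq: "p \<le> 0" "q \<le> 0" for p q
  proof -
    have "levy_exponent m p - levy_exponent m q = (LINT z:{0<..}|m. (exp (z * p) - 1) - (exp (z * q) - 1))"
      unfolding levy_exponent_def by (rule set_integral_diff(2)[symmetric]) (intro int pq)+
    also have "\<bar>\<dots>\<bar> \<le> (LINT z|m. \<bar>indicat_real {0<..} z *\<^sub>R ((exp (z * p) - 1) - (exp (z * q) - 1))\<bar>)"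
      unfolding set_lebesgue_integral_def by (rule integral_abs_bound)
    also have "\<dots> \<le> (LINT z|m. indicat_real {0<..} z *\<^sub>R (\<bar>p - q\<bar> * z))"
    proof (rule integral_mono)
      show "integrable m (\<lambda>z. \<bar>indicat_real {0<..} z *\<^sub>R ((exp (z * p) - 1) - (exp (z * q) - 1))\<bar>)"
        using set_integral_diff(1)[OF int[OF pq(1)] int[OF pq(2)]]
        unfolding set_integrable_def by (rule integrable_abs)
      show "integrable m (\<lambda>z. indicat_real {0<..} z *\<^sub>R (\<bar>p - q\<bar> * z))"
        using set_integrable_mult_right[OF intz, of "\<bar>p - q\<bar>"] by (simp add: set_integrable_def)
      show "\<bar>indicat_real {0<..} z *\<^sub>R ((exp (z * p) - 1) - (exp (z * q) - 1))\<bar> \<le> indicat_real {0<..} z *\<^sub>R (\<bar>p - q\<bar> * z)" for z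
        using exp_lip[of z p q] pq by (auto simp: indicator_def mult.commute)
    qed
    also have "\<dots> = C * \<bar>p - q\<bar>"
    proof -
      have "(LINT z:{0<..}|m. \<bar>p - q\<bar> * z) = \<bar>p - q\<bar> * C"
        unfolding C_def by (rule set_integral_mult_right)
      then show ?thesis
        unfolding set_lebesgue_integral_def by (simp only: mult.commute[of C])
    qed
    finally show ?thesis .
  qed
  with C0 show thesis by (rule that)
qed

text \<open>The numerator of the Riccati equation for a quotient of linear combinations of \<open>c = cosh\<close> and \<open>s = sinh\<close>, after
  multiplication by twice the squared denominator; \<open>q\<close> stands for \<open>\<sigma>\<^sup>2\<close>.\<close>

lemma riccati_identity:
  fixes g c s u v b q :: real
  assumes "g * g = b * b - 2 * q * v" "c * c = s * s + 1"
  shows "g * ((u * g * s + (2 * v - u * b) * c) * (g * c + (b - q * u) * s) - (u * g * c + (2 * v - u * b) * s) * (g * s + (b - q * u) * c)) =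
    q * (u * g * c + (2 * v - u * b) * s)\<^sup>2 - 2 * b * ((u * g * c + (2 * v - u * b) * s) * (g * c + (b - q * u) * s)) +
    2 * v * (g * c + (b - q * u) * s)\<^sup>2"
  using assms by algebra

text \<open>Since \<open>u\<close> and \<open>v\<close> are nonpositive, \<open>\<bar>b\<bar> \<le> \<gamma>\<close> and \<open>\<bar>sinh\<bar> < cosh\<close>, the denominator is positive and the numerator is nonpositive. In the degenerate
  case \<open>v = b = 0\<close> the equation is \<open>\<psi>' = \<sigma>\<^sup>2 / 2 * \<psi>\<^sup>2\<close>.\<close>

lemma cir_psi_riccati:
  assumes \<sigma>: "0 < \<sigma>" and uv: "u \<le> 0" "v \<le> 0" and t: "0 \<le> t"
  shows "cir_psi b \<sigma> u v t \<le> 0"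
    and "(cir_psi b \<sigma> u v has_real_derivative (\<sigma>\<^sup>2 / 2 * (cir_psi b \<sigma> u v t)\<^sup>2 - b * cir_psi b \<sigma> u v t + v)) (at t)"
proof -
  have "cir_psi b \<sigma> u v t \<le> 0 \<and> (cir_psi b \<sigma> u v has_real_derivative (\<sigma>\<^sup>2 / 2 * (cir_psi b \<sigma> u v t)\<^sup>2 - b * cir_psi b \<sigma> u v t + v)) (at t)"
  proof (cases "v < 0 \<or> b \<noteq> 0")
    case True
    define g where "g = cir_gamma b \<sigma> v"
    have \<sigma>v: "\<sigma>\<^sup>2 * v \<le> 0" using uv by (simp add: mult_nonneg_nonpos)
    have pos: "0 < b\<^sup>2 - 2 * \<sigma>\<^sup>2 * v"
    proof (cases "v < 0")
      case True
      then have "\<sigma>\<^sup>2 * v < 0" using \<sigma> by (simp add: mult_pos_neg)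
      then show ?thesis using zero_le_power2[of b] by linarith
    next
      case False
      then have "0 < b\<^sup>2" using True by simp
      then show ?thesis using \<sigma>v by linarith
    qed
    have g: "0 < g" "\<bar>b\<bar> \<le> g" "g * g = b * b - 2 * \<sigma>\<^sup>2 * v"
      using pos \<sigma>v \<sigma>v[unfolded mult.commute[of "\<sigma>\<^sup>2" v]] by (auto simp: g_def cir_gamma_def power2_eq_square[symmetric] intro!: real_le_rsqrt)
    define N where "N x = u * g * cosh (g * x / 2) + (2 * v - u * b) * sinh (g * x / 2)" for x
    define D where "D x = g * cosh (g * x / 2) + (b - \<sigma>\<^sup>2 * u) * sinh (g * x / 2)" for x
    have psi: "cir_psi b \<sigma> u v x = N x / D x" for x
      using True by (simp add: cir_psi_def N_def D_def g_def[symmetric] Let_def add.commute)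
    define c where "c = cosh (g * t / 2)"
    define s where "s = sinh (g * t / 2)"
    have cs: "0 \<le> s" "s < c" "c * c = s * s + 1"
      using g(1) t sinh_less_cosh_real[of "g * t / 2"] cosh_square_eq[of "g * t / 2"]
      by (auto simp: c_def s_def power2_eq_square)
    have bs: "\<bar>b * s\<bar> < g * c"
    proof -
      have "\<bar>b * s\<bar> \<le> g * s"
        unfolding abs_mult using g cs by (intro mult_mono) auto
      also have "\<dots> < g * c" using g(1) cs(2) by simp
      finally show ?thesis .
    qed
    have "0 \<le> - (\<sigma>\<^sup>2 * u) * s"
      using uv(1) cs(1) by (intro mult_nonneg_nonneg) (auto simp: mult_nonneg_nonpos)
    then have D0: "0 < D t"
      using bs by (simp add: D_def c_def[symmetric] s_def[symmetric] left_diff_distrib)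
    have "u * (g * c - b * s) \<le> 0"
      using uv(1) bs by (intro mult_nonpos_nonneg) auto
    moreover have "v * s \<le> 0"
      using uv(2) cs(1) by (rule mult_nonpos_nonneg)
    ultimately have N0: "N t \<le> 0"
      by (simp add: N_def c_def[symmetric] s_def[symmetric] algebra_simps)
    have Nd: "(N has_real_derivative g / 2 * (u * g * s + (2 * v - u * b) * c)) (at t)"
      unfolding N_def[abs_def] s_def c_def by (auto intro!: derivative_eq_intros simp: algebra_simps)
    have Dd: "(D has_real_derivative g / 2 * (g * s + (b - \<sigma>\<^sup>2 * u) * c)) (at t)"
      unfolding D_def[abs_def] s_def c_def by (auto intro!: derivative_eq_intros simp: algebra_simps)
    have Nt: "N t = u * g * c + (2 * v - u * b) * s" and Dt: "D t = g * c + (b - \<sigma>\<^sup>2 * u) * s"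
      by (simp_all add: N_def D_def c_def s_def)
    have id: "g * ((u * g * s + (2 * v - u * b) * c) * D t - N t * (g * s + (b - \<sigma>\<^sup>2 * u) * c)) =
      \<sigma>\<^sup>2 * (N t)\<^sup>2 - 2 * b * (N t * D t) + 2 * v * (D t)\<^sup>2"
      unfolding Nt Dt using g(3) cs(3) by (rule riccati_identity)
    have "((\<lambda>x. N x / D x) has_real_derivative
      (g / 2 * (u * g * s + (2 * v - u * b) * c) * D t - N t * (g / 2 * (g * s + (b - \<sigma>\<^sup>2 * u) * c))) / (D t * D t)) (at t)"
      using D0 by (intro DERIV_divide Nd Dd) simp
    also have "(g / 2 * (u * g * s + (2 * v - u * b) * c) * D t - N t * (g / 2 * (g * s + (b - \<sigma>\<^sup>2 * u) * c))) =
      g * ((u * g * s + (2 * v - u * b) * c) * D t - N t * (g * s + (b - \<sigma>\<^sup>2 * u) * c)) / 2"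
      by (simp add: field_simps)
    also have "\<dots> / (D t * D t) = \<sigma>\<^sup>2 / 2 * (N t / D t)\<^sup>2 - b * (N t / D t) + v"
      unfolding id using D0 by (simp add: field_simps power2_eq_square)
    finally show ?thesis
      using N0 D0 unfolding psi by (simp add: psi[abs_def] divide_nonpos_pos)
  next
    case False
    then have vb: "v = 0" "b = 0" using uv by auto
    define D where "D x = 1 - \<sigma>\<^sup>2 * u / 2 * x" for x
    have psi: "cir_psi b \<sigma> u v x = u / D x" for x
      using False by (simp add: cir_psi_def D_def)
    have "\<sigma>\<^sup>2 * u * t \<le> 0"
      using uv(1) t by (intro mult_nonpos_nonneg mult_nonneg_nonpos) auto
    then have D0: "0 < D t" by (simp add: D_def)
    have Dd: "(D has_real_derivative - (\<sigma>\<^sup>2 * u / 2)) (at t)"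
      unfolding D_def[abs_def] by (auto intro!: derivative_eq_intros)
    have "((\<lambda>x. u / D x) has_real_derivative (0 * D t - u * - (\<sigma>\<^sup>2 * u / 2)) / (D t * D t)) (at t)"
      using D0 by (intro DERIV_divide DERIV_const Dd) simp
    also have "(0 * D t - u * - (\<sigma>\<^sup>2 * u / 2)) / (D t * D t) = \<sigma>\<^sup>2 / 2 * (u / D t)\<^sup>2 - b * (u / D t) + v"
      using D0 by (simp add: vb field_simps power2_eq_square)
    finally show ?thesis
      using uv(1) D0 unfolding psi by (simp add: psi[abs_def] divide_nonpos_pos)
  qed
  then show "cir_psi b \<sigma> u v t \<le> 0"
    and "(cir_psi b \<sigma> u v has_real_derivative (\<sigma>\<^sup>2 / 2 * (cir_psi b \<sigma> u v t)\<^sup>2 - b * cir_psi b \<sigma> u v t + v)) (at t)"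
    by auto
qed

lemma cir_psi_0:
  assumes "0 < \<sigma>" "v \<le> 0"
  shows "cir_psi b \<sigma> u v 0 = u"
proof (cases "v < 0 \<or> b \<noteq> 0")
  case True
  have "b\<^sup>2 - 2 * \<sigma>\<^sup>2 * v \<noteq> 0"
  proof (cases "v < 0")
    case True
    then have "\<sigma>\<^sup>2 * v < 0" using assms by (simp add: mult_pos_neg)
    then show ?thesis using zero_le_power2[of b] by linarith
  next
    case False
    then show ?thesis using True assms by simp
  qed
  then show ?thesis
    using True by (simp add: cir_psi_def cir_gamma_def Let_def)
qed (simp add: cir_psi_def)

lemma set_integral_reflect:
  fixes f :: "real \<Rightarrow> real"
  shows "(LBINT s:{0..t}. f (t - s)) = (LBINT s:{0..t}. f s)"
proof -
  have "(LBINT s:{0..t}. f s) = (LINT s|lborel. indicator {0..t} (t + (- 1) * s) *\<^sub>R f (t + (- 1) * s))"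
    unfolding set_lebesgue_integral_def
    using lborel_integral_real_affine[of "- 1" "\<lambda>s. indicator {0..t} s *\<^sub>R f s" t] by simp
  also have "\<dots> = (LBINT s:{0..t}. f (t - s))"
    unfolding set_lebesgue_integral_def
    by (intro Bochner_Integration.integral_cong) (auto simp: indicator_def)
  finally show ?thesis by simp
qed

lemma set_integral_singleton: "(LBINT s:{0..0::real}. f s) = (0 :: real)"
proof -
  have "AE s in lborel. indicator {0..0} s *\<^sub>R f s = 0"
    using AE_lborel_singleton[of "0::real"] by eventually_elim simp
  then show ?thesis
    unfolding set_lebesgue_integral_def by (rule integral_eq_zero_AE)
qed

theorem theorem3p1:
  fixes M :: "'a measure" and m :: "real measure"
    and W J Y :: "real \<Rightarrow> 'a \<Rightarrow> real"
    and a b \<sigma> y0 u v t :: real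
  assumes "prob_space M"
    and "0 \<le> a" and "0 < \<sigma>"
    and "levy_measure_pos m"
    and "(\<integral>\<^sup>+z\<in>{0<..}. ennreal z \<partial>m) < \<infinity>"
    and "prob_space.wiener_process M W"
    and "prob_space.subordinator M m J"
    and "prob_space.independent_inputs M (Y 0) W J"
    and "prob_space.strong_solution M a b \<sigma> W J Y"
    and "0 \<le> y0" and "AE \<omega> in M. Y 0 \<omega> = y0"
    and "u \<le> 0" and "v \<le> 0" and "0 \<le> t"
  shows "cir_psi b \<sigma> u v t \<le> 0 \<and>
    prob_space.expectation M (\<lambda>\<omega>. exp (u * Y t \<omega> + v * (LBINT s:{0..t}. Y s \<omega>))) =
      exp (cir_psi b \<sigma> u v t * y0 +
        (LBINT s:{0..t}. a * cir_psi b \<sigma> u v s +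
           (LINT z:{0<..}|m. exp (z * cir_psi b \<sigma> u v s) - 1)))"
proof -
  interpret driving_noise M m "Y 0" W J
    using assms by (auto simp: driving_noise_def driving_noise_axioms_def)
  let ?\<psi> = "cir_psi b \<sigma> u v"
  note solution = assms(9)[unfolded strong_solution_def]
  have Y_measurable: "Y s \<in> borel_measurable M" if "0 \<le> s" for s
    by (rule measurable_F_M[OF solution[THEN conjunct1, rule_format, OF that]])
  have \<psi>_neg: "?\<psi> s \<le> 0" if "0 \<le> s" for s
    by (rule cir_psi_riccati(1)) (use assms that in auto)
  have \<psi>_deriv: "(?\<psi> has_real_derivative (\<sigma>\<^sup>2 / 2 * (?\<psi> s)\<^sup>2 - b * ?\<psi> s + v)) (at s)" if "0 \<le> s" for s
    by (rule cir_psi_riccati(2)) (use assms that in auto)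
  have \<psi>_0: "?\<psi> 0 = u"
    using assms by (intro cir_psi_0)
  have "expectation (\<lambda>\<omega>. exp (u * Y t \<omega> + v * (LBINT s:{0..t}. Y s \<omega>))) =
      exp (?\<psi> t * y0 + (LBINT s:{0..t}. a * ?\<psi> s + levy_exponent m (?\<psi> s)))"
  proof (cases "t = 0")
    case True
    have "expectation (\<lambda>\<omega>. exp (u * Y 0 \<omega>)) = expectation (\<lambda>\<omega>. exp (u * y0))"
    proof (rule integral_cong_AE)
      show "(\<lambda>\<omega>. exp (u * Y 0 \<omega>)) \<in> borel_measurable M"
        using Y_measurable[OF order_refl] by measurable
      show "AE \<omega> in M. exp (u * Y 0 \<omega>) = exp (u * y0)"
        using assms(11) by eventually_elim simp
    qed simp
    then show ?thesis
      unfolding True set_integral_singleton by (simp add: \<psi>_0 prob_space)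
  next
    case False
    then have t: "0 < t" using assms by simp
    obtain C where C: "0 \<le> C"
      "\<And>p q. p \<le> 0 \<Longrightarrow> q \<le> 0 \<Longrightarrow> \<bar>levy_exponent m p - levy_exponent m q\<bar> \<le> C * \<bar>p - q\<bar>"
      by (rule levy_exponent_lipschitz[OF assms(4,5)]) (rule that; assumption)
    obtain I where ito: "has_ito_integral F W (\<lambda>s \<omega>. sqrt (Y s \<omega>)) I"
      and sde: "AE \<omega> in M. \<forall>t\<ge>0. Y t \<omega> = Y 0 \<omega> + (LBINT s:{0..t}. a - b * Y s \<omega>) + \<sigma> * I t \<omega> + J t \<omega>"
      using solution[THEN conjunct2, THEN conjunct2, THEN conjunct2] by (elim exE conjE) (rule that)
    have Yt: "Y t \<in> borel_measurable M"
      by (rule Y_measurable[OF assms(14)])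
    have cadlag: "cadlag (\<lambda>t. Y t \<omega>)" if "\<omega> \<in> space M" for \<omega>
      by (rule solution[THEN conjunct2, THEN conjunct1, rule_format, OF that])
    have nonneg: "AE \<omega> in M. \<forall>t\<ge>0. 0 \<le> Y t \<omega>"
      by (rule solution[THEN conjunct2, THEN conjunct2, THEN conjunct1])
    have \<psi>_cont: "continuous_on {0..t} ?\<psi>"
      by (rule DERIV_continuous_on[where D="\<lambda>s. \<sigma>\<^sup>2 / 2 * (?\<psi> s)\<^sup>2 - b * ?\<psi> s + v"])
        (rule DERIV_subset[OF \<psi>_deriv], auto)
    have lev_cont: "continuous_on {..0} (levy_exponent m)"
    proof (rule continuous_onI)
      fix x e :: real assume x: "x \<in> {..0}" and e: "0 < e"
      show "\<exists>d>0. \<forall>x'\<in>{..0}. dist x' x < d \<longrightarrow> dist (levy_exponent m x') (levy_exponent m x) \<le> e"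
      proof (intro exI[of _ "e / (C + 1)"] conjI ballI impI)
        show "0 < e / (C + 1)" using e C(1) by simp
        fix x' assume x': "x' \<in> {..0}" "dist x' x < e / (C + 1)"
        have "\<bar>levy_exponent m x' - levy_exponent m x\<bar> \<le> C * \<bar>x' - x\<bar>"
          using x x' by (intro C(2)) auto
        also have "\<dots> \<le> (C + 1) * (e / (C + 1))"
          using x' C(1) by (intro mult_mono) (auto simp: dist_real_def)
        also have "\<dots> = e" using C(1) by simp
        finally show "dist (levy_exponent m x') (levy_exponent m x) \<le> e" by (simp add: dist_real_def)
      qed
    qed
    have int1: "set_integrable lborel {0..t} ?\<psi>"
      using borel_integrable_atLeastAtMost'[OF \<psi>_cont] by (simp add: set_integrable_def)
    have "continuous_on {0..t} (\<lambda>s. levy_exponent m (?\<psi> s))"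
      by (rule continuous_on_compose2[OF lev_cont \<psi>_cont]) (use \<psi>_neg in auto)
    from borel_integrable_atLeastAtMost'[OF this]
    have int2: "set_integrable lborel {0..t} (\<lambda>s. levy_exponent m (?\<psi> s))"
      by (simp add: set_integrable_def)
    have rcont: "continuous_on {0..t} (\<lambda>s. ?\<psi> (t - s))"
      by (rule continuous_on_compose2[OF \<psi>_cont]) (auto intro!: continuous_intros)
    have "continuous_on {0..t} (\<lambda>s. levy_exponent m (?\<psi> (t - s)))"
      by (rule continuous_on_compose2[OF lev_cont rcont]) (use \<psi>_neg in auto)
    from borel_integrable_atLeastAtMost'[OF this]
    have int3: "set_integrable lborel {0..t} (\<lambda>s. levy_exponent m (?\<psi> (t - s)))"
      by (simp add: set_integrable_def)
    \<comment> \<open>The constant that separates the exponent at time \<open>t\<close> from \<open>u * Y t + v * (\<integral>\<^sub>0\<^sup>t Y)\<close>.\<close>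
    define R where "R = exp (?\<psi> t * y0 + a * (LBINT s:{0..t}. ?\<psi> (t - s)))"
    have "expectation (\<lambda>\<omega>. exp (?\<psi> (t - t) * Y t \<omega> - ?\<psi> (t - 0) * y0 + v * (LBINT s:{0..t}. Y s \<omega>) - a * (LBINT s:{0..t}. ?\<psi> (t - s)))) =
      exp (LBINT s:{0..t}. levy_exponent m (?\<psi> (t - s)))"
    proof (rule exponential_functional[where p="\<lambda>s. ?\<psi> (t - s)"
          and p'="\<lambda>s. - (\<sigma>\<^sup>2 / 2 * (?\<psi> (t - s))\<^sup>2 - b * ?\<psi> (t - s) + v)" and b=b and \<sigma>=\<sigma> and C=C])
      fix s assume s: "s \<in> {0..t}"
      have "((\<lambda>s. ?\<psi> (t - s)) has_real_derivative (\<sigma>\<^sup>2 / 2 * (?\<psi> (t - s))\<^sup>2 - b * ?\<psi> (t - s) + v) * (- 1)) (at s)"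
        by (rule DERIV_chain2[OF \<psi>_deriv]) (use s in \<open>auto intro!: derivative_eq_intros\<close>)
      from has_field_derivative_at_within[OF this]
      show "((\<lambda>s. ?\<psi> (t - s)) has_real_derivative - (\<sigma>\<^sup>2 / 2 * (?\<psi> (t - s))\<^sup>2 - b * ?\<psi> (t - s) + v)) (at s within {0..t})"
        by simp
      show "?\<psi> (t - s) \<le> 0" by (rule \<psi>_neg) (use s in simp)
    next
      show "continuous_on {0..t} (\<lambda>s. - (\<sigma>\<^sup>2 / 2 * (?\<psi> (t - s))\<^sup>2 - b * ?\<psi> (t - s) + v))"
        by (intro continuous_intros rcont)
    qed (use t assms cadlag nonneg ito sde Yt C int3 in auto)
    moreover have "exp (?\<psi> (t - t) * Y t \<omega> - ?\<psi> (t - 0) * y0 + v * (LBINT s:{0..t}. Y s \<omega>) - a * (LBINT s:{0..t}. ?\<psi> (t - s))) =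
        exp (u * Y t \<omega> + v * (LBINT s:{0..t}. Y s \<omega>)) / R" for \<omega>
      by (simp add: R_def \<psi>_0 exp_diff[symmetric] algebra_simps)
    ultimately have "expectation (\<lambda>\<omega>. exp (u * Y t \<omega> + v * (LBINT s:{0..t}. Y s \<omega>))) / R =
      exp (LBINT s:{0..t}. levy_exponent m (?\<psi> (t - s)))"
      by simp
    then have "expectation (\<lambda>\<omega>. exp (u * Y t \<omega> + v * (LBINT s:{0..t}. Y s \<omega>))) =
      R * exp (LBINT s:{0..t}. levy_exponent m (?\<psi> (t - s)))"
      by (simp add: R_def field_simps)
    also have "\<dots> = exp (?\<psi> t * y0 + (a * (LBINT s:{0..t}. ?\<psi> s) + (LBINT s:{0..t}. levy_exponent m (?\<psi> s))))"
      using set_integral_reflect[where f="?\<psi>" and t=t] set_integral_reflect[where f="\<lambda>s. levy_exponent m (?\<psi> s)" and t=t]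
      by (simp add: R_def exp_add[symmetric] add.assoc)
    also have "a * (LBINT s:{0..t}. ?\<psi> s) + (LBINT s:{0..t}. levy_exponent m (?\<psi> s)) =
       (LBINT s:{0..t}. a * ?\<psi> s + levy_exponent m (?\<psi> s))"
      using int1 int2 by (simp add: set_integral_add set_integrable_mult_right set_integral_mult_right)
    finally show ?thesis .
  qed
  then show ?thesis
    using \<psi>_neg[OF assms(14)] unfolding levy_exponent_def by blast
qed

end
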